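(* Let $\pi$ be a probability measure on $\mathbb{R}^d$ with a smooth, strictly positive density, also denoted $\pi$, and let $\gamma:\mathbb{R}^d\to\mathbb{R}^d$ be a smooth vector field with $\nabla\cdot(\gamma\pi)=0$. Suppose that: (i) the density $\pi$ is bounded and, for some $0<\beta<1$, $\liminf_{|x|\to\infty}\left((1-\beta)|\nabla\log\pi(x)|^2+\Delta\log\pi(x)\right)>0$; (ii) $\lim_{|x|\to\infty}|\nabla\log\pi(x)|=\infty$; (iii) $\gamma$ is bounded, i.e. $\gamma\in L^\infty(\mathbb{R}^d;\mathbb{R}^d)$. Let $f\in L^2_0(\pi)$ and $\alpha\in\mathbb{R}$, and put $\hat f=(-\mathcal{S})^{-1}f\in\mathcal{H}^1$. Let $\hat f_{\mathcal{N}}$ be the $\mathcal{H}^1$-orthogonal projection of $\hat f$ onto $\mathcal{N}=\operatorname{Ker}\mathcal{A}\subset\mathcal{H}^1$, let $\{e_n\}_{n\ge1}$ be an orthonormal basis of $\mathcal{N}^\perp$ (in the complexification of $\mathcal{H}^1$) consisting of eigenfunctions of $\Gamma$, with corresponding real eigenvalues $\{\lambda_n\}_{n\ge1}$, and let $\hat f_n=\langle\hat f,e_n\rangle_1$. Then the asymptotic variance $\sigma_f^2(\alpha)$ of the observable $f$ for the diffusion $dX_t^\gamma=(\nabla\log\pi(X_t^\gamma)+\alpha\gamma(X_t^\gamma))\,dt+\sqrt2\,dW_t$ is given by $$\sigma_f^2(\alpha)=2\|\hat f_{\mathcal{N}}\|_1^2+2\sum_{n=1}^{\infty}\frac{|\hat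 f_n|^2}{1+\alpha^2\lambda_n^2}.$$ In particular, $$\lim_{\alpha\to0}\sigma_f^2(\alpha)=\sigma_f^2(0)=2\|\hat f\|_1^2\qquad\text{and}\qquad\lim_{\alpha\to\pm\infty}\sigma_f^2(\alpha)=2\|\hat f_{\mathcal{N}}\|_1^2.$$
   Context: $L^2_0(\pi)$ is the space of (real) functions in $L^2(\pi)$ with $\int f\,d\pi=0$, with inner product $\langle\cdot,\cdot\rangle_\pi$ and norm $\|\cdot\|_\pi$. $\mathcal{S}=\nabla\log\pi\cdot\nabla+\Delta$ denotes the nonpositive selfadjoint operator on $L^2_0(\pi)$ associated with the Dirichlet form $\int\nabla f\cdot\nabla g\,d\pi$. $\mathcal{H}^1$ is the Hilbert space of $f\in L^2_0(\pi)$ with $\langle f,(-\mathcal{S})f\rangle_\pi<\infty$ (the form domain, i.e. weak gradient in $L^2(\pi)$), with inner product $\langle f,g\rangle_1=\langle f,(-\mathcal{S})g\rangle_\pi=\int\nabla f\cdot\nabla g\,d\pi$ and norm $\|\cdot\|_1$; $\mathcal{H}^2$ is the domain of $\mathcal{S}$, with norm $\|f\|_2=\|\mathcal{S}f\|_\pi$. Under the stated hypotheses $-\mathcal{S}$ has a spectral gap and is invertible on $L^2_0(\pi)$. $\mathcal{A}=\gamma\cdot\nabla:\mathcal{H}^1\to L^2_0(\pi)$ is a bounded operator, antisymmetric with respect to $\langle\cdot,\cdot\rangle_\pi$. $\mathcal{L}=\mathcal{S}+\alpha\mathcal{A}$ with domain $\mathcal{H}^2$. Asymptotic variance: for $f\in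 L^2_0(\pi)$ let $\phi$ be the unique solution in $\mathcal{H}^1$ of the Poisson equation $-\mathcal{L}\phi=f$; then $\sigma_f^2(\alpha)=2\int|\nabla\phi|^2\,d\pi=2\langle\phi,(-\mathcal{L})\phi\rangle_\pi=2\langle f,(-\mathcal{L})^{-1}f\rangle_\pi$. $\mathcal{G}=(-\mathcal{S})^{-1}\mathcal{A}:\mathcal{H}^1\to\mathcal{H}^1$ is (under the stated hypotheses) compact and skew-adjoint; on the complexification of $\mathcal{H}^1$ write $\mathcal{G}=i\Gamma$ with $\Gamma$ compact and selfadjoint, so that $\operatorname{Ker}\Gamma=\operatorname{Ker}\mathcal{A}=\mathcal{N}$. If $\mathcal{N}^\perp$ is finite dimensional the sum is finite. *)

theory Defs
  imports "HOL-Probability.Probability"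
begin

primrec Ck :: "nat \<Rightarrow> ('a::real_normed_vector \<Rightarrow> 'b::real_normed_vector) \<Rightarrow> bool" where
  "Ck 0 f \<longleftrightarrow> continuous_on UNIV f"
| "Ck (Suc k) f \<longleftrightarrow>
     (\<forall>x. f differentiable (at x)) \<and> (\<forall>v. Ck k (\<lambda>x. frechet_derivative f (at x) v))"

definition smooth :: "('a::real_normed_vector \<Rightarrow> 'b::real_normed_vector) \<Rightarrow> bool" where
  "smooth f \<longleftrightarrow> (\<forall>k. Ck k f)"

definition grad :: "('a::euclidean_space \<Rightarrow> real) \<Rightarrow> 'a \<Rightarrow> 'a" where
  "grad f x = (\<Sum>b\<in>Basis. frechet_derivative f (at x) b *\<^sub>R b)"

definition divergence :: "('a::euclidean_space \<Rightarrow> 'a) \<Rightarrow> 'a \<Rightarrow> real" where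
  "divergence F x = (\<Sum>b\<in>Basis. frechet_derivative F (at x) b \<bullet> b)"

definition laplacian :: "('a::euclidean_space \<Rightarrow> real) \<Rightarrow> 'a \<Rightarrow> real" where
  "laplacian f = divergence (grad f)"

definition test_function :: "('a::euclidean_space \<Rightarrow> real) \<Rightarrow> bool" where
  "test_function \<phi> \<longleftrightarrow> smooth \<phi> \<and> (\<exists>K. compact K \<and> (\<forall>x. x \<notin> K \<longrightarrow> \<phi> x = 0))"

definition locally_integrable :: "('a::euclidean_space \<Rightarrow> 'b::euclidean_space) \<Rightarrow> bool" where
  "locally_integrable f \<longleftrightarrow>
     f \<in> borel_measurable borel \<and> (\<forall>K. compact K \<longrightarrow> set_integrable lborel K f)"

definition weak_gradient :: "('a::euclidean_space \<Rightarrow> real) \<Rightarrow> ('a \<Rightarrow> 'a) \<Rightarrow> bool" where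
  "weak_gradient f g \<longleftrightarrow> locally_integrable f \<and> locally_integrable g \<and>
     (\<forall>\<phi>. test_function \<phi> \<longrightarrow>
        (\<integral>x. f x *\<^sub>R grad \<phi> x \<partial>lborel) = - (\<integral>x. \<phi> x *\<^sub>R g x \<partial>lborel))"

text \<open>Elements of the function spaces below are represented by Borel functions, and equality of
  elements is equality almost everywhere.  A weak gradient is only determined up to a null set;
  \<open>wgrad\<close> selects a representative.\<close>

definition wgrad :: "('a::euclidean_space \<Rightarrow> real) \<Rightarrow> 'a \<Rightarrow> 'a" where
  "wgrad f = (SOME g. weak_gradient f g)"

definition pmeas :: "('a::euclidean_space \<Rightarrow> real) \<Rightarrow> 'a measure" where
  "pmeas p = density lborel (\<lambda>x. ennreal (p x))"

definition L20 :: "('a::euclidean_space \<Rightarrow> real) \<Rightarrow> ('a \<Rightarrow> real) set" where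
  "L20 p = {f. f \<in> borel_measurable borel \<and> integrable (pmeas p) (\<lambda>x. (f x)\<^sup>2) \<and>
               (\<integral>x. f x \<partial>pmeas p) = 0}"

definition H1 :: "('a::euclidean_space \<Rightarrow> real) \<Rightarrow> ('a \<Rightarrow> real) set" where
  "H1 p = {f \<in> L20 p. \<exists>g. weak_gradient f g \<and> integrable (pmeas p) (\<lambda>x. (norm (g x))\<^sup>2)}"

definition inner_p :: "('a::euclidean_space \<Rightarrow> real) \<Rightarrow> ('a \<Rightarrow> real) \<Rightarrow> ('a \<Rightarrow> real) \<Rightarrow> real" where
  "inner_p p f g = (\<integral>x. f x * g x \<partial>pmeas p)"

definition inner_1 :: "('a::euclidean_space \<Rightarrow> real) \<Rightarrow> ('a \<Rightarrow> real) \<Rightarrow> ('a \<Rightarrow> real) \<Rightarrow> real" where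
  "inner_1 p f g = (\<integral>x. wgrad f x \<bullet> wgrad g x \<partial>pmeas p)"

definition norm_1 :: "('a::euclidean_space \<Rightarrow> real) \<Rightarrow> ('a \<Rightarrow> real) \<Rightarrow> real" where
  "norm_1 p f = sqrt (inner_1 p f f)"

text \<open>\<open>S_rel p u h\<close> says that \<open>u\<close> is in the domain of the selfadjoint operator \<open>S\<close> associated with
  the closed form \<open>inner_1 p\<close> on \<open>L\<^sup>2\<^sub>0\<close>, whose form domain is \<open>H\<^sup>1\<close>, and that \<open>S u = h\<close>.\<close>

definition S_rel :: "('a::euclidean_space \<Rightarrow> real) \<Rightarrow> ('a \<Rightarrow> real) \<Rightarrow> ('a \<Rightarrow> real) \<Rightarrow> bool" where
  "S_rel p u h \<longleftrightarrow> u \<in> H1 p \<and> h \<in> L20 p \<and> (\<forall>v\<in>H1 p. inner_p p h v = - inner_1 p u v)"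

definition H2 :: "('a::euclidean_space \<Rightarrow> real) \<Rightarrow> ('a \<Rightarrow> real) set" where
  "H2 p = {u. \<exists>h. S_rel p u h}"

definition S_op :: "('a::euclidean_space \<Rightarrow> real) \<Rightarrow> ('a \<Rightarrow> real) \<Rightarrow> 'a \<Rightarrow> real" where
  "S_op p u = (SOME h. S_rel p u h)"

definition neg_S_inv :: "('a::euclidean_space \<Rightarrow> real) \<Rightarrow> ('a \<Rightarrow> real) \<Rightarrow> 'a \<Rightarrow> real" where
  "neg_S_inv p f = (SOME u. u \<in> H2 p \<and> (AE x in pmeas p. - S_op p u x = f x))"

definition A_op :: "('a::euclidean_space \<Rightarrow> 'a) \<Rightarrow> ('a \<Rightarrow> real) \<Rightarrow> 'a \<Rightarrow> real" where
  "A_op \<gamma> u x = \<gamma> x \<bullet> wgrad u x"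

definition ker_A :: "('a::euclidean_space \<Rightarrow> real) \<Rightarrow> ('a \<Rightarrow> 'a) \<Rightarrow> ('a \<Rightarrow> real) set" where
  "ker_A p \<gamma> = {u \<in> H1 p. AE x in pmeas p. A_op \<gamma> u x = 0}"

definition L_op ::
  "('a::euclidean_space \<Rightarrow> real) \<Rightarrow> ('a \<Rightarrow> 'a) \<Rightarrow> real \<Rightarrow> ('a \<Rightarrow> real) \<Rightarrow> 'a \<Rightarrow> real" where
  "L_op p \<gamma> \<alpha> u x = S_op p u x + \<alpha> * A_op \<gamma> u x"

definition poisson_solution ::
  "('a::euclidean_space \<Rightarrow> real) \<Rightarrow> ('a \<Rightarrow> 'a) \<Rightarrow> real \<Rightarrow> ('a \<Rightarrow> real) \<Rightarrow> ('a \<Rightarrow> real) \<Rightarrow> bool" where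
  "poisson_solution p \<gamma> \<alpha> f \<phi> \<longleftrightarrow>
     \<phi> \<in> H2 p \<and> (AE x in pmeas p. - L_op p \<gamma> \<alpha> \<phi> x = f x)"

text \<open>The solution of the Poisson equation is unique up to null sets, so the number is unique.\<close>

definition asymptotic_variance ::
  "('a::euclidean_space \<Rightarrow> real) \<Rightarrow> ('a \<Rightarrow> 'a) \<Rightarrow> ('a \<Rightarrow> real) \<Rightarrow> real \<Rightarrow> real" where
  "asymptotic_variance p \<gamma> f \<alpha> =
     (THE s. \<exists>\<phi>. poisson_solution p \<gamma> \<alpha> f \<phi> \<and> s = 2 * (\<integral>x. (norm (wgrad \<phi> x))\<^sup>2 \<partial>pmeas p))"

definition proj_1 ::
  "('a::euclidean_space \<Rightarrow> real) \<Rightarrow> ('a \<Rightarrow> real) set \<Rightarrow> ('a \<Rightarrow> real) \<Rightarrow> 'a \<Rightarrow> real" where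
  "proj_1 p N u = (SOME w. w \<in> N \<and> (\<forall>g\<in>N. inner_1 p (\<lambda>x. u x - w x) g = 0))"

definition G_op ::
  "('a::euclidean_space \<Rightarrow> real) \<Rightarrow> ('a \<Rightarrow> 'a) \<Rightarrow> ('a \<Rightarrow> real) \<Rightarrow> 'a \<Rightarrow> real" where
  "G_op p \<gamma> u = neg_S_inv p (A_op \<gamma> u)"

definition cplx_space :: "('a \<Rightarrow> real) set \<Rightarrow> ('a \<Rightarrow> complex) set" where
  "cplx_space U = {f. (\<lambda>x. Re (f x)) \<in> U \<and> (\<lambda>x. Im (f x)) \<in> U}"

definition cplx_op :: "(('a \<Rightarrow> real) \<Rightarrow> 'a \<Rightarrow> real) \<Rightarrow> ('a \<Rightarrow> complex) \<Rightarrow> 'a \<Rightarrow> complex" where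
  "cplx_op T f x = Complex (T (\<lambda>y. Re (f y)) x) (T (\<lambda>y. Im (f y)) x)"

text \<open>Sesquilinear extension of \<open>inner_1\<close>, linear in the first argument.\<close>

definition cinner_1 ::
  "('a::euclidean_space \<Rightarrow> real) \<Rightarrow> ('a \<Rightarrow> complex) \<Rightarrow> ('a \<Rightarrow> complex) \<Rightarrow> complex" where
  "cinner_1 p f g = Complex
     (inner_1 p (\<lambda>x. Re (f x)) (\<lambda>x. Re (g x)) + inner_1 p (\<lambda>x. Im (f x)) (\<lambda>x. Im (g x)))
     (inner_1 p (\<lambda>x. Im (f x)) (\<lambda>x. Re (g x)) - inner_1 p (\<lambda>x. Re (f x)) (\<lambda>x. Im (g x)))"

definition cnorm_1 :: "('a::euclidean_space \<Rightarrow> real) \<Rightarrow> ('a \<Rightarrow> complex) \<Rightarrow> real" where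
  "cnorm_1 p f = sqrt (Re (cinner_1 p f f))"

definition orth_1 ::
  "('a::euclidean_space \<Rightarrow> real) \<Rightarrow> ('a \<Rightarrow> complex) set \<Rightarrow> ('a \<Rightarrow> complex) set" where
  "orth_1 p N = {f \<in> cplx_space (H1 p). \<forall>g\<in>N. cinner_1 p f g = 0}"

definition orthonormal_basis_1 ::
  "('a::euclidean_space \<Rightarrow> real) \<Rightarrow> ('a \<Rightarrow> complex) set \<Rightarrow> nat set \<Rightarrow> (nat \<Rightarrow> 'a \<Rightarrow> complex) \<Rightarrow> bool"
  where
  "orthonormal_basis_1 p U I e \<longleftrightarrow>
     (\<forall>n\<in>I. e n \<in> U) \<and>
     (\<forall>m\<in>I. \<forall>n\<in>I. cinner_1 p (e m) (e n) = (if m = n then 1 else 0)) \<and>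
     (\<forall>g\<in>U. \<forall>\<epsilon>>0. \<exists>J c. finite J \<and> J \<subseteq> I \<and>
        cnorm_1 p (\<lambda>x. g x - (\<Sum>n\<in>J. c n * e n x)) < \<epsilon>)"

text \<open>\<open>\<Gamma> = - \<i> G\<close>, that is, \<open>G = \<i> \<Gamma>\<close>.\<close>

definition Gamma_op ::
  "('a::euclidean_space \<Rightarrow> real) \<Rightarrow> ('a \<Rightarrow> 'a) \<Rightarrow> ('a \<Rightarrow> complex) \<Rightarrow> 'a \<Rightarrow> complex" where
  "Gamma_op p \<gamma> f x = - \<i> * cplx_op (G_op p \<gamma>) f x"

end

theory Submission
  imports Defs
begin

text \<open>
  A weakly differentiable \<open>u\<close> satisfies \<open>u (x + h) - u x = \<integral>\<^sub>0\<^sup>1 g (x + t h) \<bullet> h dt\<close> for almost every \<open>x\<close>. This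
  gives the Poincare inequality on balls and, through difference quotients, the chain rule for \<open>u\<^sup>2\<close>
  without mollification. Expanding \<open>0 \<le> \<integral> |\<nabla>u + \<beta> u \<nabla>log p|\<^sup>2 p\<close>, which is the Lyapunov function \<open>p\<^sup>-\<^sup>\<beta>\<close> in
  disguise, controls \<open>u\<close> outside a ball, so the Poincare inequality holds globally. The chain rule
  applied to \<open>p \<gamma>\<close> times a cutoff makes \<open>G\<close> skew-adjoint on the Hilbert space \<open>H1\<close>.

  The Poisson equation is \<open>(1 - \<alpha> G) \<phi> = h\<close> there, where \<open>h = (-S)\<^sup>-\<^sup>1 f\<close>. An eigenfunction of \<open>\<Gamma>\<close> with eigenvalue \<open>\<lambda>\<close>
  multiplies the corresponding coefficient of \<open>h\<close> by \<open>1 / (1 - \<i> \<alpha> \<lambda>)\<close>, and Parseval's identity yields the sum.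
  The limits do not need a basis: \<open>\<phi>\<close> tends to the projection of \<open>h\<close> on the kernel because the range of \<open>G\<close> is
  dense in its complement and \<open>(1 - \<alpha> G)\<^sup>-\<^sup>1 G = ((1 - \<alpha> G)\<^sup>-\<^sup>1 - 1) / \<alpha>\<close>. No compactness is used.
\<close>

subsection \<open>Smooth functions\<close>

text \<open>Elements of L2 and H1 are plain functions, \<open>wgrad\<close>, \<open>S_op\<close> and
  \<open>neg_S_inv\<close> are choices, and identities between them hold only almost everywhere. The
  operator theory is therefore done for a semi-inner product on a set of functions: equations are
  tested against all \<open>v\<close>, and \<open>G\<close> is linear only up to null vectors. In
  the Lyapunov step the cross term 2 \<beta> u \<nabla>u \<bullet> \<nabla>p is \<beta>
  \<nabla>(u^2) \<bullet> \<nabla>p; its integral is that of -\<beta> u^2 \<Delta>p. The remaining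
  coefficient is \<beta> p ((1 - \<beta>) |\<nabla>log p|^2 + \<Delta>log p), which is p times -SW/W
  for W = p^(-\<beta>). It is known to be positive only outside a ball; inside, the local inequality
  takes over. Solvability of (1 - \<alpha> G) \<phi> = h is the second obstacle: this operator is
  not symmetric, so the Riesz theorem does not apply to it. The product (1 - \<alpha> G)(1 +
  \<alpha> G) = 1 - \<alpha>^2 G^2 is symmetric and bounded below by 1, because G is skew. Skewness
  also makes every (1 - \<alpha> G)^(-1) a contraction, the uniform estimate behind both
  limits.\<close>

lemma frechet_derivative_eqI:
  "(f has_derivative f') (at x) \<Longrightarrow> frechet_derivative f (at x) = f'"
  by (metis frechet_derivative_at)

text \<open>Any explicit derivative may be used, although \<open>Ck\<close> refers to the chosen
  \<open>frechet_derivative\<close>.\<close>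

lemma Ck_SucI:
  assumes "\<And>x. (f has_derivative f' x) (at x)" "\<And>v. Ck k (\<lambda>x. f' x v)"
  shows "Ck (Suc k) f"
proof -
  have "frechet_derivative f (at x) = f' x" for x
    using assms(1) by (rule frechet_derivative_eqI)
  then show ?thesis using assms by (auto simp: differentiable_def)
qed

lemma Ck_SucD:
  assumes "Ck (Suc k) f"
  shows "(f has_derivative frechet_derivative f (at x)) (at x)"
    "Ck k (\<lambda>x. frechet_derivative f (at x) v)"
  using assms by (auto simp: frechet_derivative_works)

lemma Ck_Suc_imp: "Ck (Suc k) f \<Longrightarrow> Ck k f"
proof (induction k arbitrary: f)
  case 0
  then show ?case
    by (auto intro!: continuous_at_imp_continuous_on differentiable_imp_continuous_within)
next
  case (Suc k)
  have "Ck (Suc k) (\<lambda>x. frechet_derivative f (at x) v)" for v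
    using Suc.prems by simp
  then have "Ck k (\<lambda>x. frechet_derivative f (at x) v)" for v
    by (rule Suc.IH)
  then show ?case using Suc.prems by simp
qed

lemma Ck_const: "Ck k (\<lambda>x. c)"
proof (induction k arbitrary: c)
  case (Suc k)
  show ?case by (rule Ck_SucI[where f'="\<lambda>x v. 0"]) (auto simp: Suc)
qed auto

lemma Ck_add: "Ck k f \<Longrightarrow> Ck k g \<Longrightarrow> Ck k (\<lambda>x. f x + g x)"
proof (induction k arbitrary: f g)
  case (Suc k)
  show ?case
    by (rule Ck_SucI[OF has_derivative_add[OF Ck_SucD(1)[OF Suc.prems(1)] Ck_SucD(1)[OF Suc.prems(2)]]])
      (intro Suc.IH Ck_SucD(2)[OF Suc.prems(1)] Ck_SucD(2)[OF Suc.prems(2)])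
qed (auto intro: continuous_intros)

lemma Ck_linear_comp:
  assumes "bounded_linear B"
  shows "Ck k f \<Longrightarrow> Ck k (\<lambda>x. B (f x))"
proof (induction k arbitrary: f)
  case 0
  then show ?case using assms by (auto intro: bounded_linear.continuous_on)
next
  case (Suc k)
  show ?case
    by (rule Ck_SucI[OF bounded_linear.has_derivative[OF assms Ck_SucD(1)[OF Suc.prems]]])
      (intro Suc.IH Ck_SucD(2)[OF Suc.prems])
qed

lemma Ck_comp_affine:
  assumes "bounded_linear L"
  shows "Ck k f \<Longrightarrow> Ck k (\<lambda>x. f (L x + a))"
proof (induction k arbitrary: f)
  case 0
  then show ?case
    using assms by (auto intro!: continuous_on_compose2[of UNIV f] continuous_on_add linear_continuous_on[of L])
next
  case (Suc k)
  have 1: "((\<lambda>x. L x + a) has_derivative L) (at x)" for x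
    using has_derivative_add[OF bounded_linear_imp_has_derivative[OF assms, of "at x"] has_derivative_const[of a]]
    by simp
  have 2: "((\<lambda>x. f (L x + a)) has_derivative (\<lambda>v. frechet_derivative f (at (L x + a)) (L v))) (at x)" for x
    using has_derivative_compose[OF 1 Ck_SucD(1)[OF Suc.prems]] .
  show ?case
    by (rule Ck_SucI[OF 2]) (rule Suc.IH[OF Ck_SucD(2)[OF Suc.prems]])
qed

text \<open>The derivative of a product contains the undifferentiated factors, so the induction step
  needs them at order \<open>k\<close> as well; \<open>Ck_Suc_imp\<close> provides this.\<close>

lemma Ck_mult:
  fixes f g :: "'a::real_normed_vector \<Rightarrow> real"
  shows "Ck k f \<Longrightarrow> Ck k g \<Longrightarrow> Ck k (\<lambda>x. f x * g x)"
proof (induction k arbitrary: f g)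
  case (Suc k)
  have "Ck k f" "Ck k g" using Suc.prems Ck_Suc_imp by blast+
  then show ?case
    by (intro Ck_SucI[OF has_derivative_mult[OF Ck_SucD(1)[OF Suc.prems(1)] Ck_SucD(1)[OF Suc.prems(2)]]]
       Ck_add Suc.IH Ck_SucD(2)[OF Suc.prems(1)] Ck_SucD(2)[OF Suc.prems(2)])
qed (auto intro: continuous_intros)

lemma smooth_const: "smooth (\<lambda>x. c)"
  and smooth_add: "smooth f \<Longrightarrow> smooth g \<Longrightarrow> smooth (\<lambda>x. f x + g x)"
  and smooth_linear_comp: "bounded_linear B \<Longrightarrow> smooth f \<Longrightarrow> smooth (\<lambda>x. B (f x))"
  and smooth_comp_affine: "bounded_linear L \<Longrightarrow> smooth f \<Longrightarrow> smooth (\<lambda>x. f (L x + a))"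
  by (simp_all add: smooth_def Ck_const Ck_add Ck_linear_comp Ck_comp_affine)

lemma smooth_mult:
  fixes f g :: "'a::real_normed_vector \<Rightarrow> real"
  shows "smooth f \<Longrightarrow> smooth g \<Longrightarrow> smooth (\<lambda>x. f x * g x)"
  by (simp add: smooth_def Ck_mult)

lemma smooth_prod:
  fixes f :: "'i \<Rightarrow> 'a::real_normed_vector \<Rightarrow> real"
  assumes "\<And>i. i \<in> I \<Longrightarrow> smooth (f i)"
  shows "smooth (\<lambda>x. \<Prod>i\<in>I. f i x)"
  using assms by (induction I rule: infinite_finite_induct) (auto intro: smooth_mult smooth_const)

lemma smooth_sum:
  assumes "\<And>i. i \<in> I \<Longrightarrow> smooth (f i)"
  shows "smooth (\<lambda>x. \<Sum>i\<in>I. f i x)"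
  using assms by (induction I rule: infinite_finite_induct) (auto intro: smooth_add smooth_const)

lemma smooth_has_derivative:
  "smooth f \<Longrightarrow> (f has_derivative frechet_derivative f (at x)) (at x)"
  using Ck_SucD(1)[of 0 f x] by (simp add: smooth_def del: Ck.simps)

lemma smooth_derivative:
  "smooth f \<Longrightarrow> smooth (\<lambda>x. frechet_derivative f (at x) v)"
  unfolding smooth_def using Ck_SucD(2) by blast

lemma smooth_continuous_on: "smooth f \<Longrightarrow> continuous_on S f"
  unfolding smooth_def by (metis Ck.simps(1) continuous_on_subset subset_UNIV)

lemma smooth_measurable: "smooth f \<Longrightarrow> f \<in> borel_measurable borel"
  by (intro borel_measurable_continuous_onI smooth_continuous_on)

text \<open>Replaces the coordinate sum in the definition of \<open>grad\<close> by the
  coordinate-free description, in which the chain and product rules are immediate.\<close>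

lemma grad_inner:
  fixes f :: "'a::euclidean_space \<Rightarrow> real"
  assumes "(f has_derivative f') (at x)"
  shows "grad f x \<bullet> v = f' v"
proof -
  interpret linear f' using assms has_derivative_linear by blast
  have "f' v = f' (\<Sum>b\<in>Basis. (v \<bullet> b) *\<^sub>R b)" by (simp add: euclidean_representation)
  also have "\<dots> = grad f x \<bullet> v"
    unfolding grad_def frechet_derivative_eqI[OF assms]
    by (simp add: sum scale inner_sum_left inner_commute[of v] mult.commute)
  finally show ?thesis by simp
qed

lemma derivative_eq_grad:
  fixes f :: "'a::euclidean_space \<Rightarrow> real"
  assumes "smooth f"
  shows "frechet_derivative f (at x) v = grad f x \<bullet> v"
  using grad_inner[OF smooth_has_derivative[OF assms]] by simp

lemma grad_eqI:
  fixes f :: "'a::euclidean_space \<Rightarrow> real"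
  assumes "(f has_derivative (\<lambda>v. g \<bullet> v)) (at x)"
  shows "grad f x = g"
  by (rule euclidean_eqI) (simp add: grad_inner[OF assms])

lemma smooth_has_derivative_grad:
  fixes f :: "'a::euclidean_space \<Rightarrow> real"
  assumes "smooth f"
  shows "(f has_derivative (\<lambda>v. grad f x \<bullet> v)) (at x)"
proof -
  have "frechet_derivative f (at x) = (\<lambda>v. grad f x \<bullet> v)"
    by (simp add: fun_eq_iff derivative_eq_grad[OF assms])
  then show ?thesis using smooth_has_derivative[OF assms, of x] by metis
qed

lemma smooth_grad:
  fixes f :: "'a::euclidean_space \<Rightarrow> real"
  assumes "smooth f"
  shows "smooth (grad f)"
proof -
  have "smooth (\<lambda>x. \<Sum>b\<in>Basis. frechet_derivative f (at x) b *\<^sub>R b)"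
    by (intro smooth_sum smooth_linear_comp[OF bounded_linear_scaleR_left] smooth_derivative assms)
  then show ?thesis by (simp add: grad_def[abs_def])
qed

lemma grad_mult:
  fixes f g :: "'a::euclidean_space \<Rightarrow> real"
  assumes "smooth f" "smooth g"
  shows "grad (\<lambda>x. f x * g x) x = f x *\<^sub>R grad g x + g x *\<^sub>R grad f x"
  by (rule grad_eqI, rule has_derivative_eq_rhs[OF has_derivative_mult[OF assms[THEN smooth_has_derivative_grad]]])
    (simp add: fun_eq_iff inner_left_distrib)

lemma grad_comp_affine:
  fixes f :: "'a::euclidean_space \<Rightarrow> real"
  assumes "smooth f"
  shows "grad (\<lambda>x. f (r *\<^sub>R x + a)) x = r *\<^sub>R grad f (r *\<^sub>R x + a)"
proof (rule grad_eqI)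
  have "((\<lambda>x. r *\<^sub>R x + a) has_derivative (\<lambda>v. r *\<^sub>R v)) (at x)"
    by (auto intro!: derivative_eq_intros)
  from has_derivative_compose[OF this smooth_has_derivative_grad[OF assms]]
  show "((\<lambda>x. f (r *\<^sub>R x + a)) has_derivative (\<lambda>v. (r *\<^sub>R grad f (r *\<^sub>R x + a)) \<bullet> v)) (at x)"
    by simp
qed

subsection \<open>Test functions\<close>

lemma test_functionD:
  assumes "test_function \<phi>"
  shows "smooth \<phi>" "\<exists>K. compact K \<and> (\<forall>x. x \<notin> K \<longrightarrow> \<phi> x = 0)"
  using assms by (auto simp: test_function_def)

text \<open>The complement of a compact set is open, so the function vanishes on a whole
  neighbourhood of \<open>x\<close>.\<close>

lemma grad_eq_0_off_compact:
  assumes "compact K" "\<And>x. x \<notin> K \<Longrightarrow> \<phi> x = 0" "x \<notin> K"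
  shows "grad \<phi> x = 0"
proof (rule grad_eqI)
  have "((\<lambda>x. 0) has_derivative (\<lambda>v. (0::'a) \<bullet> v)) (at x)" by simp
  then show "(\<phi> has_derivative (\<lambda>v. 0 \<bullet> v)) (at x)"
    by (rule has_derivative_transform_within_open[where s="-K"])
      (use assms compact_imp_closed in auto)
qed

lemma test_function_mult:
  assumes "test_function \<phi>" "smooth \<psi>"
  shows "test_function (\<lambda>x. \<psi> x * \<phi> x)"
  using assms unfolding test_function_def by (auto intro: smooth_mult)

text \<open>Components of \<open>grad \<phi>\<close> can thus themselves serve as test functions,
  both for integrability and in the closedness of the weak gradient.\<close>

lemma test_function_derivative:
  assumes "test_function \<phi>"
  shows "test_function (\<lambda>x. grad \<phi> x \<bullet> v)"
proof -
  obtain K where "compact K" "\<And>x. x \<notin> K \<Longrightarrow> \<phi> x = 0"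
    using assms by (auto simp: test_function_def)
  then show ?thesis
    using grad_eq_0_off_compact[of K \<phi>] test_functionD[OF assms]
    unfolding test_function_def
    by (auto intro!: smooth_linear_comp[OF bounded_linear_inner_left] smooth_grad)
qed

lemma test_function_bounded:
  assumes "test_function \<phi>"
  obtains C where "0 \<le> C" "\<And>x. \<bar>\<phi> x\<bar> \<le> C" "\<And>x. norm (grad \<phi> x) \<le> C"
proof -
  obtain K where K: "compact K" "\<And>x. x \<notin> K \<Longrightarrow> \<phi> x = 0"
    using assms by (auto simp: test_function_def)
  have s: "smooth \<phi>" using assms test_functionD by blast
  have "bounded (\<phi> ` K)" "bounded (grad \<phi> ` K)"
    by (intro compact_imp_bounded compact_continuous_image K smooth_continuous_on s smooth_grad)+
  then obtain A B where "\<And>x. x \<in> K \<Longrightarrow> norm (\<phi> x) \<le> A" "\<And>x. x \<in> K \<Longrightarrow> norm (grad \<phi> x) \<le> B"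
    by (auto simp: bounded_iff)
  then have "\<bar>\<phi> x\<bar> \<le> max 0 (max A B)" "norm (grad \<phi> x) \<le> max 0 (max A B)" for x
    using K(2)[of x] grad_eq_0_off_compact[of K \<phi> x] K by (cases "x \<in> K"; simp add: le_max_iff_disj)+
  then show ?thesis using that[of "max 0 (max A B)"] by simp
qed

subsection \<open>Bump functions\<close>

text \<open>The functions t^(-m) exp(-1/t), extended by 0 to the left. The bumps use only m = 0; the
  exponent is carried because derivatives produce further negative powers of t.\<close>

definition flat :: "nat \<Rightarrow> real \<Rightarrow> real" where
  "flat m t = (if t \<le> 0 then 0 else inverse t ^ m / exp (inverse t))"

lemma flat_tendsto_0: "((\<lambda>t. inverse t ^ m / exp (inverse t)) \<longlongrightarrow> (0::real)) (at_right 0)"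
  using filterlim_compose[OF tendsto_power_div_exp_0 filterlim_inverse_at_top_right] .

lemma flat_has_derivative:
  "(flat m has_real_derivative (flat (m + 2) t - real m * flat (m + 1) t)) (at t)"
proof -
  consider "t < 0" | "t > 0" | "t = 0" by linarith
  then show ?thesis
  proof cases
    case 1
    then have "(flat m has_real_derivative 0) (at t)"
      by (intro has_field_derivative_transform_within_open[where S="{..<0}", OF DERIV_const])
         (auto simp: flat_def)
    with 1 show ?thesis by (simp add: flat_def)
  next
    case 2
    have inv: "(inverse has_real_derivative - (inverse t ^ 2)) (at t)"
      using DERIV_inverse[of t] 2 by (simp add: numeral_2_eq_2)
    have pow: "((\<lambda>t. inverse t ^ m) has_real_derivative - real m * inverse t ^ (m + 1)) (at t)"
      using DERIV_power[OF inv, of m] by (cases m) (simp_all add: power2_eq_square algebra_simps)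
    have "((\<lambda>t. exp (- inverse t)) has_real_derivative exp (- inverse t) * inverse t ^ 2) (at t)"
      using DERIV_fun_exp[OF DERIV_minus[OF inv]] by simp
    from DERIV_mult[OF pow this]
    have "((\<lambda>t. inverse t ^ m / exp (inverse t)) has_real_derivative
        (flat (m + 2) t - real m * flat (m + 1) t)) (at t)"
      using 2 by (simp add: flat_def exp_minus divide_inverse power_add power2_eq_square algebra_simps)
    then show ?thesis
      by (rule has_field_derivative_transform_within_open[where S="{0<..}"])
         (use 2 in \<open>auto simp: flat_def\<close>)
  next
    case 3
    have "((\<lambda>h. (flat m h - flat m 0) / (h - 0)) \<longlongrightarrow> 0) (at 0)"
      unfolding filterlim_at_split
    proof
      have "((\<lambda>h. 0) \<longlongrightarrow> (0::real)) (at_left 0)" by simp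
      then show "((\<lambda>h. (flat m h - flat m 0) / (h - 0)) \<longlongrightarrow> 0) (at_left 0)"
        by (rule Lim_transform_eventually) (auto simp: eventually_at_filter flat_def)
      \<comment> \<open>Dividing by h raises the exponent by one, so the limit for
        \<open>Suc m\<close> is the right one to use.\<close>
      show "((\<lambda>h. (flat m h - flat m 0) / (h - 0)) \<longlongrightarrow> 0) (at_right 0)"
        by (rule Lim_transform_eventually[OF flat_tendsto_0[of "Suc m"]])
           (auto simp: eventually_at_filter flat_def field_simps)
    qed
    then show ?thesis using 3 by (simp add: has_field_derivative_iff flat_def)
  qed
qed

text \<open>The span of the family is closed under differentiation, hence the induction on the order
  with \<open>m\<close> arbitrary.\<close>

lemma smooth_flat: "smooth (flat m)"
proof -
  have "Ck k (flat m)" for k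
  proof (induction k arbitrary: m)
    case 0
    show ?case using flat_has_derivative by (auto intro!: continuous_at_imp_continuous_on DERIV_isCont)
  next
    case (Suc k)
    have "Ck k (\<lambda>x. (flat (m + 2) x - real m * flat (m + 1) x) * v)" for v
      using Ck_mult[OF Ck_add[OF Suc[of "m+2"] Ck_mult[OF Ck_const[of k "- real m"] Suc[of "m+1"]]] Ck_const[of k v]]
      by simp
    then show ?case
      using flat_has_derivative[of m] unfolding has_field_derivative_def
      by (intro Ck_SucI[where f'="\<lambda>x v. (flat (m + 2) x - real m * flat (m + 1) x) * v"]) auto
  qed
  then show ?thesis by (simp add: smooth_def)
qed

lemma flat_0_bounds: "0 \<le> flat 0 t" "flat 0 t \<le> 1"
  by (auto simp: flat_def field_simps)

lemma flat_0_tendsto_1: "0 < t \<Longrightarrow> (\<lambda>n. flat 0 (real n * t)) \<longlonglongrightarrow> 1"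
proof -
  assume t: "0 < t"
  have "(\<lambda>n. 1 / exp (inverse t * inverse (real n))) \<longlonglongrightarrow> 1 / exp (inverse t * 0)"
    by (intro tendsto_intros lim_inverse_n) auto
  then have "(\<lambda>n. 1 / exp (inverse t * inverse (real n))) \<longlonglongrightarrow> 1" by simp
  moreover have "\<forall>\<^sub>F n in sequentially. 1 / exp (inverse t * inverse (real n)) = flat 0 (real n * t)"
    using eventually_gt_at_top[of 0]
  proof eventually_elim
    case (elim n)
    then have "\<not> real n * t \<le> 0" using t by (simp add: not_le)
    then show ?case by (simp add: flat_def mult.commute)
  qed
  ultimately show ?thesis by (rule Lim_transform_eventually)
qed

text \<open>One factor for each face of the box, steepened by \<open>n\<close>: a smooth
  approximation of the indicator of the open box from below, with limit exactly that
  indicator.\<close>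

definition box_bump :: "'a::euclidean_space \<Rightarrow> 'a \<Rightarrow> nat \<Rightarrow> 'a \<Rightarrow> real" where
  "box_bump a b n x =
     (\<Prod>i\<in>Basis. flat 0 (real n * (x \<bullet> i - a \<bullet> i)) * flat 0 (real n * (b \<bullet> i - x \<bullet> i)))"

lemma box_bump_bounds: "0 \<le> box_bump a b n x" "box_bump a b n x \<le> 1"
  unfolding box_bump_def
  by (auto intro!: prod_nonneg prod_le_1 mult_nonneg_nonneg mult_le_one flat_0_bounds)

lemma box_bump_outside: "x \<notin> box a b \<Longrightarrow> box_bump a b n x = 0"
proof -
  assume "x \<notin> box a b"
  then obtain i where i: "i \<in> Basis" "x \<bullet> i \<le> a \<bullet> i \<or> b \<bullet> i \<le> x \<bullet> i"
    by (force simp: mem_box)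
  then have "flat 0 (real n * (x \<bullet> i - a \<bullet> i)) * flat 0 (real n * (b \<bullet> i - x \<bullet> i)) = 0"
    by (auto simp: flat_def mult_le_0_iff)
  with i(1) show ?thesis
    unfolding box_bump_def by (intro prod_zero) auto
qed

lemma box_bump_tendsto: "(\<lambda>n. box_bump a b n x) \<longlonglongrightarrow> indicator (box a b) x"
proof (cases "x \<in> box a b")
  case True
  have "(\<lambda>n. box_bump a b n x) \<longlonglongrightarrow> (\<Prod>i\<in>(Basis::'a set). 1 * 1)"
    unfolding box_bump_def
    using True by (intro tendsto_prod tendsto_mult flat_0_tendsto_1) (auto simp: mem_box)
  with True show ?thesis by simp
qed (simp add: box_bump_outside)

lemma smooth_box_bump: "smooth (box_bump a b n)"
proof -
  have 1: "smooth (\<lambda>x. flat 0 ((real n * (x \<bullet> i)) + c))" for i :: 'a and c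
    using smooth_comp_affine[OF bounded_linear_compose[OF bounded_linear_mult_right bounded_linear_inner_left] smooth_flat, where a=c] .
  have 2: "smooth (\<lambda>x. flat 0 (real n * (x \<bullet> i - a \<bullet> i)))" for i
    using 1[of i "- real n * (a \<bullet> i)"] by (simp add: algebra_simps)
  have 3: "smooth (\<lambda>x. flat 0 (real n * (b \<bullet> i - x \<bullet> i)))" for i
    using 1[of "-i" "real n * (b \<bullet> i)"] by (simp add: algebra_simps)
  show ?thesis
    unfolding box_bump_def[abs_def] by (intro smooth_prod smooth_mult 2 3)
qed

lemma test_function_box_bump: "test_function (box_bump a b n)"
  unfolding test_function_def
  using smooth_box_bump box_bump_outside[of _ a b n] box_subset_cbox[of a b]
  by (intro conjI exI[of _ "cbox a b"]) (blast intro: compact_cbox)+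

text \<open>All members are dilations of one bump, normalized to be 1 at the origin, by the factor n
  + 1. Continuity at the origin gives the limit 1, and each gradient gains a factor 1/(n + 1), so
  both are bounded uniformly and the gradients vanish in the limit.\<close>

lemma cutoff_sequence:
  obtains \<eta> :: "nat \<Rightarrow> 'a::euclidean_space \<Rightarrow> real" and C where
    "0 \<le> C" "\<And>n. test_function (\<eta> n)" "\<And>n x. \<bar>\<eta> n x\<bar> \<le> C" "\<And>x. (\<lambda>n. \<eta> n x) \<longlonglongrightarrow> 1"
    "\<And>n x. norm (grad (\<eta> n) x) \<le> C" "\<And>x. (\<lambda>n. grad (\<eta> n) x) \<longlonglongrightarrow> 0"
proof -
  define B where "B = box_bump (- One) (One::'a) 1"
  have B0: "B 0 > 0"
    unfolding B_def box_bump_def by (intro prod_pos) (auto simp: flat_def)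
  define \<theta> where "\<theta> = (\<lambda>x. inverse (B 0) * B x)"
  have th: "test_function \<theta>"
    unfolding \<theta>_def B_def by (intro test_function_mult test_function_box_bump smooth_const)
  have \<theta>0: "\<theta> 0 = 1" using B0 by (simp add: \<theta>_def)
  obtain C where C: "0 \<le> C" "\<And>x. \<bar>\<theta> x\<bar> \<le> C" "\<And>x. norm (grad \<theta> x) \<le> C"
    using test_function_bounded[OF th] by metis
  have s: "smooth \<theta>" using th test_functionD by blast
  define \<eta> where "\<eta> = (\<lambda>n x. \<theta> (inverse (real (Suc n)) *\<^sub>R x))"
  obtain K where K: "compact K" "\<And>x. x \<notin> K \<Longrightarrow> \<theta> x = 0" using th by (auto simp: test_function_def)
  have g: "grad (\<eta> n) x = inverse (real (Suc n)) *\<^sub>R grad \<theta> (inverse (real (Suc n)) *\<^sub>R x)" for n x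
    using grad_comp_affine[OF s, of "inverse (real (Suc n))" 0 x] by (simp add: \<eta>_def)
  have gn: "norm (grad (\<eta> n) x) \<le> inverse (real (Suc n)) * C" for n x
    unfolding g norm_scaleR using C(3)[of "inverse (real (Suc n)) *\<^sub>R x"]
    by (simp del: of_nat_Suc)
  show ?thesis
  proof (rule that[of C \<eta>])
    show "test_function (\<eta> n)" for n
      unfolding test_function_def
    proof (intro conjI exI[of _ "(\<lambda>x. real (Suc n) *\<^sub>R x) ` K"] allI impI)
      show "smooth (\<eta> n)"
        using smooth_comp_affine[OF bounded_linear_scaleR_right[of "inverse (real (Suc n))"] s, of 0]
        by (simp add: \<eta>_def)
      show "compact ((\<lambda>x. real (Suc n) *\<^sub>R x) ` K)" using K(1) by (rule compact_scaling)
      fix x assume x: "x \<notin> (\<lambda>x. real (Suc n) *\<^sub>R x) ` K"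
      have "inverse (real (Suc n)) *\<^sub>R x \<notin> K"
      proof
        assume "inverse (real (Suc n)) *\<^sub>R x \<in> K"
        then have "real (Suc n) *\<^sub>R (inverse (real (Suc n)) *\<^sub>R x) \<in> (\<lambda>x. real (Suc n) *\<^sub>R x) ` K" by blast
        with x show False by (simp del: of_nat_Suc)
      qed
      then show "\<eta> n x = 0" using K(2) by (simp add: \<eta>_def)
    qed
    show "(\<lambda>n. \<eta> n x) \<longlonglongrightarrow> 1" for x
    proof -
      have "isCont \<theta> 0" using smooth_continuous_on[OF s, of UNIV] continuous_on_eq_continuous_at by blast
      moreover have "(\<lambda>n. inverse (real (Suc n)) *\<^sub>R x) \<longlonglongrightarrow> 0 *\<^sub>R x"
        by (intro tendsto_intros LIMSEQ_inverse_real_of_nat)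
      ultimately have "(\<lambda>n. \<theta> (inverse (real (Suc n)) *\<^sub>R x)) \<longlonglongrightarrow> \<theta> 0"
        by (intro isCont_tendsto_compose[of 0 \<theta>]) auto
      then show ?thesis by (simp add: \<eta>_def \<theta>0)
    qed
    show "norm (grad (\<eta> n) x) \<le> C" for n x
    proof -
      have "inverse (real (Suc n)) * C \<le> 1 * C" using C(1)
        by (intro mult_right_mono) (auto simp: field_simps)
      then show ?thesis using gn[of n x] by simp
    qed
    show "(\<lambda>n. grad (\<eta> n) x) \<longlonglongrightarrow> 0" for x
    proof (rule Lim_null_comparison)
      show "(\<lambda>n. inverse (real (Suc n)) * C) \<longlonglongrightarrow> 0"
        by (intro tendsto_mult_left_zero LIMSEQ_inverse_real_of_nat)
    qed (use gn in auto)
  qed (use C in \<open>auto simp: \<eta>_def\<close>)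
qed

subsection \<open>Local integrability and the fundamental lemma of the calculus of variations\<close>

lemma locally_integrableD:
  "locally_integrable f \<Longrightarrow> f \<in> borel_measurable borel"
  "locally_integrable f \<Longrightarrow> compact K \<Longrightarrow> set_integrable lborel K f"
  by (auto simp: locally_integrable_def)

lemma locally_integrable_continuous:
  fixes f :: "'a::euclidean_space \<Rightarrow> 'b::euclidean_space"
  assumes "continuous_on UNIV f"
  shows "locally_integrable f"
  unfolding locally_integrable_def set_integrable_def
  using assms by (auto intro!: borel_measurable_continuous_onI borel_integrable_compact continuous_on_subset[OF assms])

lemma locally_integrable_scaleR:
  fixes f :: "'a::euclidean_space \<Rightarrow> 'b::euclidean_space"
  assumes f: "locally_integrable f" and h: "continuous_on UNIV h"
  shows "locally_integrable (\<lambda>x. h x *\<^sub>R f x)"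
  unfolding locally_integrable_def
proof (intro conjI allI impI)
  have hm[measurable]: "h \<in> borel_measurable borel" using h by (rule borel_measurable_continuous_onI)
  have fm[measurable]: "f \<in> borel_measurable borel" using f by (rule locally_integrableD)
  show "(\<lambda>x. h x *\<^sub>R f x) \<in> borel_measurable borel" by simp
  fix K :: "'a set" assume K: "compact K"
  have [measurable]: "K \<in> sets borel" using K by (simp add: compact_imp_closed borel_closed)
  have "bounded (h ` K)"
    using K h by (intro compact_imp_bounded compact_continuous_image continuous_on_subset[OF h]) auto
  then obtain C where C: "\<And>x. x \<in> K \<Longrightarrow> \<bar>h x\<bar> \<le> C" by (auto simp: bounded_iff)
  have "integrable lborel (\<lambda>x. C *\<^sub>R (indicator K x *\<^sub>R f x))"
    using locally_integrableD(2)[OF f K] unfolding set_integrable_def by (rule integrable_scaleR_right)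
  then show "set_integrable lborel K (\<lambda>x. h x *\<^sub>R f x)"
    unfolding set_integrable_def
    by (rule Bochner_Integration.integrable_bound)
       (auto simp: indicator_def intro!: mult_right_mono AE_I2 order_trans[OF C])
qed

lemma locally_integrable_add:
  fixes f g :: "'a::euclidean_space \<Rightarrow> 'b::euclidean_space"
  assumes "locally_integrable f" "locally_integrable g"
  shows "locally_integrable (\<lambda>x. f x + g x)"
  using assms unfolding locally_integrable_def
  by (auto intro: set_integral_add(1))

lemma locally_integrable_inner:
  fixes f :: "'a::euclidean_space \<Rightarrow> 'b::euclidean_space"
  assumes "locally_integrable f"
  shows "locally_integrable (\<lambda>x. f x \<bullet> v)"
  unfolding locally_integrable_def set_integrable_def
proof (intro conjI allI impI)
  show "(\<lambda>x. f x \<bullet> v) \<in> borel_measurable borel"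
    using locally_integrableD(1)[OF assms] by simp
  fix K :: "'a set" assume "compact K"
  then have "integrable lborel (\<lambda>x. (indicator K x *\<^sub>R f x) \<bullet> v)"
    using locally_integrableD(2)[OF assms] unfolding set_integrable_def by (intro integrable_inner_left)
  then show "integrable lborel (\<lambda>x. indicat_real K x *\<^sub>R (f x \<bullet> v))" by simp
qed

lemma locally_integrable_bound:
  fixes f :: "'a::euclidean_space \<Rightarrow> 'b::euclidean_space" and g :: "'a \<Rightarrow> 'c::euclidean_space"
  assumes "locally_integrable f" "g \<in> borel_measurable borel" "\<And>x. norm (g x) \<le> norm (f x)"
  shows "locally_integrable g"
  unfolding locally_integrable_def
proof (intro conjI allI impI)
  fix K :: "'a set" assume K: "compact K"
  then have [measurable]: "K \<in> sets borel" by (simp add: compact_imp_closed borel_closed)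
  have [measurable]: "g \<in> borel_measurable borel" by fact
  have "set_integrable lborel K f" using assms locally_integrableD K by blast
  then show "set_integrable lborel K g"
    unfolding set_integrable_def
    by (rule Bochner_Integration.integrable_bound)
      (use assms(3) in \<open>auto simp: indicator_def\<close>)
qed (use assms in auto)

lemma integrable_locally:
  fixes f :: "'a::euclidean_space \<Rightarrow> 'b::euclidean_space"
  assumes f: "locally_integrable f" and h: "continuous_on UNIV h"
    and K: "compact K" "\<And>x. x \<notin> K \<Longrightarrow> h x = 0"
  shows "integrable lborel (\<lambda>x. h x *\<^sub>R f x)"
proof -
  have "set_integrable lborel K (\<lambda>x. h x *\<^sub>R f x)"
    using locally_integrableD(2)[OF locally_integrable_scaleR[OF f h] K(1)] .
  moreover have "(\<lambda>x. indicator K x *\<^sub>R (h x *\<^sub>R f x)) = (\<lambda>x. h x *\<^sub>R f x)"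
    using K(2) by (auto simp: indicator_def fun_eq_iff)
  ultimately show ?thesis by (simp only: set_integrable_def)
qed

lemma integrable_test:
  fixes f :: "'a::euclidean_space \<Rightarrow> 'b::euclidean_space"
  assumes f: "locally_integrable f" and \<phi>: "test_function \<phi>"
  shows "integrable lborel (\<lambda>x. \<phi> x *\<^sub>R f x)"
  using integrable_locally[OF f smooth_continuous_on] \<phi> by (metis test_functionD)

lemma integrable_test_real:
  fixes f :: "'a::euclidean_space \<Rightarrow> real"
  assumes f: "locally_integrable f" and \<phi>: "test_function \<phi>"
  shows "integrable lborel (\<lambda>x. \<phi> x * f x)" "integrable lborel (\<lambda>x. f x * \<phi> x)"
  using integrable_test[OF assms] by (simp_all add: mult.commute)

lemma integrable_test_grad:
  fixes f :: "'a::euclidean_space \<Rightarrow> real"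
  assumes f: "locally_integrable f" and \<phi>: "test_function \<phi>"
  shows "integrable lborel (\<lambda>x. f x * (grad \<phi> x \<bullet> v))"
  by (intro integrable_test_real f test_function_derivative \<phi>)

text \<open>Bump functions converge to indicators of boxes, so f integrates to 0 over every box. The
  measures with densities f^+ and f^- then agree on the boxes, which form an intersection-stable
  generator, and equal measures have almost everywhere equal densities.\<close>

lemma fundamental_lemma:
  fixes f :: "'a::euclidean_space \<Rightarrow> real"
  assumes f: "locally_integrable f"
    and 0: "\<And>\<phi>. test_function \<phi> \<Longrightarrow> (LBINT x. \<phi> x * f x) = 0"
  shows "AE x in lborel. f x = 0"
proof -
  have [measurable]: "f \<in> borel_measurable borel" using f by (rule locally_integrableD)
  have box: "integrable lborel (\<lambda>x. indicator (box a b) x * f x)" for a b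
  proof -
    have "set_integrable lborel (cbox a b) f" using locally_integrableD[OF f] by simp
    then have "set_integrable lborel (box a b) f"
      by (rule set_integrable_subset) (auto simp: box_subset_cbox)
    then show ?thesis by (simp add: set_integrable_def)
  qed
  have int0: "(LBINT x. indicator (box a b) x * f x) = 0" for a b
  proof -
    have "(\<lambda>n. \<integral>x. box_bump a b n x * f x \<partial>lborel) \<longlonglongrightarrow> (LBINT x. indicator (box a b) x * f x)"
    proof (rule integral_dominated_convergence[where w="\<lambda>x. \<bar>indicator (box a b) x * f x\<bar>"])
      show "AE x in lborel. (\<lambda>n. box_bump a b n x * f x) \<longlonglongrightarrow> indicat_real (box a b) x * f x"
        by (intro AE_I2 tendsto_mult box_bump_tendsto tendsto_const)
      show "AE x in lborel. norm (box_bump a b n x * f x) \<le> \<bar>indicat_real (box a b) x * f x\<bar>" for n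
      proof (rule AE_I2)
        fix x
        show "norm (box_bump a b n x * f x) \<le> \<bar>indicat_real (box a b) x * f x\<bar>"
          using box_bump_bounds[of a b n x] box_bump_outside[of x a b n]
          by (cases "x \<in> box a b") (auto simp: abs_mult intro: mult_left_le_one_le)
      qed
      show "(\<lambda>x. box_bump a b n x * f x) \<in> borel_measurable lborel" for n
        using smooth_measurable[OF smooth_box_bump, of a b n] by simp
    qed (use box in auto)
    then have "(\<lambda>n. 0::real) \<longlonglongrightarrow> (LBINT x. indicator (box a b) x * f x)"
      by (simp add: 0 test_function_box_bump)
    then show ?thesis using LIMSEQ_unique tendsto_const by blast
  qed
  \<comment> \<open>Since \<open>f\<close> is only locally integrable, these measures may be
    infinite; they are finite on boxes, which is enough for uniqueness on the exhausting sequence of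
    boxes.\<close>
  define P where "P = density lborel (\<lambda>x. ennreal (max 0 (f x)))"
  define N where "N = density lborel (\<lambda>x. ennreal (max 0 (- f x)))"
  have P: "emeasure P (box a b) = ennreal (LBINT x. indicator (box a b) x * max 0 (f x))" 
    and Ni: "emeasure N (box a b) = ennreal (LBINT x. indicator (box a b) x * max 0 (- f x))" 
    and eq: "(LBINT x. indicator (box a b) x * max 0 (f x)) = (LBINT x. indicator (box a b) x * max 0 (- f x))"
    for a b
  proof -
    have i: "integrable lborel (\<lambda>x. indicator (box a b) x * max 0 (f x))"
      by (rule Bochner_Integration.integrable_bound[OF box[of a b]]) (auto simp: indicator_def)
    have j: "integrable lborel (\<lambda>x. indicator (box a b) x * max 0 (- f x))"
      by (rule Bochner_Integration.integrable_bound[OF box[of a b]]) (auto simp: indicator_def)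
    show "emeasure P (box a b) = ennreal (LBINT x. indicator (box a b) x * max 0 (f x))"
      unfolding P_def
      by (subst nn_integral_eq_integral[symmetric, OF i])
         (auto simp: emeasure_density indicator_def intro!: nn_integral_cong)
    show "emeasure N (box a b) = ennreal (LBINT x. indicator (box a b) x * max 0 (- f x))"
      unfolding N_def
      by (subst nn_integral_eq_integral[symmetric, OF j])
         (auto simp: emeasure_density indicator_def intro!: nn_integral_cong)
    have "(LBINT x. indicator (box a b) x * max 0 (f x) - indicator (box a b) x * max 0 (- f x))
      = (LBINT x. indicator (box a b) x * f x)"
      by (intro Bochner_Integration.integral_cong) (auto simp: indicator_def)
    with int0[of a b] i j
    show "(LBINT x. indicator (box a b) x * max 0 (f x)) = (LBINT x. indicator (box a b) x * max 0 (- f x))"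
      by simp
  qed
  have "P = N"
  proof (rule measure_eqI_generator_eq)
    let ?E = "range (\<lambda>(a, b). box a b::'a set)"
    show "Int_stable ?E" by (auto simp: Int_stable_def box_Int_box)
    show "?E \<subseteq> Pow UNIV" "sets P = sigma_sets UNIV ?E" "sets N = sigma_sets UNIV ?E"
      by (simp_all add: borel_eq_box P_def N_def)
    let ?A = "\<lambda>n::nat. box (- (real n *\<^sub>R One)) (real n *\<^sub>R One) :: 'a set"
    show "range ?A \<subseteq> ?E" "(\<Union>i. ?A i) = UNIV"
      unfolding UN_box_eq_UNIV by auto
    show "emeasure P (?A i) \<noteq> \<infinity>" for i by (simp add: P)
    show "emeasure P X = emeasure N X" if "X \<in> ?E" for X
      using that by (auto simp: P Ni eq)
  qed
  then have "AE x in lborel. ennreal (max 0 (f x)) = ennreal (max 0 (- f x))"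
    unfolding P_def N_def by (intro sigma_finite_measure.density_unique[OF sigma_finite_lborel]) auto
  then show ?thesis by (rule AE_mp) (auto simp: max_def split: if_splits)
qed

lemma fundamental_lemma_vec:
  fixes g :: "'a::euclidean_space \<Rightarrow> 'b::euclidean_space"
  assumes g: "locally_integrable g"
    and 0: "\<And>\<phi> v. test_function \<phi> \<Longrightarrow> (LBINT x. \<phi> x * (g x \<bullet> v)) = 0"
  shows "AE x in lborel. g x = 0"
proof -
  have "AE x in lborel. g x \<bullet> b = 0" for b
    by (intro fundamental_lemma locally_integrable_inner g 0)
  then have "AE x in lborel. \<forall>b\<in>Basis. g x \<bullet> b = 0"
    by (intro AE_finite_allI) auto
  then show ?thesis by (rule AE_mp) (auto simp: euclidean_all_zero_iff)
qed

subsection \<open>Averages over the unit interval\<close>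

text \<open>Lebesgue measure on the unit interval as a probability measure on all reals: averages
  along a segment become expectations, to which Fubini and the second moment inequality
  apply.\<close>

definition unit_ivl :: "real measure" where
  "unit_ivl = density lborel (\<lambda>t. ennreal (indicator {0..1} t))"

lemma sets_unit_ivl[measurable_cong, simp]: "sets unit_ivl = sets borel"
  and space_unit_ivl[simp]: "space unit_ivl = UNIV"
  by (simp_all add: unit_ivl_def)

lemma prob_space_unit_ivl: "prob_space unit_ivl"
  by (rule prob_spaceI) (simp add: unit_ivl_def emeasure_density nn_integral_indicator ennreal_indicator)

lemma AE_unit_ivl: "AE t in unit_ivl. 0 \<le> t \<and> t \<le> 1"
  unfolding unit_ivl_def by (subst AE_density) (auto simp: indicator_def)

lemma integral_unit_ivl:
  fixes f :: "real \<Rightarrow> real"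
  assumes "f \<in> borel_measurable borel"
  shows "(\<integral>t. f t \<partial>unit_ivl) = (\<integral>t. indicator {0..1} t *\<^sub>R f t \<partial>lborel)"
  using assms unfolding unit_ivl_def by (subst integral_density) auto

lemma smooth_FTC:
  fixes \<phi> :: "'a::euclidean_space \<Rightarrow> real"
  assumes s: "smooth \<phi>"
  shows "\<phi> (x + h) - \<phi> x = (\<integral>t. grad \<phi> (x + t *\<^sub>R h) \<bullet> h \<partial>unit_ivl)"
proof -
  have c: "continuous_on S (\<lambda>t. grad \<phi> (x + t *\<^sub>R h) \<bullet> h)" for S
    by (intro continuous_intros continuous_on_compose2[OF smooth_continuous_on[OF smooth_grad[OF s], of UNIV]]) auto
  have d: "((\<lambda>t. \<phi> (x + t *\<^sub>R h)) has_vector_derivative (grad \<phi> (x + t *\<^sub>R h) \<bullet> h)) (at t within A)" for t A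
  proof -
    have "((\<lambda>t. x + t *\<^sub>R h) has_derivative (\<lambda>r. r *\<^sub>R h)) (at t within A)"
      by (auto intro!: derivative_eq_intros)
    from has_derivative_compose[OF this smooth_has_derivative_grad[OF s]]
    show ?thesis by (simp add: has_vector_derivative_def)
  qed
  have "(\<integral>t. indicator {0..1} t *\<^sub>R (grad \<phi> (x + t *\<^sub>R h) \<bullet> h) \<partial>lborel) = \<phi> (x + 1 *\<^sub>R h) - \<phi> (x + 0 *\<^sub>R h)"
    by (rule integral_FTC_atLeastAtMost) (use c d in auto)
  then show ?thesis
    by (subst integral_unit_ivl) (use borel_measurable_continuous_onI[OF c] in auto)
qed

lemma integral_translation:
  fixes f :: "'a::euclidean_space \<Rightarrow> 'b::{banach, second_countable_topology}"
  assumes [measurable]: "f \<in> borel_measurable borel"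
  shows "(LBINT x. f (x + h)) = (LBINT x. f x)"
proof -
  have "(LBINT x. f x) = (\<integral>x. f x \<partial>distr lborel borel ((+) h))"
    by (simp add: lborel_distr_plus)
  also have "\<dots> = (LBINT x. f (h + x))" by (rule integral_distr) auto
  finally show ?thesis by (simp add: add.commute)
qed

lemma nn_integral_translation:
  fixes f :: "'a::euclidean_space \<Rightarrow> ennreal"
  assumes [measurable]: "f \<in> borel_measurable borel"
  shows "(\<integral>\<^sup>+x. f (x + h) \<partial>lborel) = (\<integral>\<^sup>+x. f x \<partial>lborel)"
proof -
  have "(\<integral>\<^sup>+x. f x \<partial>lborel) = (\<integral>\<^sup>+x. f x \<partial>distr lborel borel ((+) h))"
    by (simp add: lborel_distr_plus)
  also have "\<dots> = (\<integral>\<^sup>+x. f (h + x) \<partial>lborel)" by (rule nn_integral_distr) auto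
  finally show ?thesis by (simp add: add.commute)
qed

lemma integrable_translation:
  fixes f :: "'a::euclidean_space \<Rightarrow> 'b::{banach, second_countable_topology}"
  assumes "integrable lborel f"
  shows "integrable lborel (\<lambda>x. f (x + h))"
proof -
  have "integrable (distr lborel borel ((+) h)) f" using assms by (simp add: lborel_distr_plus)
  then have "integrable lborel (\<lambda>x. f (h + x))" by (rule integrable_distr[rotated]) auto
  then show ?thesis by (simp add: add.commute)
qed

lemma test_function_lipschitz:
  assumes "smooth \<phi>" "\<And>x. norm (grad \<phi> x) \<le> C"
  shows "\<bar>\<phi> (x + h) - \<phi> x\<bar> \<le> C * norm h"
proof -
  interpret prob_space unit_ivl by (rule prob_space_unit_ivl)
  have [measurable]: "(\<lambda>t. grad \<phi> (x + t *\<^sub>R h)) \<in> borel_measurable borel"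
    using smooth_measurable[OF smooth_grad[OF assms(1)]] by simp
  have b: "\<bar>grad \<phi> (x + t *\<^sub>R h) \<bullet> h\<bar> \<le> C * norm h" for t
    using Cauchy_Schwarz_ineq2[of "grad \<phi> (x + t *\<^sub>R h)" h] assms(2)[of "x + t *\<^sub>R h"]
    by (meson mult_right_mono norm_ge_zero order_trans)
  have i: "integrable unit_ivl (\<lambda>t. grad \<phi> (x + t *\<^sub>R h) \<bullet> h)"
    by (rule integrable_const_bound[where B="C * norm h"]) (use b in auto)
  have "\<bar>\<integral>t. grad \<phi> (x + t *\<^sub>R h) \<bullet> h \<partial>unit_ivl\<bar> \<le> (\<integral>t. \<bar>grad \<phi> (x + t *\<^sub>R h) \<bullet> h\<bar> \<partial>unit_ivl)"
    by (rule integral_abs_bound)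
  also have "\<dots> \<le> (\<integral>t. C * norm h \<partial>unit_ivl)"
    by (rule integral_mono) (use i b in auto)
  finally have "\<bar>\<integral>t. grad \<phi> (x + t *\<^sub>R h) \<bullet> h \<partial>unit_ivl\<bar> \<le> (\<integral>t. C * norm h \<partial>unit_ivl)" .
  then show ?thesis unfolding smooth_FTC[OF assms(1)] using prob_space by simp
qed

text \<open>Difference quotients of \<open>\<phi>\<close> integrate to 0 by translation invariance,
  and they converge dominatedly to the directional derivative.\<close>

lemma integral_grad_test:
  fixes \<phi> :: "'a::euclidean_space \<Rightarrow> real"
  assumes \<phi>: "test_function \<phi>"
  shows "(LBINT x. grad \<phi> x \<bullet> v) = 0"
proof -
  have s: "smooth \<phi>" using \<phi> test_functionD by blast
  obtain K where K: "compact K" "\<And>x. x \<notin> K \<Longrightarrow> \<phi> x = 0" using \<phi> by (auto simp: test_function_def)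
  obtain C where C: "0 \<le> C" "\<And>x. norm (grad \<phi> x) \<le> C" using test_function_bounded[OF \<phi>] by metis
  \<comment> \<open>The region swept by translating \<open>K\<close> backwards along
    \<open>v\<close>; it contains the supports of all difference quotients with step at most 1,
    which gives one integrable majorant.\<close>
  define K' where "K' = (\<lambda>(x, t). x - t *\<^sub>R v) ` (K \<times> {0..1::real})"
  have K': "compact K'" unfolding K'_def
    by (intro compact_continuous_image compact_Times K)
       (auto intro!: continuous_intros simp: case_prod_unfold)
  have [measurable]: "K' \<in> sets borel" using K' by (simp add: compact_imp_closed borel_closed)
  have [measurable]: "\<phi> \<in> borel_measurable borel" "grad \<phi> \<in> borel_measurable borel"
    by (simp_all add: smooth_measurable s smooth_grad)
  define s where "s = (\<lambda>n. inverse (real (Suc n)))"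
  have s01: "0 < s n" "s n \<le> 1" for n by (auto simp: s_def field_simps)
  have s0: "s \<longlonglongrightarrow> 0" unfolding s_def by (rule LIMSEQ_inverse_real_of_nat)
  have int: "integrable lborel \<phi>"
    using integrable_test_real(1)[OF locally_integrable_continuous[OF continuous_on_const[of _ 1]] \<phi>] by simp
  have "(\<lambda>n. \<integral>x. (\<phi> (x + s n *\<^sub>R v) - \<phi> x) / s n \<partial>lborel) \<longlonglongrightarrow> (LBINT x. grad \<phi> x \<bullet> v)"
  proof (rule integral_dominated_convergence[where w="\<lambda>x. indicator K' x * (C * norm v)"])
    show "integrable lborel (\<lambda>x. indicat_real K' x * (C * norm v))"
      using K' by (intro integrable_mult_left integrable_real_indicator emeasure_compact_finite) auto
    show "AE x in lborel. (\<lambda>n. (\<phi> (x + s n *\<^sub>R v) - \<phi> x) / s n) \<longlonglongrightarrow> grad \<phi> x \<bullet> v"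
    proof (rule AE_I2)
      fix x
      have "((\<lambda>t. x + t *\<^sub>R v) has_derivative (\<lambda>r. r *\<^sub>R v)) (at 0)"
        by (auto intro!: derivative_eq_intros)
      from has_derivative_compose[OF this smooth_has_derivative_grad[OF \<open>smooth \<phi>\<close>]]
      have "((\<lambda>t. \<phi> (x + t *\<^sub>R v)) has_real_derivative (grad \<phi> x \<bullet> v)) (at 0)"
        by (simp add: has_field_derivative_def mult.commute[of _ "grad \<phi> x \<bullet> v"])
      then have "((\<lambda>t. (\<phi> (x + t *\<^sub>R v) - \<phi> x) / t) \<longlongrightarrow> grad \<phi> x \<bullet> v) (at 0)"
        by (simp add: has_field_derivative_iff)
      then show "(\<lambda>n. (\<phi> (x + s n *\<^sub>R v) - \<phi> x) / s n) \<longlonglongrightarrow> grad \<phi> x \<bullet> v"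
        by (rule filterlim_compose) (use s0 s01(1) in \<open>auto simp: filterlim_at intro!: always_eventually less_imp_neq[symmetric]\<close>)
    qed
    show "AE x in lborel. norm ((\<phi> (x + s n *\<^sub>R v) - \<phi> x) / s n) \<le> indicat_real K' x * (C * norm v)" for n
    proof (rule AE_I2)
      fix x
      show "norm ((\<phi> (x + s n *\<^sub>R v) - \<phi> x) / s n) \<le> indicat_real K' x * (C * norm v)"
      proof (cases "x \<in> K'")
        case True
        then show ?thesis
          using test_function_lipschitz[OF \<open>smooth \<phi>\<close> C(2), of x "s n *\<^sub>R v"] s01(1)[of n]
          by (simp add: field_simps)
      next
        case False
        have "x \<notin> K" using False by (force simp: K'_def image_iff)
        moreover have "x + s n *\<^sub>R v \<notin> K"
        proof
          assume "x + s n *\<^sub>R v \<in> K"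
          then have "(x + s n *\<^sub>R v, s n) \<in> K \<times> {0..1}" using s01[of n] by simp
          then have "(\<lambda>(x, t). x - t *\<^sub>R v) (x + s n *\<^sub>R v, s n) \<in> K'" unfolding K'_def by blast
          with False show False by simp
        qed
        ultimately show ?thesis using False K by simp
      qed
    qed
  qed auto
  moreover have "(LBINT x. (\<phi> (x + s n *\<^sub>R v) - \<phi> x) / s n) = 0" for n
    using integrable_translation[OF int, of "s n *\<^sub>R v"] int integral_translation[of \<phi> "s n *\<^sub>R v"] by simp
  ultimately have "(\<lambda>n. 0) \<longlonglongrightarrow> (LBINT x. grad \<phi> x \<bullet> v)" by (simp only:)
  then show ?thesis by (rule LIMSEQ_unique) (rule tendsto_const)
qed

subsection \<open>Weak gradients\<close>

lemma weak_gradientD: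
  assumes "weak_gradient f g"
  shows "locally_integrable f" "locally_integrable g"
    "f \<in> borel_measurable borel" "g \<in> borel_measurable borel"
  using assms by (auto simp: weak_gradient_def locally_integrable_def)

text \<open>Scalar form of the definition, one identity for each direction \<open>v\<close>. Pulling
  the inner product out of the Bochner integral requires integrability, which the two local
  integrability conditions supply on the support of \<open>\<phi>\<close>.\<close>

lemma weak_gradient_iff:
  "weak_gradient f g \<longleftrightarrow> locally_integrable f \<and> locally_integrable g \<and>
     (\<forall>\<phi> v. test_function \<phi> \<longrightarrow>
        (LBINT x. f x * (grad \<phi> x \<bullet> v)) = - (LBINT x. \<phi> x * (g x \<bullet> v)))"
  (is "_ \<longleftrightarrow> _ \<and> _ \<and> ?R")
proof -
  have "(\<forall>\<phi>. test_function \<phi> \<longrightarrow>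
        (LBINT x. f x *\<^sub>R grad \<phi> x) = - (LBINT x. \<phi> x *\<^sub>R g x)) \<longleftrightarrow> ?R"
    if f: "locally_integrable f" and g: "locally_integrable g"
  proof -
    have "(LBINT x. f x *\<^sub>R grad \<phi> x) = - (LBINT x. \<phi> x *\<^sub>R g x) \<longleftrightarrow>
      (\<forall>v. (LBINT x. f x * (grad \<phi> x \<bullet> v)) = - (LBINT x. \<phi> x * (g x \<bullet> v)))"
      if \<phi>: "test_function \<phi>" for \<phi>
    proof -
      obtain K where K: "compact K" "\<And>x. x \<notin> K \<Longrightarrow> \<phi> x = 0" using \<phi> by (auto simp: test_function_def)
      have 1: "integrable lborel (\<lambda>x. f x *\<^sub>R grad \<phi> x)"
      proof -
        have "integrable lborel (\<lambda>x. \<Sum>b\<in>Basis. (f x * (grad \<phi> x \<bullet> b)) *\<^sub>R b)"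
          using integrable_test_grad[OF f \<phi>] by (intro Bochner_Integration.integrable_sum integrable_scaleR_left)
        moreover have "(\<Sum>b\<in>Basis. (f x * (grad \<phi> x \<bullet> b)) *\<^sub>R b) = f x *\<^sub>R grad \<phi> x" for x
          using euclidean_representation[of "f x *\<^sub>R grad \<phi> x"] by simp
        ultimately show ?thesis by simp
      qed
      have 2: "integrable lborel (\<lambda>x. \<phi> x *\<^sub>R g x)" by (rule integrable_test[OF g \<phi>])
      have "(LBINT x. f x * (grad \<phi> x \<bullet> v)) = (LBINT x. f x *\<^sub>R grad \<phi> x) \<bullet> v" for v
        using integral_inner_left[OF 1, of v] by simp
      moreover have "(LBINT x. \<phi> x * (g x \<bullet> v)) = (LBINT x. \<phi> x *\<^sub>R g x) \<bullet> v" for v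
        using integral_inner_left[OF 2, of v] by simp
      moreover have "a = - b \<longleftrightarrow> (\<forall>v. a \<bullet> v = - (b \<bullet> v))" for a b :: 'a
        by (metis euclidean_eqI inner_minus_left)
      ultimately show ?thesis by simp
    qed
    then show ?thesis by blast
  qed
  then show ?thesis unfolding weak_gradient_def by blast
qed

lemma weak_gradient_test:
  assumes "weak_gradient f g" "test_function \<phi>"
  shows "(LBINT x. f x * (grad \<phi> x \<bullet> v)) = - (LBINT x. \<phi> x * (g x \<bullet> v))"
  using assms weak_gradient_iff by blast

lemma weak_gradient_unique:
  assumes 1: "weak_gradient f g" and 2: "weak_gradient f g'"
  shows "AE x in lborel. g x = g' x"
proof -
  have "locally_integrable (\<lambda>x. g x + (-1) *\<^sub>R g' x)"
    by (intro locally_integrable_add locally_integrable_scaleR weak_gradientD(2)[OF 1] weak_gradientD(2)[OF 2] continuous_on_const)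
  then have "locally_integrable (\<lambda>x. g x - g' x)" by simp
  then have "AE x in lborel. g x - g' x = 0"
  proof (rule fundamental_lemma_vec)
    fix \<phi> :: "'a \<Rightarrow> real" and v assume \<phi>: "test_function \<phi>"
    have "integrable lborel (\<lambda>x. \<phi> x * (g x \<bullet> v))" "integrable lborel (\<lambda>x. \<phi> x * (g' x \<bullet> v))"
      by (intro integrable_test_real locally_integrable_inner weak_gradientD(2)[OF 1] weak_gradientD(2)[OF 2] \<phi>)+
    then have "(LBINT x. \<phi> x * ((g x - g' x) \<bullet> v)) = (LBINT x. \<phi> x * (g x \<bullet> v)) - (LBINT x. \<phi> x * (g' x \<bullet> v))"
      by (simp add: inner_diff_left right_diff_distrib)
    then show "(LBINT x. \<phi> x * ((g x - g' x) \<bullet> v)) = 0"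
      using weak_gradient_test[OF 1 \<phi>, of v] weak_gradient_test[OF 2 \<phi>, of v] by simp
  qed
  then show ?thesis by simp
qed

lemma locally_integrable_cong_AE:
  fixes f f' :: "'a::euclidean_space \<Rightarrow> 'b::euclidean_space"
  assumes "locally_integrable f" "f' \<in> borel_measurable borel" "AE x in lborel. f x = f' x"
  shows "locally_integrable f'"
  unfolding locally_integrable_def set_integrable_def
proof (intro conjI allI impI)
  fix K :: "'a set" assume K: "compact K"
  then have [measurable]: "K \<in> sets borel" by (simp add: compact_imp_closed borel_closed)
  note [measurable] = assms(2) locally_integrableD(1)[OF assms(1)]
  have "integrable lborel (\<lambda>x. indicat_real K x *\<^sub>R f x)"
    using locally_integrableD(2)[OF assms(1) K] by (simp add: set_integrable_def)
  then show "integrable lborel (\<lambda>x. indicat_real K x *\<^sub>R f' x)"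
    by (rule integrable_cong_AE_imp) (use assms(3) in auto)
qed (use assms in auto)

lemma weak_gradient_cong_AE:
  assumes wg: "weak_gradient f g" and f': "f' \<in> borel_measurable borel" "AE x in lborel. f x = f' x"
    and g': "g' \<in> borel_measurable borel" "AE x in lborel. g x = g' x"
  shows "weak_gradient f' g'"
  unfolding weak_gradient_iff
proof (intro conjI allI impI)
  show "locally_integrable f'" "locally_integrable g'"
    using locally_integrable_cong_AE weak_gradientD wg f' g' by blast+
  fix \<phi> :: "'a \<Rightarrow> real" and v :: 'a assume \<phi>: "test_function \<phi>"
  note [measurable] = f'(1) g'(1) weak_gradientD(3,4)[OF wg]
  have [measurable]: "\<phi> \<in> borel_measurable borel" "grad \<phi> \<in> borel_measurable borel"
    using test_functionD[OF \<phi>] by (auto intro: smooth_measurable smooth_grad)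
  have "(LBINT x. f' x * (grad \<phi> x \<bullet> v)) = (LBINT x. f x * (grad \<phi> x \<bullet> v))"
    by (rule integral_cong_AE) (use f'(2) in auto)
  moreover have "(LBINT x. \<phi> x * (g' x \<bullet> v)) = (LBINT x. \<phi> x * (g x \<bullet> v))"
    by (rule integral_cong_AE) (use g'(2) in auto)
  ultimately show "(LBINT x. f' x * (grad \<phi> x \<bullet> v)) = - (LBINT x. \<phi> x * (g' x \<bullet> v))"
    using weak_gradient_test[OF wg \<phi>] by simp
qed

lemma weak_gradient_lincomb:
  assumes 1: "weak_gradient f g" and 2: "weak_gradient f' g'"
  shows "weak_gradient (\<lambda>x. a * f x + b * f' x) (\<lambda>x. a *\<^sub>R g x + b *\<^sub>R g' x)"
  unfolding weak_gradient_iff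
proof (intro conjI allI impI)
  have "locally_integrable (\<lambda>x. a *\<^sub>R f x + b *\<^sub>R f' x)"
    by (intro locally_integrable_add locally_integrable_scaleR weak_gradientD(1)[OF 1] weak_gradientD(1)[OF 2] continuous_on_const)
  then show "locally_integrable (\<lambda>x. a * f x + b * f' x)" by simp
  show "locally_integrable (\<lambda>x. a *\<^sub>R g x + b *\<^sub>R g' x)"
    by (intro locally_integrable_add locally_integrable_scaleR weak_gradientD(2)[OF 1] weak_gradientD(2)[OF 2] continuous_on_const)
  fix \<phi> :: "'a \<Rightarrow> real" and v :: 'a assume \<phi>: "test_function \<phi>"
  have "(LBINT x. (a * f x + b * f' x) * (grad \<phi> x \<bullet> v))
     = (LBINT x. a * (f x * (grad \<phi> x \<bullet> v)) + b * (f' x * (grad \<phi> x \<bullet> v)))"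
    by (simp add: algebra_simps)
  also have "\<dots> = a * (LBINT x. f x * (grad \<phi> x \<bullet> v)) + b * (LBINT x. f' x * (grad \<phi> x \<bullet> v))"
    using integrable_test_grad[OF weak_gradientD(1)[OF 1] \<phi>] integrable_test_grad[OF weak_gradientD(1)[OF 2] \<phi>] by simp
  also have "\<dots> = - (a * (LBINT x. \<phi> x * (g x \<bullet> v)) + b * (LBINT x. \<phi> x * (g' x \<bullet> v)))"
    using weak_gradient_test[OF 1 \<phi>, of v] weak_gradient_test[OF 2 \<phi>, of v] by simp
  also have "a * (LBINT x. \<phi> x * (g x \<bullet> v)) + b * (LBINT x. \<phi> x * (g' x \<bullet> v))
    = (LBINT x. a * (\<phi> x * (g x \<bullet> v)) + b * (\<phi> x * (g' x \<bullet> v)))"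
    using integrable_test_real(1)[OF locally_integrable_inner[OF weak_gradientD(2)[OF 1]] \<phi>]
      integrable_test_real(1)[OF locally_integrable_inner[OF weak_gradientD(2)[OF 2]] \<phi>] by simp
  also have "\<dots> = (LBINT x. \<phi> x * ((a *\<^sub>R g x + b *\<^sub>R g' x) \<bullet> v))"
    by (simp add: algebra_simps inner_simps)
  finally show "(LBINT x. (a * f x + b * f' x) * (grad \<phi> x \<bullet> v)) = - (LBINT x. \<phi> x * ((a *\<^sub>R g x + b *\<^sub>R g' x) \<bullet> v))" .
qed

lemma weak_gradient_const: "weak_gradient (\<lambda>x. c) (\<lambda>x. 0)"
  unfolding weak_gradient_iff
proof (intro conjI allI impI)
  fix \<phi> :: "'a \<Rightarrow> real" and v assume "test_function \<phi>"
  then show "(LBINT x. c * (grad \<phi> x \<bullet> v)) = - (LBINT x. \<phi> x * (0 \<bullet> v))"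
    by (simp add: integral_grad_test)
qed (auto intro: locally_integrable_continuous continuous_on_const)

text \<open>Testing \<open>u\<close> with the test function \<eta> \<phi> and expanding its gradient
  by the classical product rule gives the Leibniz rule.\<close>

lemma weak_gradient_mult_smooth:
  assumes wg: "weak_gradient u g" and s: "smooth \<eta>"
  shows "weak_gradient (\<lambda>x. \<eta> x * u x) (\<lambda>x. \<eta> x *\<^sub>R g x + u x *\<^sub>R grad \<eta> x)"
  unfolding weak_gradient_iff
proof (intro conjI allI impI)
  have [measurable]: "u \<in> borel_measurable borel" using weak_gradientD(3)[OF wg] .
  have c: "continuous_on UNIV \<eta>" "continuous_on UNIV (grad \<eta>)"
    using s by (auto intro: smooth_continuous_on smooth_grad)
  show "locally_integrable (\<lambda>x. \<eta> x * u x)"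
    using locally_integrable_scaleR[OF weak_gradientD(1)[OF wg] c(1)] by simp
  have "locally_integrable (\<lambda>x. norm (grad \<eta> x) *\<^sub>R u x)"
    by (intro locally_integrable_scaleR weak_gradientD(1)[OF wg] continuous_on_norm c)
  moreover have "(\<lambda>x. u x *\<^sub>R grad \<eta> x) \<in> borel_measurable borel"
    using smooth_measurable[OF smooth_grad[OF s]] by simp
  ultimately have l: "locally_integrable (\<lambda>x. u x *\<^sub>R grad \<eta> x)"
    by (rule locally_integrable_bound) (simp add: abs_mult mult.commute)
  show "locally_integrable (\<lambda>x. \<eta> x *\<^sub>R g x + u x *\<^sub>R grad \<eta> x)"
    by (intro locally_integrable_add locally_integrable_scaleR l weak_gradientD(2)[OF wg] c)
  fix \<phi> :: "'a \<Rightarrow> real" and v assume \<phi>: "test_function \<phi>"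
  have s\<phi>: "smooth \<phi>" using test_functionD[OF \<phi>] by blast
  have t: "test_function (\<lambda>x. \<eta> x * \<phi> x)" by (rule test_function_mult[OF \<phi> s])
  have i1: "integrable lborel (\<lambda>x. u x * (grad (\<lambda>x. \<eta> x * \<phi> x) x \<bullet> v))"
    by (rule integrable_test_grad[OF weak_gradientD(1)[OF wg] t])
  have i2: "integrable lborel (\<lambda>x. \<phi> x * ((u x *\<^sub>R grad \<eta> x) \<bullet> v))"
    by (rule integrable_test_real(1)[OF locally_integrable_inner[OF l] \<phi>])
  have i3: "integrable lborel (\<lambda>x. (\<eta> x * \<phi> x) * (g x \<bullet> v))"
    by (rule integrable_test_real(1)[OF locally_integrable_inner[OF weak_gradientD(2)[OF wg]] t])
  have "(LBINT x. \<eta> x * u x * (grad \<phi> x \<bullet> v))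
    = (LBINT x. u x * (grad (\<lambda>x. \<eta> x * \<phi> x) x \<bullet> v) - \<phi> x * ((u x *\<^sub>R grad \<eta> x) \<bullet> v))"
    by (intro Bochner_Integration.integral_cong refl) (simp add: grad_mult[OF s s\<phi>] inner_simps algebra_simps)
  also have "\<dots> = - (LBINT x. (\<eta> x * \<phi> x) * (g x \<bullet> v)) - (LBINT x. \<phi> x * ((u x *\<^sub>R grad \<eta> x) \<bullet> v))"
    using i1 i2 weak_gradient_test[OF wg t, of v] by simp
  also have "\<dots> = - (LBINT x. (\<eta> x * \<phi> x) * (g x \<bullet> v) + \<phi> x * ((u x *\<^sub>R grad \<eta> x) \<bullet> v))"
    using i2 i3 by simp
  also have "(LBINT x. (\<eta> x * \<phi> x) * (g x \<bullet> v) + \<phi> x * ((u x *\<^sub>R grad \<eta> x) \<bullet> v))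
     = (LBINT x. \<phi> x * ((\<eta> x *\<^sub>R g x + u x *\<^sub>R grad \<eta> x) \<bullet> v))"
    by (intro Bochner_Integration.integral_cong refl) (simp add: inner_simps algebra_simps)
  finally show "(LBINT x. \<eta> x * u x * (grad \<phi> x \<bullet> v)) = - (LBINT x. \<phi> x * ((\<eta> x *\<^sub>R g x + u x *\<^sub>R grad \<eta> x) \<bullet> v))" .
qed

text \<open>The Leibniz rule for \<open>\<phi>\<close> times the constant 1; the only classical
  integration by parts behind it is \<open>integral_grad_test\<close>.\<close>

lemma weak_gradient_smooth: "smooth \<phi> \<Longrightarrow> weak_gradient \<phi> (grad \<phi>)"
  using weak_gradient_mult_smooth[OF weak_gradient_const[of 1]] by force

subsection \<open>Difference quotients of weakly differentiable functions\<close>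

lemma pair_sigma_finite_unit_ivl: "pair_sigma_finite unit_ivl (lborel :: 'a::euclidean_space measure)"
proof -
  interpret U: prob_space unit_ivl by (rule prob_space_unit_ivl)
  show ?thesis ..
qed

text \<open>Moves a segment average from one factor of an integral to the other: exchange the
  integrals, then translate \<open>x\<close> by t h. The hypothesis \<open>fin\<close> is the
  Tonelli condition that permits the exchange.\<close>

lemma segment_Fubini:
  fixes k :: "'a::euclidean_space \<Rightarrow> real" and \<psi> :: "'a \<Rightarrow> real"
  assumes k[measurable]: "k \<in> borel_measurable borel" and \<psi>[measurable]: "\<psi> \<in> borel_measurable borel"
    and fin: "AE t in unit_ivl. (\<integral>\<^sup>+x. ennreal \<bar>k (x + t *\<^sub>R h) * \<psi> x\<bar> \<partial>lborel) \<le> ennreal C"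
  shows "integrable (unit_ivl \<Otimes>\<^sub>M lborel) (\<lambda>(t, x). k (x + t *\<^sub>R h) * \<psi> x)"
    "(\<integral>x. (\<integral>t. k (x + t *\<^sub>R h) \<partial>unit_ivl) * \<psi> x \<partial>lborel) = (\<integral>t. \<integral>x. k x * \<psi> (x - t *\<^sub>R h) \<partial>lborel \<partial>unit_ivl)"
    "integrable lborel (\<lambda>x. (\<integral>t. k (x + t *\<^sub>R h) \<partial>unit_ivl) * \<psi> x)"
proof -
  interpret U: prob_space unit_ivl by (rule prob_space_unit_ivl)
  interpret pair_sigma_finite unit_ivl "lborel :: 'a measure" by (rule pair_sigma_finite_unit_ivl)
  have m[measurable]: "(\<lambda>(t, x). k (x + t *\<^sub>R h) * \<psi> x) \<in> borel_measurable (unit_ivl \<Otimes>\<^sub>M lborel)"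
    by measurable
  show i: "integrable (unit_ivl \<Otimes>\<^sub>M lborel) (\<lambda>(t, x). k (x + t *\<^sub>R h) * \<psi> x)"
  proof (rule integrableI_bounded[OF m])
    have "(\<integral>\<^sup>+z. ennreal (norm (case z of (t, x) \<Rightarrow> k (x + t *\<^sub>R h) * \<psi> x)) \<partial>(unit_ivl \<Otimes>\<^sub>M lborel))
       = (\<integral>\<^sup>+t. \<integral>\<^sup>+x. ennreal \<bar>k (x + t *\<^sub>R h) * \<psi> x\<bar> \<partial>lborel \<partial>unit_ivl)"
      by (subst sigma_finite_measure.nn_integral_fst[OF sigma_finite_lborel, symmetric]) auto
    also have "\<dots> \<le> (\<integral>\<^sup>+t. ennreal C \<partial>unit_ivl)" by (rule nn_integral_mono_AE[OF fin])
    also have "\<dots> < \<infinity>" by (simp add: U.emeasure_space_1[simplified])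
    finally show "(\<integral>\<^sup>+z. ennreal (norm (case z of (t, x) \<Rightarrow> k (x + t *\<^sub>R h) * \<psi> x)) \<partial>(unit_ivl \<Otimes>\<^sub>M lborel)) < \<infinity>" .
  qed
  have "(\<integral>x. (\<integral>t. k (x + t *\<^sub>R h) \<partial>unit_ivl) * \<psi> x \<partial>lborel) = (\<integral>x. (\<integral>t. k (x + t *\<^sub>R h) * \<psi> x \<partial>unit_ivl) \<partial>lborel)"
    by simp
  also have "\<dots> = (\<integral>t. \<integral>x. k (x + t *\<^sub>R h) * \<psi> x \<partial>lborel \<partial>unit_ivl)"
    using Fubini_integral[OF i] .
  also have "\<dots> = (\<integral>t. \<integral>x. k x * \<psi> (x - t *\<^sub>R h) \<partial>lborel \<partial>unit_ivl)"
  proof -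
    have "(LBINT x. k (x + t *\<^sub>R h) * \<psi> x) = (LBINT x. k x * \<psi> (x - t *\<^sub>R h))" for t
      using integral_translation[of "\<lambda>x. k x * \<psi> (x - t *\<^sub>R h)" "t *\<^sub>R h"] by simp
    then show ?thesis by simp
  qed
  finally show "(\<integral>x. (\<integral>t. k (x + t *\<^sub>R h) \<partial>unit_ivl) * \<psi> x \<partial>lborel) = (\<integral>t. \<integral>x. k x * \<psi> (x - t *\<^sub>R h) \<partial>lborel \<partial>unit_ivl)" .
  show "integrable lborel (\<lambda>x. (\<integral>t. k (x + t *\<^sub>R h) \<partial>unit_ivl) * \<psi> x)"
    using integrable_snd[OF i] by simp
qed

lemma locally_integrable_translation:
  fixes f :: "'a::euclidean_space \<Rightarrow> 'b::euclidean_space"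
  assumes f: "locally_integrable f"
  shows "locally_integrable (\<lambda>x. f (x + h))"
  unfolding locally_integrable_def set_integrable_def
proof (intro conjI allI impI)
  show "(\<lambda>x. f (x + h)) \<in> borel_measurable borel"
    using locally_integrableD(1)[OF f] by simp
  fix K :: "'a set" assume "compact K"
  then have "compact ((+) h ` K)" by (rule compact_translation)
  then have "integrable lborel (\<lambda>x. indicator ((+) h ` K) x *\<^sub>R f x)"
    using locally_integrableD(2)[OF f] by (simp add: set_integrable_def)
  from integrable_translation[OF this, of h]
  have "integrable lborel (\<lambda>x. indicator ((+) h ` K) (x + h) *\<^sub>R f (x + h))" .
  moreover have "indicat_real ((+) h ` K) (x + h) = indicator K x" for x
    by (auto simp: indicator_def image_iff add.commute)
  ultimately show "integrable lborel (\<lambda>x. indicat_real K x *\<^sub>R f (x + h))" by simp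
qed

text \<open>For t in the unit interval the points x + t h with x in \<open>K\<close> stay in one
  compact set, over which \<open>k\<close> is integrable; this makes the bound uniform in t.\<close>

lemma segment_bound:
  fixes k \<psi> :: "'a::euclidean_space \<Rightarrow> real"
  assumes k: "locally_integrable k" and \<psi>: "\<And>x. \<bar>\<psi> x\<bar> \<le> B" and K: "compact K" "\<And>x. x \<notin> K \<Longrightarrow> \<psi> x = 0"
    and [measurable]: "\<psi> \<in> borel_measurable borel"
  obtains C where "\<And>t. 0 \<le> t \<Longrightarrow> t \<le> 1 \<Longrightarrow> (\<integral>\<^sup>+x. ennreal \<bar>k (x + t *\<^sub>R h) * \<psi> x\<bar> \<partial>lborel) \<le> ennreal C"
proof -
  have [measurable]: "k \<in> borel_measurable borel" using k by (rule locally_integrableD)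
  define K' where "K' = (\<lambda>(x, t). x + t *\<^sub>R h) ` (K \<times> {0..1::real})"
  have K': "compact K'" unfolding K'_def
    by (intro compact_continuous_image compact_Times K)
       (auto intro!: continuous_intros simp: case_prod_unfold)
  have [measurable]: "K' \<in> sets borel" using K' by (simp add: compact_imp_closed borel_closed)
  have B0: "0 \<le> B" using \<psi>[of 0] by linarith
  have i: "integrable lborel (\<lambda>x. B * \<bar>indicator K' x * k x\<bar>)"
    using locally_integrableD(2)[OF k K'] by (simp add: set_integrable_def)
  show ?thesis
  proof (rule that)
    fix t :: real assume t: "0 \<le> t" "t \<le> 1"
    have "(\<integral>\<^sup>+x. ennreal \<bar>k (x + t *\<^sub>R h) * \<psi> x\<bar> \<partial>lborel)
      \<le> (\<integral>\<^sup>+x. ennreal (B * \<bar>indicator K' (x + t *\<^sub>R h) * k (x + t *\<^sub>R h)\<bar>) \<partial>lborel)"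
    proof (rule nn_integral_mono, rule ennreal_leI)
      fix x
      show "\<bar>k (x + t *\<^sub>R h) * \<psi> x\<bar> \<le> B * \<bar>indicator K' (x + t *\<^sub>R h) * k (x + t *\<^sub>R h)\<bar>"
      proof (cases "x \<in> K")
        case True
        then have "(x, t) \<in> K \<times> {0..1}" using t by simp
        then have "(\<lambda>(x, t). x + t *\<^sub>R h) (x, t) \<in> K'" unfolding K'_def by blast
        then show ?thesis using \<psi>[of x] by (simp add: abs_mult mult.commute mult_right_mono)
      qed (use K B0 in auto)
    qed
    also have "\<dots> = (\<integral>\<^sup>+x. ennreal (B * \<bar>indicator K' x * k x\<bar>) \<partial>lborel)"
      by (rule nn_integral_translation) simp
    also have "\<dots> = ennreal (LBINT x. B * \<bar>indicator K' x * k x\<bar>)"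
      using i B0 by (intro nn_integral_eq_integral) auto
    finally show "(\<integral>\<^sup>+x. ennreal \<bar>k (x + t *\<^sub>R h) * \<psi> x\<bar> \<partial>lborel) \<le> ennreal (LBINT x. B * \<bar>indicator K' x * k x\<bar>)" .
  qed
qed

text \<open>A fundamental theorem of calculus by duality. Against a test function, both sides become
  the integral of u(x) (\<phi>(x - h) - \<phi>(x)): the difference on the left by translation, the
  average on the right by the weak gradient identity for each translate of \<open>\<phi>\<close> and
  then the classical theorem for \<open>\<phi>\<close> in the direction -h.\<close>

lemma weak_gradient_segment:
  fixes u :: "'a::euclidean_space \<Rightarrow> real"
  assumes wg: "weak_gradient u g"
  shows "AE x in lborel. u (x + h) - u x = (\<integral>t. g (x + t *\<^sub>R h) \<bullet> h \<partial>unit_ivl)"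
proof -
  interpret U: prob_space unit_ivl by (rule prob_space_unit_ivl)
  note [measurable] = weak_gradientD(3,4)[OF wg]
  define k where "k = (\<lambda>x. g x \<bullet> h)"
  have k: "locally_integrable k" unfolding k_def by (rule locally_integrable_inner[OF weak_gradientD(2)[OF wg]])
  have [measurable]: "k \<in> borel_measurable borel" using k by (rule locally_integrableD)
  define G where "G = (\<lambda>x. \<integral>t. k (x + t *\<^sub>R h) \<partial>unit_ivl)"
  have G: "locally_integrable G"
    unfolding locally_integrable_def set_integrable_def
  proof (intro conjI allI impI)
    show "G \<in> borel_measurable borel" unfolding G_def by measurable
    fix K :: "'a set" assume K: "compact K"
    then have [measurable]: "K \<in> sets borel" by (simp add: compact_imp_closed borel_closed)
    \<comment> \<open>With an indicator in place of a smooth weight, the same Fubini argument yields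
      local integrability of the average.\<close>
    obtain C where C: "\<And>t. 0 \<le> t \<Longrightarrow> t \<le> 1 \<Longrightarrow> (\<integral>\<^sup>+x. ennreal \<bar>k (x + t *\<^sub>R h) * indicator K x\<bar> \<partial>lborel) \<le> ennreal C"
      by (rule segment_bound[OF k _ K, of "indicator K" 1]) auto
    have "integrable lborel (\<lambda>x. G x * indicator K x)"
      unfolding G_def
      by (rule segment_Fubini(3)[where C=C]) (use AE_unit_ivl C in auto)
    then show "integrable lborel (\<lambda>x. indicat_real K x *\<^sub>R G x)" by (simp add: mult.commute)
  qed
  have uh: "locally_integrable (\<lambda>x. u (x + h))" by (rule locally_integrable_translation[OF weak_gradientD(1)[OF wg]])
  have "locally_integrable (\<lambda>x. (u (x + h) + (-1) *\<^sub>R u x) + (-1) *\<^sub>R G x)"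
    by (intro locally_integrable_add locally_integrable_scaleR uh weak_gradientD(1)[OF wg] G continuous_on_const)
  then have d: "locally_integrable (\<lambda>x. u (x + h) - u x - G x)" by simp
  have "AE x in lborel. u (x + h) - u x - G x = 0"
  proof (rule fundamental_lemma[OF d])
    fix \<phi> :: "'a \<Rightarrow> real" assume \<phi>: "test_function \<phi>"
    have s: "smooth \<phi>" using \<phi> test_functionD by blast
    have [measurable]: "\<phi> \<in> borel_measurable borel" "grad \<phi> \<in> borel_measurable borel"
      using s by (auto intro: smooth_measurable smooth_grad)
    obtain K where K: "compact K" "\<And>x. x \<notin> K \<Longrightarrow> \<phi> x = 0" using \<phi> by (auto simp: test_function_def)
    obtain B where B: "\<And>x. \<bar>\<phi> x\<bar> \<le> B" "\<And>x. norm (grad \<phi> x) \<le> B" using test_function_bounded[OF \<phi>] by metis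
    have trans: "test_function (\<lambda>x. \<phi> (x - a))" "grad (\<lambda>x. \<phi> (x - a)) x = grad \<phi> (x - a)" for a x
    proof -
      show "grad (\<lambda>x. \<phi> (x - a)) x = grad \<phi> (x - a)" using grad_comp_affine[OF s, of 1 "-a" x] by simp
      have "smooth (\<lambda>x. \<phi> (x - a))" using smooth_comp_affine[OF bounded_linear_ident s, of "-a"] by simp
      moreover have "\<phi> (x - a) = 0" if "x \<notin> (+) a ` K" for x
        using K(2)[of "x - a"] that by (force simp: image_iff)
      ultimately show "test_function (\<lambda>x. \<phi> (x - a))"
        unfolding test_function_def using compact_translation[OF K(1)] by blast
    qed
    obtain C where C: "\<And>t. 0 \<le> t \<Longrightarrow> t \<le> 1 \<Longrightarrow> (\<integral>\<^sup>+x. ennreal \<bar>k (x + t *\<^sub>R h) * \<phi> x\<bar> \<partial>lborel) \<le> ennreal C"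
      by (rule segment_bound[OF k B(1) K]) auto
    have F1: "(LBINT x. G x * \<phi> x) = (\<integral>t. \<integral>x. k x * \<phi> (x - t *\<^sub>R h) \<partial>lborel \<partial>unit_ivl)"
      unfolding G_def
      by (rule segment_Fubini(2)[where C=C]) (use AE_unit_ivl C in auto)
    have kb: "\<bar>grad \<phi> x \<bullet> - h\<bar> \<le> B * norm h" for x
      using Cauchy_Schwarz_ineq2[of "grad \<phi> x" "-h"] mult_right_mono[OF B(2)[of x] norm_ge_zero[of h]] by simp
    have k0: "grad \<phi> x \<bullet> - h = 0" if "x \<notin> K" for x
      using grad_eq_0_off_compact[of K \<phi> x] K that by simp
    obtain C' where C': "\<And>t. 0 \<le> t \<Longrightarrow> t \<le> 1 \<Longrightarrow> (\<integral>\<^sup>+x. ennreal \<bar>u (x + t *\<^sub>R h) * (grad \<phi> x \<bullet> - h)\<bar> \<partial>lborel) \<le> ennreal C'"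
      by (rule segment_bound[OF weak_gradientD(1)[OF wg] kb K(1) k0]) auto
    \<comment> \<open>Here the roles are exchanged: \<open>\<phi>\<close> is averaged and
      \<open>u\<close> is the weight. For each t the inner integral agrees with the one in
      \<open>F1\<close>, by the definition of the weak gradient.\<close>
    have F2: "(\<integral>x. (\<integral>t. grad \<phi> (x + t *\<^sub>R (- h)) \<bullet> - h \<partial>unit_ivl) * u x \<partial>lborel)
       = (\<integral>t. \<integral>x. (grad \<phi> x \<bullet> - h) * u (x - t *\<^sub>R (- h)) \<partial>lborel \<partial>unit_ivl)"
    proof (rule segment_Fubini(2)[where C=C'])
      show "AE t in unit_ivl. (\<integral>\<^sup>+x. ennreal \<bar>(grad \<phi> (x + t *\<^sub>R (- h)) \<bullet> - h) * u x\<bar> \<partial>lborel) \<le> ennreal C'"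
        using AE_unit_ivl
      proof eventually_elim
        case (elim t)
        have "(\<integral>\<^sup>+x. ennreal \<bar>(grad \<phi> (x + t *\<^sub>R (- h)) \<bullet> - h) * u x\<bar> \<partial>lborel)
          = (\<integral>\<^sup>+x. ennreal \<bar>u (x + t *\<^sub>R h) * (grad \<phi> x \<bullet> - h)\<bar> \<partial>lborel)"
          using nn_integral_translation[of "\<lambda>x. ennreal \<bar>(grad \<phi> (x + t *\<^sub>R (- h)) \<bullet> - h) * u x\<bar>" "t *\<^sub>R h", symmetric]
          by (simp add: mult.commute)
        with C' elim show ?case by simp
      qed
    qed auto
    have "(LBINT x. (grad \<phi> x \<bullet> - h) * u (x - t *\<^sub>R (- h))) = (LBINT x. k x * \<phi> (x - t *\<^sub>R h))" for t
    proof -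
      have "(LBINT x. (grad \<phi> x \<bullet> - h) * u (x - t *\<^sub>R (- h))) = (LBINT x. - (u x * (grad (\<lambda>x. \<phi> (x - t *\<^sub>R h)) x \<bullet> h)))"
        using integral_translation[of "\<lambda>x. (grad \<phi> (x - t *\<^sub>R h) \<bullet> - h) * u x" "t *\<^sub>R h"]
        by (simp add: trans mult.commute)
      also have "\<dots> = (LBINT x. \<phi> (x - t *\<^sub>R h) * (g x \<bullet> h))"
        using weak_gradient_test[OF wg trans(1), of "t *\<^sub>R h" h] by simp
      finally show ?thesis by (simp add: k_def mult.commute)
    qed
    then have F3: "(LBINT x. (\<phi> (x - h) - \<phi> x) * u x) = (LBINT x. G x * \<phi> x)"
      using F1 F2 smooth_FTC[OF s, of _ "-h"] by simp
    have i: "integrable lborel (\<lambda>x. \<phi> x * u (x + h))" "integrable lborel (\<lambda>x. \<phi> x * u x)" "integrable lborel (\<lambda>x. \<phi> x * G x)"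
      "integrable lborel (\<lambda>x. \<phi> (x - h) * u x)"
      by (intro integrable_test_real(1) uh weak_gradientD(1)[OF wg] G \<phi> trans)+
    have "(LBINT x. \<phi> x * (u (x + h) - u x - G x)) = (LBINT x. \<phi> x * u (x + h)) - (LBINT x. \<phi> x * u x) - (LBINT x. \<phi> x * G x)"
      using i by (simp add: right_diff_distrib)
    also have "(LBINT x. \<phi> x * u (x + h)) = (LBINT x. \<phi> (x - h) * u x)"
      using integral_translation[of "\<lambda>x. \<phi> (x - h) * u x" h] by simp
    finally have "(LBINT x. \<phi> x * (u (x + h) - u x - G x))
      = (LBINT x. \<phi> (x - h) * u x) - (LBINT x. \<phi> x * u x) - (LBINT x. G x * \<phi> x)"
      by (simp add: mult.commute)
    moreover have "(LBINT x. (\<phi> (x - h) - \<phi> x) * u x) = (LBINT x. \<phi> (x - h) * u x) - (LBINT x. \<phi> x * u x)"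
      using i by (simp add: left_diff_distrib)
    ultimately show "(LBINT x. \<phi> x * (u (x + h) - u x - G x)) = 0"
      using F3 by simp
  qed
  then show ?thesis by (simp add: G_def k_def)
qed

text \<open>Nonnegativity of the variance. The right side is a nonnegative integral so that no
  integrability has to be assumed: if the square is not integrable, that side is infinite, whatever
  value the Bochner integral on the left takes.\<close>

lemma (in prob_space) square_integral_le:
  fixes f :: "'a \<Rightarrow> real"
  assumes [measurable]: "f \<in> borel_measurable M"
  shows "ennreal ((\<integral>x. f x \<partial>M)\<^sup>2) \<le> (\<integral>\<^sup>+x. ennreal ((f x)\<^sup>2) \<partial>M)"
proof (cases "integrable M (\<lambda>x. (f x)\<^sup>2)")
  case True
  then have "integrable M f" by (rule square_integrable_imp_integrable[rotated]) simp
  then have "(\<integral>x. f x \<partial>M)\<^sup>2 \<le> (\<integral>x. (f x)\<^sup>2 \<partial>M)"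
    using variance_eq[of f] True variance_positive[of f] by simp
  then show ?thesis using True by (simp add: nn_integral_eq_integral)
next
  case False
  have "(\<integral>\<^sup>+x. ennreal (norm ((f x)\<^sup>2)) \<partial>M) = \<infinity>"
  proof (rule ccontr)
    assume "(\<integral>\<^sup>+x. ennreal (norm ((f x)\<^sup>2)) \<partial>M) \<noteq> \<infinity>"
    then have "integrable M (\<lambda>x. (f x)\<^sup>2)"
      by (intro integrableI_bounded) (auto simp: less_top[symmetric])
    with False show False by blast
  qed
  then show ?thesis by simp
qed

text \<open>The square of a segment average is at most the average of squares; convexity keeps the
  segment in \<open>B\<close> when its ends are there; Tonelli and translation invariance finish.
  \<open>B\<close> is a ball for the local Poincare inequality and the whole space for
  \<open>L2_difference\<close>.\<close>

lemma nn_integral_difference_le: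
  fixes u :: "'a::euclidean_space \<Rightarrow> real"
  assumes wg: "weak_gradient u g" and [measurable]: "B \<in> sets borel" and B: "convex B"
  shows "(\<integral>\<^sup>+x. indicator B x * indicator B (x + h) * ennreal ((u (x + h) - u x)\<^sup>2) \<partial>lborel)
    \<le> ennreal ((norm h)\<^sup>2) * (\<integral>\<^sup>+x. indicator B x * ennreal ((norm (g x))\<^sup>2) \<partial>lborel)"
proof -
  interpret U: prob_space unit_ivl by (rule prob_space_unit_ivl)
  interpret pair_sigma_finite unit_ivl "lborel :: 'a measure" by (rule pair_sigma_finite_unit_ivl)
  note [measurable] = weak_gradientD(3,4)[OF wg]
  define q where "q = (\<lambda>y. indicator B y * ennreal ((norm (g y))\<^sup>2))"
  have [measurable]: "q \<in> borel_measurable borel" unfolding q_def by measurable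
  have "AE x in lborel. indicator B x * indicator B (x + h) * ennreal ((u (x + h) - u x)\<^sup>2)
      \<le> (\<integral>\<^sup>+t. ennreal ((norm h)\<^sup>2) * q (x + t *\<^sub>R h) \<partial>unit_ivl)"
    using weak_gradient_segment[OF wg, of h]
  proof eventually_elim
    case (elim x)
    show ?case
    proof (cases "x \<in> B \<and> x + h \<in> B")
      case True
      have "ennreal ((u (x + h) - u x)\<^sup>2) \<le> (\<integral>\<^sup>+t. ennreal ((g (x + t *\<^sub>R h) \<bullet> h)\<^sup>2) \<partial>unit_ivl)"
        unfolding elim by (rule U.square_integral_le) measurable
      also have "\<dots> \<le> (\<integral>\<^sup>+t. ennreal ((norm h)\<^sup>2) * q (x + t *\<^sub>R h) \<partial>unit_ivl)"
      proof (rule nn_integral_mono_AE)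
        show "AE t in unit_ivl. ennreal ((g (x + t *\<^sub>R h) \<bullet> h)\<^sup>2) \<le> ennreal ((norm h)\<^sup>2) * q (x + t *\<^sub>R h)"
          using AE_unit_ivl
        proof eventually_elim
          case (elim t)
          have "(1 - t) *\<^sub>R x + t *\<^sub>R (x + h) \<in> B"
            using B True elim by (intro convexD) auto
          then have "x + t *\<^sub>R h \<in> B" by (simp add: algebra_simps)
          moreover have "(g (x + t *\<^sub>R h) \<bullet> h)\<^sup>2 \<le> (norm h)\<^sup>2 * (norm (g (x + t *\<^sub>R h)))\<^sup>2"
            using Cauchy_Schwarz_ineq[of "g (x + t *\<^sub>R h)" h] by (simp add: power2_norm_eq_inner mult.commute)
          ultimately show ?case by (simp add: q_def ennreal_mult[symmetric])
        qed
      qed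
      finally show ?thesis using True by simp
    qed auto
  qed
  then have "(\<integral>\<^sup>+x. indicator B x * indicator B (x + h) * ennreal ((u (x + h) - u x)\<^sup>2) \<partial>lborel)
    \<le> (\<integral>\<^sup>+x. \<integral>\<^sup>+t. ennreal ((norm h)\<^sup>2) * q (x + t *\<^sub>R h) \<partial>unit_ivl \<partial>lborel)"
    by (rule nn_integral_mono_AE)
  also have "\<dots> = (\<integral>\<^sup>+t. \<integral>\<^sup>+x. ennreal ((norm h)\<^sup>2) * q (x + t *\<^sub>R h) \<partial>lborel \<partial>unit_ivl)"
    by (rule Fubini') measurable
  also have "\<dots> = (\<integral>\<^sup>+t. ennreal ((norm h)\<^sup>2) * (\<integral>\<^sup>+x. q x \<partial>lborel) \<partial>unit_ivl)"
    by (simp add: nn_integral_cmult nn_integral_translation)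
  also have "\<dots> = ennreal ((norm h)\<^sup>2) * (\<integral>\<^sup>+x. q x \<partial>lborel)"
    by (simp add: U.emeasure_space_1[simplified])
  finally show ?thesis by (simp add: q_def)
qed

section \<open>Square-integrable functions: Cauchy-Schwarz, integration by parts and the chain rule
  for squares\<close>

lemma abs_mult_le_sum_squares: "\<bar>a * b\<bar> \<le> a\<^sup>2 + b\<^sup>2" for a b :: real
proof -
  have "0 \<le> (\<bar>a\<bar> - \<bar>b\<bar>)\<^sup>2" by simp
  then have "2 * (\<bar>a\<bar> * \<bar>b\<bar>) \<le> a\<^sup>2 + b\<^sup>2" by (simp add: power2_diff)
  moreover have "0 \<le> \<bar>a\<bar> * \<bar>b\<bar>" by simp
  ultimately show ?thesis unfolding abs_mult by linarith
qed

lemma norm_add_sq_le: "(norm (a + b))\<^sup>2 \<le> 2 * ((norm a)\<^sup>2 + (norm b)\<^sup>2)" for a b :: "'a::real_normed_vector"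
proof -
  have "(norm (a + b))\<^sup>2 \<le> (norm a + norm b)\<^sup>2" by (intro power_mono norm_triangle_ineq) simp
  also have "\<dots> \<le> 2 * ((norm a)\<^sup>2 + (norm b)\<^sup>2)"
    using zero_le_power2[of "norm a - norm b"] by (simp add: power2_diff power2_sum)
  finally show ?thesis .
qed

lemma integrable_mult_L2:
  fixes f g :: "'a \<Rightarrow> real"
  assumes [measurable]: "f \<in> borel_measurable M" "g \<in> borel_measurable M"
    and f: "integrable M (\<lambda>x. (f x)\<^sup>2)" and g: "integrable M (\<lambda>x. (g x)\<^sup>2)"
  shows "integrable M (\<lambda>x. f x * g x)"
proof (rule Bochner_Integration.integrable_bound)
  show "integrable M (\<lambda>x. (f x)\<^sup>2 + (g x)\<^sup>2)" using f g by simp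
  show "AE x in M. norm (f x * g x) \<le> norm ((f x)\<^sup>2 + (g x)\<^sup>2)"
    using abs_mult_le_sum_squares by (intro AE_I2) simp
qed simp

lemma Cauchy_Schwarz_integral:
  fixes f g :: "'a \<Rightarrow> real"
  assumes [measurable]: "f \<in> borel_measurable M" "g \<in> borel_measurable M"
    and f: "integrable M (\<lambda>x. (f x)\<^sup>2)" and g: "integrable M (\<lambda>x. (g x)\<^sup>2)"
  shows "\<bar>\<integral>x. f x * g x \<partial>M\<bar> \<le> sqrt (\<integral>x. (f x)\<^sup>2 \<partial>M) * sqrt (\<integral>x. (g x)\<^sup>2 \<partial>M)"
proof -
  have i: "integrable M (\<lambda>x. \<bar>f x\<bar> * \<bar>g x\<bar>)"
    using integrable_abs[OF integrable_mult_L2[OF assms]] by (simp add: abs_mult)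
  let ?A = "\<integral>x. \<bar>f x\<bar> * \<bar>g x\<bar> \<partial>M"
  have nn: "(\<integral>\<^sup>+x. ennreal \<bar>f x\<bar> * ennreal \<bar>g x\<bar> \<partial>M) = ennreal ?A"
    using nn_integral_eq_integral[OF i] by (simp add: ennreal_mult)
  have "ennreal (?A\<^sup>2) = (\<integral>\<^sup>+x. ennreal \<bar>f x\<bar> * ennreal \<bar>g x\<bar> \<partial>M)\<^sup>2"
    unfolding nn by (simp add: ennreal_power)
  also have "\<dots> \<le> (\<integral>\<^sup>+x. (ennreal \<bar>f x\<bar>)\<^sup>2 \<partial>M) * (\<integral>\<^sup>+x. (ennreal \<bar>g x\<bar>)\<^sup>2 \<partial>M)"
    by (rule Cauchy_Schwarz_nn_integral) simp_all
  also have "\<dots> = ennreal ((\<integral>x. (f x)\<^sup>2 \<partial>M) * (\<integral>x. (g x)\<^sup>2 \<partial>M))"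
    using f g by (simp add: ennreal_power nn_integral_eq_integral ennreal_mult)
  finally have "?A\<^sup>2 \<le> (\<integral>x. (f x)\<^sup>2 \<partial>M) * (\<integral>x. (g x)\<^sup>2 \<partial>M)"
    by (subst (asm) ennreal_le_iff) simp_all
  then have "?A \<le> sqrt ((\<integral>x. (f x)\<^sup>2 \<partial>M) * (\<integral>x. (g x)\<^sup>2 \<partial>M))" by (rule real_le_rsqrt)
  moreover have "\<bar>\<integral>x. f x * g x \<partial>M\<bar> \<le> ?A"
    using integral_abs_bound[of M "\<lambda>x. f x * g x"] by (simp add: abs_mult)
  ultimately show ?thesis by (simp add: real_sqrt_mult)
qed

lemma nn_integral_le_imp_integrable:
  fixes f :: "'a \<Rightarrow> real"
  assumes [measurable]: "f \<in> borel_measurable M" and "\<And>x. 0 \<le> f x"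
    and le: "(\<integral>\<^sup>+x. ennreal (f x) \<partial>M) \<le> ennreal C" and "0 \<le> C"
  shows "integrable M f" "(\<integral>x. f x \<partial>M) \<le> C"
proof -
  have "(\<integral>\<^sup>+x. ennreal (f x) \<partial>M) < \<infinity>"
    using le ennreal_less_top[of C] by (simp add: order_le_less_trans)
  then show i: "integrable M f" using assms(2) by (intro integrableI_bounded) auto
  have "ennreal (\<integral>x. f x \<partial>M) \<le> ennreal C"
    using nn_integral_eq_integral[OF i] assms(2) le by simp
  then show "(\<integral>x. f x \<partial>M) \<le> C" using assms(4) by simp
qed

lemma L2_difference:
  fixes u :: "'a::euclidean_space \<Rightarrow> real"
  assumes wg: "weak_gradient u g" and g: "integrable lborel (\<lambda>x. (norm (g x))\<^sup>2)"
  shows "integrable lborel (\<lambda>x. (u (x + h) - u x)\<^sup>2)"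
    "(LBINT x. (u (x + h) - u x)\<^sup>2) \<le> (norm h)\<^sup>2 * (LBINT x. (norm (g x))\<^sup>2)"
proof -
  note [measurable] = weak_gradientD(3,4)[OF wg]
  have "(\<integral>\<^sup>+x. ennreal ((u (x + h) - u x)\<^sup>2) \<partial>lborel) \<le> ennreal ((norm h)\<^sup>2) * (\<integral>\<^sup>+x. ennreal ((norm (g x))\<^sup>2) \<partial>lborel)"
    using nn_integral_difference_le[OF wg, of UNIV h] by simp
  also have "\<dots> = ennreal ((norm h)\<^sup>2 * (LBINT x. (norm (g x))\<^sup>2))"
    using g by (simp add: nn_integral_eq_integral ennreal_mult)
  finally have le: "(\<integral>\<^sup>+x. ennreal ((u (x + h) - u x)\<^sup>2) \<partial>lborel) \<le> ennreal ((norm h)\<^sup>2 * (LBINT x. (norm (g x))\<^sup>2))" .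
  show "integrable lborel (\<lambda>x. (u (x + h) - u x)\<^sup>2)"
    by (rule nn_integral_le_imp_integrable(1)[OF _ _ le]) auto
  show "(LBINT x. (u (x + h) - u x)\<^sup>2) \<le> (norm h)\<^sup>2 * (LBINT x. (norm (g x))\<^sup>2)"
    by (rule nn_integral_le_imp_integrable(2)[OF _ _ le]) auto
qed

lemma L2_inner:
  fixes g :: "'x \<Rightarrow> 'a::euclidean_space"
  assumes [measurable]: "g \<in> borel_measurable M" and g: "integrable M (\<lambda>x. (norm (g x))\<^sup>2)"
  shows "integrable M (\<lambda>x. (g x \<bullet> v)\<^sup>2)"
    "(\<integral>x. (g x \<bullet> v)\<^sup>2 \<partial>M) \<le> (norm v)\<^sup>2 * (\<integral>x. (norm (g x))\<^sup>2 \<partial>M)"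
proof -
  have le: "(g x \<bullet> v)\<^sup>2 \<le> (norm v)\<^sup>2 * (norm (g x))\<^sup>2" for x
    using Cauchy_Schwarz_ineq[of "g x" v] by (simp add: power2_norm_eq_inner mult.commute)
  show i: "integrable M (\<lambda>x. (g x \<bullet> v)\<^sup>2)"
    by (rule Bochner_Integration.integrable_bound[OF integrable_mult_right[OF g, of "(norm v)\<^sup>2"]]) (use le in auto)
  have "(\<integral>x. (g x \<bullet> v)\<^sup>2 \<partial>M) \<le> (\<integral>x. (norm v)\<^sup>2 * (norm (g x))\<^sup>2 \<partial>M)"
    by (rule integral_mono[OF i]) (use g le in auto)
  then show "(\<integral>x. (g x \<bullet> v)\<^sup>2 \<partial>M) \<le> (norm v)\<^sup>2 * (\<integral>x. (norm (g x))\<^sup>2 \<partial>M)" by simp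
qed

text \<open>The error is of second order although only first derivatives exist. One factor |h| comes
  from \<open>gw\<close> in the segment formula; the shift in its argument is moved onto
  \<open>z\<close>, where \<open>L2_difference\<close> pays for it with another |h|.\<close>

lemma weak_difference_quotient:
  fixes w z :: "'a::euclidean_space \<Rightarrow> real"
  assumes w: "weak_gradient w gw" "integrable lborel (\<lambda>x. (norm (gw x))\<^sup>2)"
    and z: "weak_gradient z gz" "integrable lborel (\<lambda>x. (z x)\<^sup>2)" "integrable lborel (\<lambda>x. (norm (gz x))\<^sup>2)"
  shows "\<bar>(LBINT x. (w (x + h) - w x) * z x) - (LBINT x. (gw x \<bullet> h) * z x)\<bar>
    \<le> (norm h)\<^sup>2 * (sqrt (LBINT x. (norm (gw x))\<^sup>2) * sqrt (LBINT x. (norm (gz x))\<^sup>2))"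
proof -
  interpret U: prob_space unit_ivl by (rule prob_space_unit_ivl)
  interpret pair_sigma_finite unit_ivl "lborel :: 'a measure" by (rule pair_sigma_finite_unit_ivl)
  note [measurable] = weak_gradientD(3,4)[OF w(1)] weak_gradientD(3,4)[OF z(1)]
  define k where "k = (\<lambda>x. gw x \<bullet> h)"
  have [measurable]: "k \<in> borel_measurable borel" unfolding k_def by measurable
  have k2: "integrable lborel (\<lambda>x. (k x)\<^sup>2)" "(LBINT x. (k x)\<^sup>2) \<le> (norm h)\<^sup>2 * (LBINT x. (norm (gw x))\<^sup>2)"
    unfolding k_def by (rule L2_inner; use w in simp)+
  define C where "C = (LBINT x. (k x)\<^sup>2) + (LBINT x. (z x)\<^sup>2)"
  have bnd: "(\<integral>\<^sup>+x. ennreal \<bar>k (x + t *\<^sub>R h) * z x\<bar> \<partial>lborel) \<le> ennreal C" for t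
  proof -
    have "(\<integral>\<^sup>+x. ennreal \<bar>k (x + t *\<^sub>R h) * z x\<bar> \<partial>lborel) \<le> (\<integral>\<^sup>+x. ennreal ((k (x + t *\<^sub>R h))\<^sup>2) + ennreal ((z x)\<^sup>2) \<partial>lborel)"
      by (rule nn_integral_mono) (simp add: ennreal_plus[symmetric] abs_mult_le_sum_squares del: ennreal_plus)
    also have "\<dots> = (\<integral>\<^sup>+x. ennreal ((k (x + t *\<^sub>R h))\<^sup>2) \<partial>lborel) + (\<integral>\<^sup>+x. ennreal ((z x)\<^sup>2) \<partial>lborel)"
      by (rule nn_integral_add) auto
    also have "(\<integral>\<^sup>+x. ennreal ((k (x + t *\<^sub>R h))\<^sup>2) \<partial>lborel) = (\<integral>\<^sup>+x. ennreal ((k x)\<^sup>2) \<partial>lborel)"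
      using nn_integral_translation[of "\<lambda>x. ennreal ((k x)\<^sup>2)" "t *\<^sub>R h"] by simp
    also have "\<dots> + (\<integral>\<^sup>+x. ennreal ((z x)\<^sup>2) \<partial>lborel) = ennreal C"
      using k2(1) z(2) by (simp add: nn_integral_eq_integral C_def ennreal_plus)
    finally show ?thesis .
  qed
  define I where "I = (\<lambda>t. \<integral>x. k x * z (x - t *\<^sub>R h) \<partial>lborel)"
  have bnd': "AE t in unit_ivl. (\<integral>\<^sup>+x. ennreal \<bar>k (x + t *\<^sub>R h) * z x\<bar> \<partial>lborel) \<le> ennreal C"
    using bnd by simp
  have "(LBINT x. (w (x + h) - w x) * z x) = (\<integral>x. (\<integral>t. k (x + t *\<^sub>R h) \<partial>unit_ivl) * z x \<partial>lborel)"
    by (rule integral_cong_AE) (use weak_gradient_segment[OF w(1), of h] in \<open>auto simp: k_def\<close>)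
  also have "\<dots> = (\<integral>t. I t \<partial>unit_ivl)"
    unfolding I_def by (rule segment_Fubini(2)[OF _ _ bnd']) auto
  finally have eq: "(LBINT x. (w (x + h) - w x) * z x) = (\<integral>t. I t \<partial>unit_ivl)" .
  have int: "integrable unit_ivl I"
  proof -
    have "integrable unit_ivl (\<lambda>t. \<integral>x. k (x + t *\<^sub>R h) * z x \<partial>lborel)"
      using integrable_fst[OF segment_Fubini(1)[OF _ _ bnd']] by simp
    moreover have "(LBINT x. k (x + t *\<^sub>R h) * z x) = I t" for t
      using integral_translation[of "\<lambda>x. k x * z (x - t *\<^sub>R h)" "t *\<^sub>R h"] by (simp add: I_def)
    ultimately show ?thesis by simp
  qed
  let ?B = "(norm h)\<^sup>2 * (sqrt (LBINT x. (norm (gw x))\<^sup>2) * sqrt (LBINT x. (norm (gz x))\<^sup>2))"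
  have le: "\<bar>I t - (LBINT x. k x * z x)\<bar> \<le> ?B" if t: "0 \<le> t \<and> t \<le> 1" for t
  proof -
    have z2: "integrable lborel (\<lambda>x. (z (x - t *\<^sub>R h))\<^sup>2)"
      using integrable_translation[OF z(2), of "- (t *\<^sub>R h)"] by simp
    have d: "integrable lborel (\<lambda>x. (z (x - t *\<^sub>R h) - z x)\<^sup>2)"
      "(LBINT x. (z (x - t *\<^sub>R h) - z x)\<^sup>2) \<le> (norm (t *\<^sub>R h))\<^sup>2 * (LBINT x. (norm (gz x))\<^sup>2)"
      using L2_difference[OF z(1,3), of "- (t *\<^sub>R h)"] by simp_all
    have "(norm (t *\<^sub>R h))\<^sup>2 \<le> (norm h)\<^sup>2"
      using t by (intro power_mono) (auto simp: mult_left_le_one_le)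
    then have d': "(LBINT x. (z (x - t *\<^sub>R h) - z x)\<^sup>2) \<le> (norm h)\<^sup>2 * (LBINT x. (norm (gz x))\<^sup>2)"
      by (intro order_trans[OF d(2)] mult_right_mono) simp_all
    have "I t - (LBINT x. k x * z x) = (LBINT x. k x * z (x - t *\<^sub>R h) - k x * z x)"
      unfolding I_def using k2(1) z(2) z2
      by (intro Bochner_Integration.integral_diff[symmetric] integrable_mult_L2) auto
    also have "\<dots> = (LBINT x. k x * (z (x - t *\<^sub>R h) - z x))"
      by (simp add: right_diff_distrib)
    finally have "\<bar>I t - (LBINT x. k x * z x)\<bar> \<le> sqrt (LBINT x. (k x)\<^sup>2) * sqrt (LBINT x. (z (x - t *\<^sub>R h) - z x)\<^sup>2)"
      using Cauchy_Schwarz_integral[OF _ _ k2(1) d(1)] by simp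
    also have "\<dots> \<le> sqrt ((norm h)\<^sup>2 * (LBINT x. (norm (gw x))\<^sup>2)) * sqrt ((norm h)\<^sup>2 * (LBINT x. (norm (gz x))\<^sup>2))"
      by (intro mult_mono real_sqrt_le_mono k2 d') auto
    also have "\<dots> = ?B" by (simp add: real_sqrt_mult power2_eq_square)
    finally show ?thesis .
  qed
  have "(\<integral>t. I t \<partial>unit_ivl) - (LBINT x. k x * z x) = (\<integral>t. I t - (LBINT x. k x * z x) \<partial>unit_ivl)"
    using int by (simp add: U.prob_space[simplified])
  also have "\<bar>\<dots>\<bar> \<le> (\<integral>t. \<bar>I t - (LBINT x. k x * z x)\<bar> \<partial>unit_ivl)"
    by (rule integral_abs_bound)
  also have "\<dots> \<le> (\<integral>t. ?B \<partial>unit_ivl)"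
    by (intro integral_mono_AE eventually_mono[OF AE_unit_ivl le]) (use int in auto)
  also have "\<dots> = ?B" by (simp add: U.prob_space[simplified])
  finally show ?thesis unfolding eq k_def .
qed

text \<open>Summation by parts for the difference quotients of \<open>w\<close> and \<open>z\<close> in the directions \<open>b\<close> and \<open>-b\<close>
  is exact, and both quotients converge weakly.\<close>

lemma integration_by_parts_L2:
  fixes w z :: "'a::euclidean_space \<Rightarrow> real"
  assumes w: "weak_gradient w gw" "integrable lborel (\<lambda>x. (w x)\<^sup>2)" "integrable lborel (\<lambda>x. (norm (gw x))\<^sup>2)"
    and z: "weak_gradient z gz" "integrable lborel (\<lambda>x. (z x)\<^sup>2)" "integrable lborel (\<lambda>x. (norm (gz x))\<^sup>2)"
  shows "(LBINT x. (gw x \<bullet> b) * z x) + (LBINT x. (gz x \<bullet> b) * w x) = 0" (is "?Q = 0")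
proof (rule ccontr)
  assume Q: "?Q \<noteq> 0"
  note [measurable] = weak_gradientD(3,4)[OF w(1)] weak_gradientD(3,4)[OF z(1)]
  define C where "C = (norm b)\<^sup>2 * (sqrt (LBINT x. (norm (gw x))\<^sup>2) * sqrt (LBINT x. (norm (gz x))\<^sup>2))"
  have C0: "0 \<le> C" unfolding C_def by (intro mult_nonneg_nonneg) auto
  have le: "\<bar>?Q\<bar> \<le> s * (2 * C)" if s: "0 < s" for s
  proof -
    define h where "h = s *\<^sub>R b"
    have i: "integrable lborel (\<lambda>x. w x * z x)" "integrable lborel (\<lambda>x. w (x + h) * z x)" "integrable lborel (\<lambda>x. w x * z (x - h))"
      using w(2) z(2) integrable_translation[OF w(2), of h] integrable_translation[OF z(2), of "-h"]
      by (auto intro!: integrable_mult_L2)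
    have "(LBINT x. (w (x + h) - w x) * z x) = (LBINT x. w (x + h) * z x) - (LBINT x. w x * z x)"
      using i by (simp add: left_diff_distrib)
    also have "(LBINT x. w (x + h) * z x) = (LBINT x. w x * z (x - h))"
      using integral_translation[of "\<lambda>x. w x * z (x - h)" h] by simp
    also have "(LBINT x. w x * z (x - h)) - (LBINT x. w x * z x) = (LBINT x. (z (x + - h) - z x) * w x)"
      using i by (simp add: algebra_simps)
    finally have eq: "(LBINT x. (w (x + h) - w x) * z x) = (LBINT x. (z (x + - h) - z x) * w x)" .
    have 1: "\<bar>(LBINT x. (w (x + h) - w x) * z x) - s * (LBINT x. (gw x \<bullet> b) * z x)\<bar> \<le> s\<^sup>2 * C"
      using weak_difference_quotient[OF w(1,3) z(1,2,3), of h]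
      by (simp add: h_def C_def power_mult_distrib mult.assoc)
    have 2: "\<bar>(LBINT x. (z (x + - h) - z x) * w x) + s * (LBINT x. (gz x \<bullet> b) * w x)\<bar> \<le> s\<^sup>2 * C"
      using weak_difference_quotient[OF z(1,3) w(1,2,3), of "-h"]
      by (simp add: h_def C_def power_mult_distrib mult.assoc mult.commute[of "sqrt (LBINT x. (norm (gz x))\<^sup>2)"])
    have "s * \<bar>?Q\<bar> = \<bar>s * ?Q\<bar>" using s by (simp add: abs_mult)
    also have "\<dots> \<le> s * (s * (2 * C))"
      using 1 2 unfolding eq by (simp add: distrib_left power2_eq_square abs_le_iff)
    finally show ?thesis using s by simp
  qed
  \<comment> \<open>The bound \<open>le\<close> holds for all positive steps. This step replaces a
    passage to the limit: 4C + 1 is positive even if C = 0, and it exceeds 2C, which contradicts a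
    nonzero \<open>?Q\<close>.\<close>
  have "\<bar>?Q\<bar> \<le> \<bar>?Q\<bar> / (4 * C + 1) * (2 * C)" by (rule le) (use Q C0 in auto)
  then have "\<bar>?Q\<bar> * (4 * C + 1) \<le> \<bar>?Q\<bar> * (2 * C)" using C0 by (simp add: field_simps)
  then have "4 * C + 1 \<le> 2 * C" using Q by (subst (asm) mult_le_cancel_left_pos) auto
  then show False using C0 by simp
qed

lemma locally_integrable_L2_mult:
  fixes u :: "'a::euclidean_space \<Rightarrow> real" and g :: "'a \<Rightarrow> 'b::euclidean_space"
  assumes [measurable]: "u \<in> borel_measurable borel" "g \<in> borel_measurable borel"
    and u: "locally_integrable (\<lambda>x. (u x)\<^sup>2)" and g: "locally_integrable (\<lambda>x. (norm (g x))\<^sup>2)"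
  shows "locally_integrable (\<lambda>x. u x * (g x \<bullet> v))"
proof (rule locally_integrable_bound)
  show "locally_integrable (\<lambda>x. norm v *\<^sub>R ((u x)\<^sup>2 + (norm (g x))\<^sup>2))"
    by (intro locally_integrable_scaleR locally_integrable_add u g continuous_on_const)
  show "(\<lambda>x. u x * (g x \<bullet> v)) \<in> borel_measurable borel" by measurable
  fix x
  have "\<bar>u x\<bar> * norm (g x) \<le> (u x)\<^sup>2 + (norm (g x))\<^sup>2"
    using abs_mult_le_sum_squares[of "u x" "norm (g x)"] by (simp add: abs_mult)
  then have "norm v * (\<bar>u x\<bar> * norm (g x)) \<le> norm v * ((u x)\<^sup>2 + (norm (g x))\<^sup>2)" by (rule mult_left_mono) simp
  moreover have "\<bar>u x * (g x \<bullet> v)\<bar> \<le> norm v * (\<bar>u x\<bar> * norm (g x))"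
    using mult_left_mono[OF Cauchy_Schwarz_ineq2[of "g x" v] abs_ge_zero[of "u x"]] by (simp add: abs_mult mult_ac)
  ultimately show "norm (u x * (g x \<bullet> v)) \<le> norm (norm v *\<^sub>R ((u x)\<^sup>2 + (norm (g x))\<^sup>2))"
    by (simp add: abs_mult)
qed

text \<open>A test function turns locally square-integrable data into globally square-integrable
  data, as \<open>integration_by_parts_L2\<close> demands. The vector field in the second claim is
  the weak gradient of the product.\<close>

lemma L2_mult_test:
  fixes u :: "'a::euclidean_space \<Rightarrow> real"
  assumes wg: "weak_gradient u g"
    and u: "locally_integrable (\<lambda>x. (u x)\<^sup>2)" and g: "locally_integrable (\<lambda>x. (norm (g x))\<^sup>2)"
    and \<phi>: "test_function \<phi>"
  shows "integrable lborel (\<lambda>x. (\<phi> x * u x)\<^sup>2)"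
    "integrable lborel (\<lambda>x. (norm (\<phi> x *\<^sub>R g x + u x *\<^sub>R grad \<phi> x))\<^sup>2)"
proof -
  note [measurable] = weak_gradientD(3,4)[OF wg]
  have s: "smooth \<phi>" using \<phi> test_functionD by blast
  have [measurable]: "\<phi> \<in> borel_measurable borel" "grad \<phi> \<in> borel_measurable borel"
    using s by (auto intro: smooth_measurable smooth_grad)
  obtain K where K: "compact K" "\<And>x. x \<notin> K \<Longrightarrow> \<phi> x = 0" using \<phi> by (auto simp: test_function_def)
  have c: "continuous_on UNIV (\<lambda>x. (\<phi> x)\<^sup>2)" "continuous_on UNIV (\<lambda>x. (norm (grad \<phi> x))\<^sup>2)"
    using s by (intro continuous_on_power continuous_on_norm smooth_continuous_on smooth_grad; assumption)+
  have z: "grad \<phi> x = 0" if "x \<notin> K" for x using grad_eq_0_off_compact[of K \<phi> x] K that by simp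
  have 1: "integrable lborel (\<lambda>x. (\<phi> x)\<^sup>2 * (u x)\<^sup>2)"
    using integrable_locally[OF u c(1) K(1)] K(2) by simp
  then show "integrable lborel (\<lambda>x. (\<phi> x * u x)\<^sup>2)" by (simp add: power_mult_distrib)
  have 2: "integrable lborel (\<lambda>x. (\<phi> x)\<^sup>2 * (norm (g x))\<^sup>2)"
    using integrable_locally[OF g c(1) K(1)] K(2) by simp
  have 3: "integrable lborel (\<lambda>x. (norm (grad \<phi> x))\<^sup>2 * (u x)\<^sup>2)"
    using integrable_locally[OF u c(2) K(1)] z by simp
  show "integrable lborel (\<lambda>x. (norm (\<phi> x *\<^sub>R g x + u x *\<^sub>R grad \<phi> x))\<^sup>2)"
  proof (rule Bochner_Integration.integrable_bound)
    show "integrable lborel (\<lambda>x. 2 * ((\<phi> x)\<^sup>2 * (norm (g x))\<^sup>2 + (norm (grad \<phi> x))\<^sup>2 * (u x)\<^sup>2))"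
      using 2 3 by simp
    show "AE x in lborel. norm ((norm (\<phi> x *\<^sub>R g x + u x *\<^sub>R grad \<phi> x))\<^sup>2)
        \<le> norm (2 * ((\<phi> x)\<^sup>2 * (norm (g x))\<^sup>2 + (norm (grad \<phi> x))\<^sup>2 * (u x)\<^sup>2))"
    proof (rule AE_I2)
      fix x
      show "norm ((norm (\<phi> x *\<^sub>R g x + u x *\<^sub>R grad \<phi> x))\<^sup>2)
        \<le> norm (2 * ((\<phi> x)\<^sup>2 * (norm (g x))\<^sup>2 + (norm (grad \<phi> x))\<^sup>2 * (u x)\<^sup>2))"
        using norm_add_sq_le[of "\<phi> x *\<^sub>R g x" "u x *\<^sub>R grad \<phi> x"]
        by (simp add: power_mult_distrib mult.commute[of "(u x)\<^sup>2"])
    qed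
  qed measurable
qed

text \<open>Integration by parts is applied to \<eta>_n u and \<phi> u, the two factors of u^2 with
  different cutoffs. The sum of the two integrands is \<eta>_n A + B \<nabla>\<eta>_n \<bullet> v,
  where A is the integrand of the claim and B = \<phi> u^2; the cutoff is then removed by dominated
  convergence.\<close>

lemma weak_gradient_square:
  fixes u :: "'a::euclidean_space \<Rightarrow> real"
  assumes wg: "weak_gradient u g"
    and u: "locally_integrable (\<lambda>x. (u x)\<^sup>2)" and g: "locally_integrable (\<lambda>x. (norm (g x))\<^sup>2)"
  shows "weak_gradient (\<lambda>x. (u x)\<^sup>2) (\<lambda>x. (2 * u x) *\<^sub>R g x)"
  unfolding weak_gradient_iff
proof (intro conjI allI impI)
  note [measurable] = weak_gradientD(3,4)[OF wg]
  show "locally_integrable (\<lambda>x. (u x)\<^sup>2)" by (rule u)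
  have lug: "locally_integrable (\<lambda>x. u x * (g x \<bullet> v))" for v
    by (rule locally_integrable_L2_mult[OF _ _ u g]) auto
  have "locally_integrable (\<lambda>x. 2 *\<^sub>R ((u x)\<^sup>2 + (norm (g x))\<^sup>2))"
    by (intro locally_integrable_scaleR locally_integrable_add u g continuous_on_const)
  then show "locally_integrable (\<lambda>x. (2 * u x) *\<^sub>R g x)"
  proof (rule locally_integrable_bound)
    fix x
    have "2 * (\<bar>u x\<bar> * norm (g x)) \<le> 2 * ((u x)\<^sup>2 + (norm (g x))\<^sup>2)"
      using abs_mult_le_sum_squares[of "u x" "norm (g x)"] by (simp add: abs_mult)
    then show "norm ((2 * u x) *\<^sub>R g x) \<le> norm (2 *\<^sub>R ((u x)\<^sup>2 + (norm (g x))\<^sup>2))"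
      by (simp add: abs_mult)
  qed measurable
  fix \<phi> :: "'a \<Rightarrow> real" and v :: 'a assume \<phi>: "test_function \<phi>"
  have s: "smooth \<phi>" using \<phi> test_functionD by blast
  have [measurable]: "\<phi> \<in> borel_measurable borel" "grad \<phi> \<in> borel_measurable borel"
    using s by (auto intro: smooth_measurable smooth_grad)
  obtain \<eta> :: "nat \<Rightarrow> 'a \<Rightarrow> real" and C where \<eta>: "0 \<le> C" "\<And>n. test_function (\<eta> n)" "\<And>n x. \<bar>\<eta> n x\<bar> \<le> C"
    "\<And>x. (\<lambda>n. \<eta> n x) \<longlonglongrightarrow> 1" "\<And>n x. norm (grad (\<eta> n) x) \<le> C" "\<And>x. (\<lambda>n. grad (\<eta> n) x) \<longlonglongrightarrow> 0"
    using cutoff_sequence by metis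
  have s\<eta>: "smooth (\<eta> n)" for n using \<eta>(2) test_functionD by blast
  have [measurable]: "\<eta> n \<in> borel_measurable borel" "grad (\<eta> n) \<in> borel_measurable borel" for n
    using s\<eta> by (auto intro: smooth_measurable smooth_grad)
  have i1: "integrable lborel (\<lambda>x. \<phi> x * (u x * (g x \<bullet> v)))" by (rule integrable_test_real(1)[OF lug \<phi>])
  have i2: "integrable lborel (\<lambda>x. (u x)\<^sup>2 * (grad \<phi> x \<bullet> v))" by (rule integrable_test_grad[OF u \<phi>])
  have i3: "integrable lborel (\<lambda>x. \<phi> x * (u x)\<^sup>2)" by (rule integrable_test_real(1)[OF u \<phi>])
  define A where "A = (\<lambda>x. 2 * (\<phi> x * (u x * (g x \<bullet> v))) + (u x)\<^sup>2 * (grad \<phi> x \<bullet> v))"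
  define B where "B = (\<lambda>x. \<phi> x * (u x)\<^sup>2)"
  have iA: "integrable lborel A" unfolding A_def using i1 i2 by simp
  have iB: "integrable lborel B" unfolding B_def using i3 by simp
  have [measurable]: "A \<in> borel_measurable borel" "B \<in> borel_measurable borel"
    unfolding A_def B_def by measurable
  have "(\<lambda>n. \<integral>x. \<eta> n x * A x + B x * (grad (\<eta> n) x \<bullet> v) \<partial>lborel) \<longlonglongrightarrow> (LBINT x. A x)"
  proof (rule integral_dominated_convergence[where w="\<lambda>x. C * \<bar>A x\<bar> + C * norm v * \<bar>B x\<bar>"])
    show "AE x in lborel. (\<lambda>n. \<eta> n x * A x + B x * (grad (\<eta> n) x \<bullet> v)) \<longlonglongrightarrow> A x"
    proof (rule AE_I2)
      fix x
      have "(\<lambda>n. \<eta> n x * A x + B x * (grad (\<eta> n) x \<bullet> v)) \<longlonglongrightarrow> 1 * A x + B x * (0 \<bullet> v)"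
        by (intro tendsto_intros \<eta>)
      then show "(\<lambda>n. \<eta> n x * A x + B x * (grad (\<eta> n) x \<bullet> v)) \<longlonglongrightarrow> A x" by simp
    qed
    show "AE x in lborel. norm (\<eta> n x * A x + B x * (grad (\<eta> n) x \<bullet> v)) \<le> C * \<bar>A x\<bar> + C * norm v * \<bar>B x\<bar>" for n
    proof (rule AE_I2)
      fix x
      have "\<bar>grad (\<eta> n) x \<bullet> v\<bar> \<le> C * norm v"
        using Cauchy_Schwarz_ineq2[of "grad (\<eta> n) x" v] mult_right_mono[OF \<eta>(5)[of n x] norm_ge_zero[of v]] by linarith
      then have "\<bar>B x * (grad (\<eta> n) x \<bullet> v)\<bar> \<le> C * norm v * \<bar>B x\<bar>"
        by (simp add: abs_mult mult.commute[of "\<bar>B x\<bar>"] mult_right_mono)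
      moreover have "\<bar>\<eta> n x * A x\<bar> \<le> C * \<bar>A x\<bar>" using \<eta>(3)[of n x] by (simp add: abs_mult mult_right_mono)
      ultimately show "norm (\<eta> n x * A x + B x * (grad (\<eta> n) x \<bullet> v)) \<le> C * \<bar>A x\<bar> + C * norm v * \<bar>B x\<bar>"
        unfolding real_norm_def by linarith
    qed
  qed (use iA iB in auto)
  moreover have "(LBINT x. \<eta> n x * A x + B x * (grad (\<eta> n) x \<bullet> v)) = 0" for n
  proof -
    let ?w = "\<lambda>x. \<eta> n x * u x" and ?gw = "\<lambda>x. \<eta> n x *\<^sub>R g x + u x *\<^sub>R grad (\<eta> n) x"
    let ?z = "\<lambda>x. \<phi> x * u x" and ?gz = "\<lambda>x. \<phi> x *\<^sub>R g x + u x *\<^sub>R grad \<phi> x"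
    note w = weak_gradient_mult_smooth[OF wg s\<eta>, of n] L2_mult_test[OF wg u g \<eta>(2), of n]
    note z = weak_gradient_mult_smooth[OF wg s] L2_mult_test[OF wg u g \<phi>]
    have m[measurable]: "?w \<in> borel_measurable borel" "?z \<in> borel_measurable borel"
       "?gw \<in> borel_measurable borel" "?gz \<in> borel_measurable borel" by measurable
    have "integrable lborel (\<lambda>x. (?gw x \<bullet> v) * ?z x)" "integrable lborel (\<lambda>x. (?gz x \<bullet> v) * ?w x)"
      using w z m by (auto intro!: integrable_mult_L2 L2_inner(1))
    then have "(LBINT x. (?gw x \<bullet> v) * ?z x + (?gz x \<bullet> v) * ?w x) = 0"
      using integration_by_parts_L2[OF w z, of v] by (subst Bochner_Integration.integral_add)
    moreover have "(?gw x \<bullet> v) * ?z x + (?gz x \<bullet> v) * ?w x = \<eta> n x * A x + B x * (grad (\<eta> n) x \<bullet> v)" for x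
      by (simp add: A_def B_def inner_simps algebra_simps power2_eq_square)
    ultimately show ?thesis by simp
  qed
  ultimately have "(\<lambda>n. 0) \<longlonglongrightarrow> (LBINT x. A x)" by (simp only:)
  then have A0: "(LBINT x. A x) = 0" using LIMSEQ_unique tendsto_const by blast
  show "(LBINT x. (u x)\<^sup>2 * (grad \<phi> x \<bullet> v)) = - (LBINT x. \<phi> x * (((2 * u x) *\<^sub>R g x) \<bullet> v))"
  proof -
    have "(LBINT x. A x) = 2 * (LBINT x. \<phi> x * (u x * (g x \<bullet> v))) + (LBINT x. (u x)\<^sup>2 * (grad \<phi> x \<bullet> v))"
      unfolding A_def using i1 i2 by simp
    moreover have "(LBINT x. \<phi> x * (((2 * u x) *\<^sub>R g x) \<bullet> v)) = (LBINT x. 2 * (\<phi> x * (u x * (g x \<bullet> v))))"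
      by (intro Bochner_Integration.integral_cong) auto
    ultimately show ?thesis using A0 by simp
  qed
qed

subsection \<open>The Poincare inequality\<close>

text \<open>The double integral of (u x - u y)^2 over the ball is sliced by h = x - y. Only |h|
  \<le> 2R contributes, and each slice is at most |h|^2 times the gradient integral, whence K =
  (2R)^2 \<open>b2\<close> / \<open>b\<close> after dividing by the volume of the ball. The constant
  c is the value of u at a point y that does no worse than average; no mean of u over the ball has
  to exist.\<close>

lemma local_Poincare:
  assumes R: "0 < R"
  obtains K where "0 \<le> K"
    "\<And>(u :: 'a::euclidean_space \<Rightarrow> real) g. weak_gradient u g \<Longrightarrow>
      (\<exists>c. (\<integral>\<^sup>+x. indicator (cball 0 R) x * ennreal ((u x - c)\<^sup>2) \<partial>lborel)
        \<le> ennreal K * (\<integral>\<^sup>+x. indicator (cball 0 R) x * ennreal ((norm (g x))\<^sup>2) \<partial>lborel))"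
proof -
  let ?B = "cball (0::'a) R"
  define b where "b = measure lborel ?B"
  have eb: "emeasure lborel ?B = ennreal b"
    using emeasure_lborel_cball_finite[of "0::'a" R] unfolding b_def by (auto intro!: emeasure_eq_ennreal_measure)
  have b: "0 < b"
    using content_cball_pos[OF R, of "0::'a"] unfolding b_def by simp
  define b2 where "b2 = measure lborel (cball (0::'a) (2 * R))"
  have eb2: "emeasure lborel (cball (0::'a) (2 * R)) = ennreal b2"
    using emeasure_lborel_cball_finite[of "0::'a" "2 * R"] unfolding b2_def by (auto intro!: emeasure_eq_ennreal_measure)
  have b2: "0 \<le> b2" by (simp add: b2_def)
  define K where "K = (2 * R)\<^sup>2 * b2 / b"
  show ?thesis
  proof (rule that[of K])
    show K: "0 \<le> K" using b b2 by (simp add: K_def)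
    fix u :: "'a \<Rightarrow> real" and g assume wg: "weak_gradient u g"
    note [measurable] = weak_gradientD(3,4)[OF wg]
    have [measurable]: "?B \<in> sets borel" "cball 0 (2 * R) \<in> sets (borel :: 'a measure)" by simp_all
    define G where "G = (\<integral>\<^sup>+x. indicator ?B x * ennreal ((norm (g x))\<^sup>2) \<partial>lborel)"
    define J where "J = (\<lambda>y. \<integral>\<^sup>+x. indicator ?B x * ennreal ((u x - u y)\<^sup>2) \<partial>lborel)"
    have [measurable]: "J \<in> borel_measurable borel" unfolding J_def by measurable
    have "\<exists>c. (\<integral>\<^sup>+x. indicator ?B x * ennreal ((u x - c)\<^sup>2) \<partial>lborel) \<le> ennreal K * G"
    \<comment> \<open>Because 0 times infinity is 0 in \<open>ennreal\<close>, an infinite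
      \<open>G\<close> trivializes the claim only if \<open>K\<close> is nonzero. In the other case
      the product is finite, as the strict comparison of integrals below requires.\<close>
    proof (cases "G = \<infinity> \<and> K \<noteq> 0")
      case True
      then show ?thesis using K by (auto simp: ennreal_mult_eq_top_iff)
    next
      case False
      have "(\<integral>\<^sup>+y. indicator ?B y * J y \<partial>lborel)
        = (\<integral>\<^sup>+y. \<integral>\<^sup>+x. indicator ?B y * indicator ?B x * ennreal ((u x - u y)\<^sup>2) \<partial>lborel \<partial>lborel)"
        unfolding J_def by (simp add: nn_integral_cmult[symmetric] mult.assoc)
      also have "\<dots> = (\<integral>\<^sup>+y. \<integral>\<^sup>+h. indicator ?B y * indicator ?B (y + h) * ennreal ((u (y + h) - u y)\<^sup>2) \<partial>lborel \<partial>lborel)"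
      proof (rule nn_integral_cong)
        fix y
        show "(\<integral>\<^sup>+x. indicator ?B y * indicator ?B x * ennreal ((u x - u y)\<^sup>2) \<partial>lborel)
          = (\<integral>\<^sup>+h. indicator ?B y * indicator ?B (y + h) * ennreal ((u (y + h) - u y)\<^sup>2) \<partial>lborel)"
          using nn_integral_translation[of "\<lambda>x. indicator ?B y * indicator ?B x * ennreal ((u x - u y)\<^sup>2)" y]
          by (simp add: add.commute)
      qed
      also have "\<dots> = (\<integral>\<^sup>+h. \<integral>\<^sup>+y. indicator ?B y * indicator ?B (y + h) * ennreal ((u (y + h) - u y)\<^sup>2) \<partial>lborel \<partial>lborel)"
        by (rule lborel_pair.Fubini') measurable
      also have "\<dots> \<le> (\<integral>\<^sup>+h. indicator (cball (0::'a) (2 * R)) h * (ennreal ((2 * R)\<^sup>2) * G) \<partial>lborel)"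
      proof (rule nn_integral_mono)
        fix h :: 'a
        show "(\<integral>\<^sup>+y. indicator ?B y * indicator ?B (y + h) * ennreal ((u (y + h) - u y)\<^sup>2) \<partial>lborel)
           \<le> indicator (cball (0::'a) (2 * R)) h * (ennreal ((2 * R)\<^sup>2) * G)"
        proof (cases "h \<in> cball 0 (2 * R)")
          case True
          have "(\<integral>\<^sup>+y. indicator ?B y * indicator ?B (y + h) * ennreal ((u (y + h) - u y)\<^sup>2) \<partial>lborel) \<le> ennreal ((norm h)\<^sup>2) * G"
            unfolding G_def by (rule nn_integral_difference_le[OF wg]) auto
          also have "\<dots> \<le> ennreal ((2 * R)\<^sup>2) * G"
            using True by (intro mult_right_mono ennreal_leI power_mono) auto
          finally show ?thesis using True by simp
        next
          case False
          have "y \<notin> ?B \<or> y + h \<notin> ?B" for y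
            using norm_triangle_ineq4[of "y + h" y] False by auto
          then have z: "indicator ?B y * indicator ?B (y + h) = (0 :: ennreal)" for y
            by (auto simp: indicator_def)
          show ?thesis unfolding z by simp
        qed
      qed
      also have "\<dots> = ennreal b2 * (ennreal ((2 * R)\<^sup>2) * G)"
        by (simp add: nn_integral_multc eb2)
      also have "\<dots> = ennreal ((2 * R)\<^sup>2 * b2) * G"
        using b2 by (simp add: ennreal_mult mult_ac)
      also have "(2 * R)\<^sup>2 * b2 = b * K" using b by (simp add: K_def)
      also have "ennreal (b * K) * G = ennreal b * (ennreal K * G)" using b K by (simp add: ennreal_mult mult.assoc)
      finally have le: "(\<integral>\<^sup>+y. indicator ?B y * J y \<partial>lborel) \<le> ennreal b * (ennreal K * G)" .
      have fin: "ennreal K * G \<noteq> \<infinity>" using False by (auto simp: ennreal_mult_eq_top_iff)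
      \<comment> \<open>Averaging: if every point of the ball exceeded the bound, so would the
        integral, since the ball has positive volume.\<close>
      have "\<exists>y\<in>?B. J y \<le> ennreal K * G"
      proof (rule ccontr)
        assume "\<not> ?thesis"
        then have lt: "ennreal K * G < J y" if "y \<in> ?B" for y using that by (metis not_le)
        have "(\<integral>\<^sup>+y. indicator ?B y * (ennreal K * G) \<partial>lborel) < (\<integral>\<^sup>+y. indicator ?B y * J y \<partial>lborel)"
        proof (rule nn_integral_less)
          show "(\<integral>\<^sup>+y. indicator ?B y * (ennreal K * G) \<partial>lborel) \<noteq> \<infinity>"
            using fin by (simp add: nn_integral_multc eb ennreal_mult_eq_top_iff)
          show "AE y in lborel. indicator ?B y * (ennreal K * G) \<le> indicator ?B y * J y"
            using lt by (auto simp: indicator_def intro: less_imp_le)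
          show "\<not> (AE y in lborel. indicator ?B y * J y \<le> indicator ?B y * (ennreal K * G))"
          proof
            assume "AE y in lborel. indicator ?B y * J y \<le> indicator ?B y * (ennreal K * G)"
            then have "AE y in lborel. y \<notin> ?B"
              by (rule AE_mp) (use lt in \<open>auto simp: indicator_def not_le[symmetric] intro!: AE_I2\<close>)
            then have "emeasure lborel ?B = 0"
              by (subst (asm) AE_iff_measurable[of ?B]) auto
            with eb b show False by simp
          qed
        qed auto
        with le show False by (simp add: nn_integral_multc eb)
      qed
      then show ?thesis unfolding J_def by blast
    qed
    then show "\<exists>c. (\<integral>\<^sup>+x. indicator ?B x * ennreal ((u x - c)\<^sup>2) \<partial>lborel)
        \<le> ennreal K * (\<integral>\<^sup>+x. indicator ?B x * ennreal ((norm (g x))\<^sup>2) \<partial>lborel)"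
      unfolding G_def .
  qed
qed

section \<open>Divergence and Laplacian of the logarithm of a density\<close>

lemma divergence_eq_sum_grad:
  fixes F :: "'a::euclidean_space \<Rightarrow> 'a"
  assumes "smooth F"
  shows "divergence F x = (\<Sum>b\<in>Basis. grad (\<lambda>y. F y \<bullet> b) x \<bullet> b)"
proof -
  have "grad (\<lambda>y. F y \<bullet> b) x \<bullet> v = frechet_derivative F (at x) v \<bullet> b" for v b
    by (rule grad_inner) (intro has_derivative_inner_left smooth_has_derivative assms)
  then show ?thesis by (simp add: divergence_def)
qed

lemma grad_ln:
  fixes p :: "'a::euclidean_space \<Rightarrow> real"
  assumes "smooth p" "0 < p x"
  shows "grad (\<lambda>y. ln (p y)) x = inverse (p x) *\<^sub>R grad p x"
  by (rule grad_eqI)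
     (use assms in \<open>auto intro!: derivative_eq_intros smooth_has_derivative_grad simp: divide_inverse\<close>)

lemma laplacian_ln:
  fixes p :: "'a::euclidean_space \<Rightarrow> real"
  assumes s: "smooth p" and pos: "\<And>x. 0 < p x"
  shows "laplacian (\<lambda>y. ln (p y)) x = laplacian p x / p x - (norm (grad p x))\<^sup>2 / (p x)\<^sup>2"
proof -
  let ?D = "frechet_derivative (grad p) (at x)"
  have d: "((\<lambda>y. inverse (p y) *\<^sub>R grad p y) has_derivative
      (\<lambda>v. inverse (p x) *\<^sub>R ?D v + (- (inverse (p x) * (grad p x \<bullet> v) * inverse (p x))) *\<^sub>R grad p x)) (at x)"
  proof (rule has_derivative_scaleR)
    show "((\<lambda>y. inverse (p y)) has_derivative (\<lambda>v. - (inverse (p x) * (grad p x \<bullet> v) * inverse (p x)))) (at x)"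
      using pos[of x] by (intro Deriv.has_derivative_inverse[OF _ smooth_has_derivative_grad[OF s]]) simp
    show "(grad p has_derivative ?D) (at x)"
      by (rule smooth_has_derivative[OF smooth_grad[OF s]])
  qed
  have e: "grad (\<lambda>y. ln (p y)) = (\<lambda>y. inverse (p y) *\<^sub>R grad p y)"
    by (rule ext) (rule grad_ln[OF s pos])
  have "frechet_derivative (grad (\<lambda>y. ln (p y))) (at x) =
     (\<lambda>v. inverse (p x) *\<^sub>R ?D v + (- (inverse (p x) * (grad p x \<bullet> v) * inverse (p x))) *\<^sub>R grad p x)"
    unfolding e by (rule frechet_derivative_eqI[OF d])
  then have "laplacian (\<lambda>y. ln (p y)) x = (\<Sum>b\<in>Basis. inverse (p x) * (?D b \<bullet> b) - (inverse (p x))\<^sup>2 * ((grad p x \<bullet> b) * (grad p x \<bullet> b)))"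
    by (simp add: laplacian_def divergence_def inner_simps power2_eq_square algebra_simps)
  also have "\<dots> = inverse (p x) * laplacian p x - (inverse (p x))\<^sup>2 * (grad p x \<bullet> grad p x)"
    unfolding laplacian_def divergence_def euclidean_inner[of "grad p x" "grad p x"]
    by (simp add: sum_subtractf sum_distrib_left)
  finally show ?thesis by (simp add: divide_inverse power2_norm_eq_inner power_inverse mult.commute)
qed

section \<open>The weighted measure, its L2 functions and the Lyapunov estimate\<close>

locale weight =
  fixes p :: "'a::euclidean_space \<Rightarrow> real"
  assumes smooth_p: "smooth p" and p_pos: "\<And>x. 0 < p x" and prob_p: "prob_space (pmeas p)"
    and bounded_p: "bounded (range p)"

sublocale weight \<subseteq> P: prob_space "pmeas p" by (rule prob_p)

context weight
begin

lemma p_measurable[measurable]: "p \<in> borel_measurable borel"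
  by (rule smooth_measurable[OF smooth_p])

lemma sets_pmeas[measurable_cong, simp]: "sets (pmeas p) = sets borel"
  and space_pmeas[simp]: "space (pmeas p) = UNIV"
  by (simp_all add: pmeas_def)

lemma measurable_pmeas: "f \<in> borel_measurable (pmeas p) \<longleftrightarrow> f \<in> borel_measurable borel"
  using measurable_cong_sets[OF sets_pmeas refl] by blast

text \<open>A strictly positive density has the null sets of Lebesgue measure. Weak gradients live
  over \<open>lborel\<close> and the Hilbert spaces over \<open>pmeas p\<close>; this lets
  statements pass between them.\<close>

lemma AE_pmeas: "(AE x in pmeas p. Q x) \<longleftrightarrow> (AE x in lborel. Q x)"
  unfolding pmeas_def by (subst AE_density) (auto simp: p_pos)

lemma integrable_pmeas:
  fixes f :: "'a \<Rightarrow> 'b::euclidean_space"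
  assumes [measurable]: "f \<in> borel_measurable borel"
  shows "integrable (pmeas p) f \<longleftrightarrow> integrable lborel (\<lambda>x. p x *\<^sub>R f x)"
  unfolding pmeas_def by (rule integrable_density) (auto simp: p_pos less_imp_le)

lemma integral_pmeas:
  fixes f :: "'a \<Rightarrow> 'b::euclidean_space"
  assumes [measurable]: "f \<in> borel_measurable borel"
  shows "(\<integral>x. f x \<partial>pmeas p) = (LBINT x. p x *\<^sub>R f x)"
  unfolding pmeas_def by (rule integral_density) (auto simp: p_pos less_imp_le)

text \<open>On a compact set the continuous positive \<open>p\<close> is bounded below by its
  minimum, so Lebesgue integrals are controlled by weighted ones.\<close>

lemma integrable_pmeas_locally:
  fixes f :: "'a \<Rightarrow> real"
  assumes [measurable]: "f \<in> borel_measurable borel" and f: "integrable (pmeas p) f"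
  shows "locally_integrable f"
  unfolding locally_integrable_def set_integrable_def
proof (intro conjI allI impI)
  fix K :: "'a set" assume K: "compact K"
  then have [measurable]: "K \<in> sets borel" by (simp add: compact_imp_closed borel_closed)
  show "integrable lborel (\<lambda>x. indicat_real K x *\<^sub>R f x)"
  proof (cases "K = {}")
    case False
    obtain y where y: "y \<in> K" "\<And>x. x \<in> K \<Longrightarrow> p y \<le> p x"
      using continuous_attains_inf[OF K False smooth_continuous_on[OF smooth_p]] by blast
    have "integrable lborel (\<lambda>x. inverse (p y) * (p x * f x))"
      using f by (simp add: integrable_pmeas)
    then show ?thesis
    proof (rule Bochner_Integration.integrable_bound)
      show "AE x in lborel. norm (indicat_real K x *\<^sub>R f x) \<le> norm (inverse (p y) * (p x * f x))"
      proof (rule AE_I2)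
        fix x
        show "norm (indicat_real K x *\<^sub>R f x) \<le> norm (inverse (p y) * (p x * f x))"
        proof (cases "x \<in> K")
          case True
          have "1 \<le> inverse (p y) * p x" using y(2)[OF True] p_pos[of y] by (simp add: field_simps)
          then have "1 * \<bar>f x\<bar> \<le> inverse (p y) * p x * \<bar>f x\<bar>" by (rule mult_right_mono) simp
          then show ?thesis using True p_pos[of x] p_pos[of y] by (simp add: abs_mult less_imp_le)
        qed simp
      qed
    qed measurable
  qed simp
qed simp

definition L2 :: "('a \<Rightarrow> 'b::euclidean_space) \<Rightarrow> bool" where
  "L2 f \<longleftrightarrow> f \<in> borel_measurable borel \<and> integrable (pmeas p) (\<lambda>x. (norm (f x))\<^sup>2)"

lemma L2_measurable: "L2 f \<Longrightarrow> f \<in> borel_measurable borel"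
  by (simp add: L2_def)

lemma L2_real: "L2 (f :: 'a \<Rightarrow> real) \<longleftrightarrow> f \<in> borel_measurable borel \<and> integrable (pmeas p) (\<lambda>x. (f x)\<^sup>2)"
  by (simp add: L2_def)

lemma L2_locally: "L2 f \<Longrightarrow> locally_integrable (\<lambda>x. (norm (f x))\<^sup>2)"
  unfolding L2_def by (intro integrable_pmeas_locally) auto

lemma L2_norm: "L2 f \<Longrightarrow> L2 (\<lambda>x. norm (f x))"
  by (auto simp: L2_def intro: borel_measurable_norm)

lemma L2_bound:
  assumes "L2 f" "g \<in> borel_measurable borel" "AE x in lborel. norm (g x) \<le> C * norm (f x)"
  shows "L2 g"
  unfolding L2_def
proof
  have "integrable (pmeas p) (\<lambda>x. C\<^sup>2 * (norm (f x))\<^sup>2)" using assms(1) by (simp add: L2_def)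
  then show "integrable (pmeas p) (\<lambda>x. (norm (g x))\<^sup>2)"
  proof (rule Bochner_Integration.integrable_bound)
    show "AE x in pmeas p. norm ((norm (g x))\<^sup>2) \<le> norm (C\<^sup>2 * (norm (f x))\<^sup>2)"
      unfolding AE_pmeas using assms(3)
    proof eventually_elim
      case (elim x)
      then have "(norm (g x))\<^sup>2 \<le> (C * norm (f x))\<^sup>2" by (intro power_mono) auto
      then show ?case by (simp add: power_mult_distrib)
    qed
  qed (use assms(2) in measurable)
qed (rule assms)

lemma L2_integrable_mult:
  "L2 f \<Longrightarrow> L2 g \<Longrightarrow> integrable (pmeas p) (\<lambda>x. f x * g x)" for f g :: "'a \<Rightarrow> real"
  by (rule integrable_mult_L2) (auto simp: L2_real)

lemma L2_integrable_inner:
  assumes "L2 f" "L2 g"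
  shows "integrable (pmeas p) (\<lambda>x. f x \<bullet> g x)"
proof -
  note [measurable] = assms[THEN L2_measurable]
  have "integrable (pmeas p) (\<lambda>x. norm (f x) * norm (g x))"
    using assms by (intro L2_integrable_mult L2_norm)
  then show ?thesis
    by (rule Bochner_Integration.integrable_bound) (auto simp: Cauchy_Schwarz_ineq2)
qed

lemma L2_integrable: "L2 (f :: 'a \<Rightarrow> real) \<Longrightarrow> integrable (pmeas p) f"
  unfolding L2_real measurable_pmeas[symmetric] using P.square_integrable_imp_integrable by blast

lemma L2_add:
  assumes f: "L2 f" and g: "L2 g" shows "L2 (\<lambda>x. f x + g x)"
proof -
  note [measurable] = f[THEN L2_measurable] g[THEN L2_measurable]
  have "integrable (pmeas p) (\<lambda>x. 2 * ((norm (f x))\<^sup>2 + (norm (g x))\<^sup>2))"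
    using f g by (simp add: L2_def)
  then have "integrable (pmeas p) (\<lambda>x. (norm (f x + g x))\<^sup>2)"
  proof (rule Bochner_Integration.integrable_bound)
    show "AE x in pmeas p. norm ((norm (f x + g x))\<^sup>2) \<le> norm (2 * ((norm (f x))\<^sup>2 + (norm (g x))\<^sup>2))"
      using norm_add_sq_le by (intro AE_I2) simp
  qed measurable
  then show ?thesis by (simp add: L2_def)
qed

lemma L2_scaleR: "L2 f \<Longrightarrow> L2 (\<lambda>x. c *\<^sub>R f x)"
  by (auto simp: L2_def power_mult_distrib intro!: borel_measurable_scaleR)

lemma L2_const: "L2 (\<lambda>x. c)"
  by (simp add: L2_def)

text \<open>The square of \<nabla>(\<phi> u) + \<beta> \<phi> u \<nabla>log p, weighted by p, has
  nonnegative integral. In its cross term 2 u g is the weak gradient of u^2; testing that with the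
  field \<phi>^2 \<nabla>p turns the whole cross term into minus \<beta> times the integral of
  \<Delta>p (\<phi> u)^2, with the derivatives of \<phi> cancelling. The compact support of
  \<open>\<phi>\<close> makes each term integrable separately.\<close>

lemma Lyapunov_localized:
  assumes wg: "weak_gradient u g" and u: "L2 u" and g: "L2 g" and \<phi>: "test_function \<phi>"
  shows "integrable lborel (\<lambda>x. \<beta> * (laplacian p x - \<beta> * (norm (grad p x))\<^sup>2 / p x) * (\<phi> x * u x)\<^sup>2)"
    "(LBINT x. \<beta> * (laplacian p x - \<beta> * (norm (grad p x))\<^sup>2 / p x) * (\<phi> x * u x)\<^sup>2)
     \<le> (\<integral>x. (norm (\<phi> x *\<^sub>R g x + u x *\<^sub>R grad \<phi> x))\<^sup>2 \<partial>pmeas p)"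
proof -
  note [measurable] = weak_gradientD(3,4)[OF wg]
  have s: "smooth \<phi>" using \<phi> test_functionD by blast
  have [measurable]: "\<phi> \<in> borel_measurable borel" "grad \<phi> \<in> borel_measurable borel"
    using s by (auto intro: smooth_measurable smooth_grad)
  have lu: "locally_integrable (\<lambda>x. (u x)\<^sup>2)" using L2_locally[OF u] by simp
  have lg: "locally_integrable (\<lambda>x. (norm (g x))\<^sup>2)" by (rule L2_locally[OF g])
  note sq = weak_gradient_square[OF wg lu lg]
  have sp: "smooth (\<lambda>x. grad p x \<bullet> b)" for b
    by (intro smooth_linear_comp[OF bounded_linear_inner_left] smooth_grad smooth_p)
  \<comment> \<open>The components of \<phi>^2 \<nabla>p; summing the weak gradient identities over
    the basis produces the divergence of this field.\<close>
  define \<psi> where "\<psi> = (\<lambda>b x. (grad p x \<bullet> b) * (\<phi> x * \<phi> x))"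
  have t\<psi>: "test_function (\<psi> b)" for b
    unfolding \<psi>_def by (intro test_function_mult \<phi> s sp)
  let ?M = "\<lambda>x. (u x)\<^sup>2 * ((\<phi> x)\<^sup>2 * laplacian p x + 2 * \<phi> x * (grad \<phi> x \<bullet> grad p x))"
  let ?N = "\<lambda>x. 2 * (\<phi> x)\<^sup>2 * u x * (g x \<bullet> grad p x)"
  have Meq: "(\<Sum>b\<in>Basis. (u x)\<^sup>2 * (grad (\<psi> b) x \<bullet> b)) = ?M x" for x
  proof -
    have "grad (\<psi> b) x \<bullet> b = (\<phi> x)\<^sup>2 * (grad (\<lambda>y. grad p y \<bullet> b) x \<bullet> b) + 2 * \<phi> x * ((grad \<phi> x \<bullet> b) * (grad p x \<bullet> b))" for b
      unfolding \<psi>_def grad_mult[OF sp smooth_mult[OF s s]] grad_mult[OF s s]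
      by (simp add: inner_simps algebra_simps power2_eq_square)
    then show ?thesis
      unfolding laplacian_def divergence_eq_sum_grad[OF smooth_grad[OF smooth_p]] euclidean_inner[of "grad \<phi> x" "grad p x"]
      by (simp add: sum_distrib_left sum.distrib algebra_simps)
  qed
  have Neq: "(\<Sum>b\<in>Basis. \<psi> b x * (((2 * u x) *\<^sub>R g x) \<bullet> b)) = ?N x" for x
    unfolding \<psi>_def euclidean_inner[of "g x" "grad p x"]
    by (simp add: sum_distrib_left power2_eq_square mult_ac)
  have iM: "integrable lborel ?M"
    unfolding Meq[symmetric]
    by (intro Bochner_Integration.integrable_sum integrable_test_grad[OF weak_gradientD(1)[OF sq] t\<psi>])
  have iN: "integrable lborel ?N"
    unfolding Neq[symmetric]
    by (intro Bochner_Integration.integrable_sum integrable_test_real(1) t\<psi> locally_integrable_inner[OF weak_gradientD(2)[OF sq]])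
  have MN: "(LBINT x. ?M x) = - (LBINT x. ?N x)"
  proof -
    have "(LBINT x. ?M x) = (\<Sum>b\<in>Basis. \<integral>x. (u x)\<^sup>2 * (grad (\<psi> b) x \<bullet> b) \<partial>lborel)"
      unfolding Meq[symmetric]
      by (rule Bochner_Integration.integral_sum) (rule integrable_test_grad[OF weak_gradientD(1)[OF sq] t\<psi>])
    also have "\<dots> = - (\<Sum>b\<in>Basis. \<integral>x. \<psi> b x * (((2 * u x) *\<^sub>R g x) \<bullet> b) \<partial>lborel)"
      unfolding weak_gradient_test[OF sq t\<psi>] by (rule sum_negf)
    also have "(\<Sum>b\<in>Basis. \<integral>x. \<psi> b x * (((2 * u x) *\<^sub>R g x) \<bullet> b) \<partial>lborel) = (LBINT x. ?N x)"
      unfolding Neq[symmetric]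
      by (rule Bochner_Integration.integral_sum[symmetric]) (intro integrable_test_real(1) t\<psi> locally_integrable_inner[OF weak_gradientD(2)[OF sq]])
    finally show ?thesis .
  qed
  obtain K where K: "compact K" "\<And>x. x \<notin> K \<Longrightarrow> \<phi> x = 0" using \<phi> by (auto simp: test_function_def)
  have cont: "integrable lborel (\<lambda>x. (h x * \<phi> x) * (u x)\<^sup>2)" if "continuous_on UNIV h" for h
    using integrable_locally[OF lu _ K(1), of "\<lambda>x. h x * \<phi> x"] K(2) that
    by (auto intro: continuous_on_mult smooth_continuous_on s)
  have clap: "continuous_on UNIV (laplacian p)"
    unfolding laplacian_def divergence_eq_sum_grad[OF smooth_grad[OF smooth_p], abs_def]
    by (intro continuous_on_sum continuous_on_inner smooth_continuous_on[OF smooth_grad[OF sp]] continuous_on_const)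
  have cp: "continuous_on UNIV p" "continuous_on UNIV (grad p)" "continuous_on UNIV \<phi>" "continuous_on UNIV (grad \<phi>)"
    by (auto intro: smooth_continuous_on smooth_grad smooth_p s)
  have iL: "integrable lborel (\<lambda>x. laplacian p x * (\<phi> x * u x)\<^sup>2)"
    using cont[of "\<lambda>x. laplacian p x * \<phi> x", OF continuous_on_mult[OF clap cp(3)]] by (simp add: power2_eq_square mult_ac)
  have iG: "integrable lborel (\<lambda>x. (norm (grad p x))\<^sup>2 / p x * (\<phi> x * u x)\<^sup>2)"
  proof -
    have "continuous_on UNIV (\<lambda>x. (norm (grad p x))\<^sup>2 / p x * \<phi> x)"
      using p_pos by (intro continuous_intros cp) (metis less_irrefl)
    from cont[OF this] show ?thesis by (simp add: power2_eq_square mult_ac)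
  qed
  have iC: "integrable lborel (\<lambda>x. 2 * \<phi> x * (grad \<phi> x \<bullet> grad p x) * (u x)\<^sup>2)"
    using cont[of "\<lambda>x. 2 * (grad \<phi> x \<bullet> grad p x)"] cp by (simp add: continuous_on_mult continuous_on_inner continuous_on_const mult_ac)
  let ?W = "\<lambda>x. \<phi> x *\<^sub>R g x + u x *\<^sub>R grad \<phi> x"
  have iW: "integrable lborel (\<lambda>x. p x * (norm (?W x))\<^sup>2)"
  proof -
    obtain B where B: "\<And>x. \<bar>p x\<bar> \<le> B" using bounded_p by (auto simp: bounded_iff)
    have "integrable lborel (\<lambda>x. B * (norm (?W x))\<^sup>2)" using L2_mult_test(2)[OF wg lu lg \<phi>] by simp
    then show ?thesis
      by (rule Bochner_Integration.integrable_bound)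
         (auto simp: abs_mult intro!: AE_I2 mult_right_mono order_trans[OF B])
  qed
  show int: "integrable lborel (\<lambda>x. \<beta> * (laplacian p x - \<beta> * (norm (grad p x))\<^sup>2 / p x) * (\<phi> x * u x)\<^sup>2)"
    using integrable_mult_right[OF iL, of \<beta>] integrable_mult_right[OF iG, of "\<beta>\<^sup>2"]
    by (auto simp: algebra_simps power2_eq_square dest: Bochner_Integration.integrable_diff)
  have pw: "p x * (norm (?W x + (\<beta> * \<phi> x * u x / p x) *\<^sub>R grad p x))\<^sup>2
      = p x * (norm (?W x))\<^sup>2 + \<beta> * (?N x + 2 * \<phi> x * (grad \<phi> x \<bullet> grad p x) * (u x)\<^sup>2) + \<beta>\<^sup>2 * ((norm (grad p x))\<^sup>2 / p x * (\<phi> x * u x)\<^sup>2)" for x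
  proof -
    have "p x * (norm (a + (k / p x) *\<^sub>R b))\<^sup>2 = p x * (norm a)\<^sup>2 + 2 * k * (a \<bullet> b) + k\<^sup>2 * (norm b)\<^sup>2 / p x" for a b :: 'a and k
      using p_pos[of x] unfolding power2_norm_eq_inner
      by (simp add: inner_simps field_simps power2_eq_square inner_commute)
    from this[of "?W x" "\<beta> * \<phi> x * u x" "grad p x"] show ?thesis
      by (simp add: inner_simps algebra_simps power2_eq_square)
  qed
  have "0 \<le> (LBINT x. p x * (norm (?W x + (\<beta> * \<phi> x * u x / p x) *\<^sub>R grad p x))\<^sup>2)"
    by (intro Bochner_Integration.integral_nonneg) (simp add: p_pos less_imp_le)
  also have "\<dots> = (LBINT x. p x * (norm (?W x))\<^sup>2 + \<beta> * (?N x + 2 * \<phi> x * (grad \<phi> x \<bullet> grad p x) * (u x)\<^sup>2) + \<beta>\<^sup>2 * ((norm (grad p x))\<^sup>2 / p x * (\<phi> x * u x)\<^sup>2))"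
    unfolding pw ..
  also have "(LBINT x. p x * (norm (?W x))\<^sup>2 + \<beta> * (?N x + 2 * \<phi> x * (grad \<phi> x \<bullet> grad p x) * (u x)\<^sup>2) + \<beta>\<^sup>2 * ((norm (grad p x))\<^sup>2 / p x * (\<phi> x * u x)\<^sup>2))
    = (LBINT x. p x * (norm (?W x))\<^sup>2) + \<beta> * ((LBINT x. ?N x) + (LBINT x. 2 * \<phi> x * (grad \<phi> x \<bullet> grad p x) * (u x)\<^sup>2)) + \<beta>\<^sup>2 * (LBINT x. (norm (grad p x))\<^sup>2 / p x * (\<phi> x * u x)\<^sup>2)"
    using iW iN iC iG by (simp del: times_divide_eq_left)
  also have "(LBINT x. ?N x) = - (LBINT x. laplacian p x * (\<phi> x * u x)\<^sup>2 + 2 * \<phi> x * (grad \<phi> x \<bullet> grad p x) * (u x)\<^sup>2)"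
    using MN by (simp add: algebra_simps power_mult_distrib)
  also have "\<dots> = - (LBINT x. laplacian p x * (\<phi> x * u x)\<^sup>2) - (LBINT x. 2 * \<phi> x * (grad \<phi> x \<bullet> grad p x) * (u x)\<^sup>2)"
    using iL iC by simp
  finally have "\<beta> * (LBINT x. laplacian p x * (\<phi> x * u x)\<^sup>2) - \<beta>\<^sup>2 * (LBINT x. (norm (grad p x))\<^sup>2 / p x * (\<phi> x * u x)\<^sup>2)
     \<le> (LBINT x. p x * (norm (?W x))\<^sup>2)"
    by (simp add: algebra_simps)
  also have "\<beta> * (LBINT x. laplacian p x * (\<phi> x * u x)\<^sup>2) - \<beta>\<^sup>2 * (LBINT x. (norm (grad p x))\<^sup>2 / p x * (\<phi> x * u x)\<^sup>2)
     = (LBINT x. \<beta> * (laplacian p x * (\<phi> x * u x)\<^sup>2) - \<beta>\<^sup>2 * ((norm (grad p x))\<^sup>2 / p x * (\<phi> x * u x)\<^sup>2))"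
    using iL iG by (simp del: times_divide_eq_left)
  also have "\<dots> = (LBINT x. \<beta> * (laplacian p x - \<beta> * (norm (grad p x))\<^sup>2 / p x) * (\<phi> x * u x)\<^sup>2)"
    by (intro Bochner_Integration.integral_cong refl) (simp add: algebra_simps power2_eq_square)
  also have "(LBINT x. p x * (norm (?W x))\<^sup>2) = (\<integral>x. (norm (?W x))\<^sup>2 \<partial>pmeas p)"
    by (subst integral_pmeas) auto
  finally show "(LBINT x. \<beta> * (laplacian p x - \<beta> * (norm (grad p x))\<^sup>2 / p x) * (\<phi> x * u x)\<^sup>2)
     \<le> (\<integral>x. (norm (?W x))\<^sup>2 \<partial>pmeas p)" .
qed

end

context weight
begin

lemma L2_mult_bounded:
  fixes u :: "'a \<Rightarrow> real"
  assumes "L2 u" "h \<in> borel_measurable borel" "\<And>x. norm (h x) \<le> C"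
  shows "L2 (\<lambda>x. u x *\<^sub>R h x)"
proof (rule L2_bound[OF assms(1), where C=C])
  note [measurable] = assms(2) L2_measurable[OF assms(1)]
  show "(\<lambda>x. u x *\<^sub>R h x) \<in> borel_measurable borel" by measurable
  show "AE x in lborel. norm (u x *\<^sub>R h x) \<le> C * norm (u x)"
    using assms(3) by (auto simp: mult.commute[of C] intro!: AE_I2 mult_left_mono)
qed

lemma L2_scale_bounded:
  fixes h :: "'a \<Rightarrow> real"
  assumes "L2 g" "h \<in> borel_measurable borel" "\<And>x. \<bar>h x\<bar> \<le> C"
  shows "L2 (\<lambda>x. h x *\<^sub>R g x)"
proof (rule L2_bound[OF assms(1), where C=C])
  note [measurable] = assms(2) L2_measurable[OF assms(1)]
  show "(\<lambda>x. h x *\<^sub>R g x) \<in> borel_measurable borel" by measurable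
  show "AE x in lborel. norm (h x *\<^sub>R g x) \<le> C * norm (g x)"
    using assms(3) by (auto intro!: AE_I2 mult_right_mono)
qed

text \<open>Removal of the cutoff. The coefficient on the right of \<open>q\<close> may be unbounded
  relative to p, so it is first replaced by its lower bound (\<theta> - C' 1_B) p, whose factor is
  bounded; then both sides converge dominatedly.\<close>

lemma Lyapunov_global:
  assumes wg: "weak_gradient u g" and u: "L2 u" and g: "L2 g"
    and [measurable]: "B \<in> sets borel" and C': "0 \<le> C'" and \<theta>: "0 \<le> \<theta>"
    and q: "\<And>x. (\<theta> - C' * indicator B x) * p x \<le> \<beta> * (laplacian p x - \<beta> * (norm (grad p x))\<^sup>2 / p x)"
  shows "\<theta> * (\<integral>x. (u x)\<^sup>2 \<partial>pmeas p) \<le> C' * (\<integral>x. indicator B x * (u x)\<^sup>2 \<partial>pmeas p) + (\<integral>x. (norm (g x))\<^sup>2 \<partial>pmeas p)"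
proof -
  note [measurable] = weak_gradientD(3,4)[OF wg]
  obtain \<eta> :: "nat \<Rightarrow> 'a \<Rightarrow> real" and C where \<eta>: "0 \<le> C" "\<And>n. test_function (\<eta> n)" "\<And>n x. \<bar>\<eta> n x\<bar> \<le> C"
    "\<And>x. (\<lambda>n. \<eta> n x) \<longlonglongrightarrow> 1" "\<And>n x. norm (grad (\<eta> n) x) \<le> C" "\<And>x. (\<lambda>n. grad (\<eta> n) x) \<longlonglongrightarrow> 0"
    using cutoff_sequence by metis
  have s\<eta>: "smooth (\<eta> n)" for n using \<eta>(2) test_functionD by blast
  have [measurable]: "\<eta> n \<in> borel_measurable borel" "grad (\<eta> n) \<in> borel_measurable borel" for n
    using s\<eta> by (auto intro: smooth_measurable smooth_grad)
  have iu: "integrable (pmeas p) (\<lambda>x. (u x)\<^sup>2)" using u by (simp add: L2_real)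
  have ig: "integrable (pmeas p) (\<lambda>x. (norm (g x))\<^sup>2)" using g by (simp add: L2_def)
  have iBu: "integrable (pmeas p) (\<lambda>x. indicator B x * (u x)\<^sup>2)"
    by (rule Bochner_Integration.integrable_bound[OF iu]) (auto simp: indicator_def)
  let ?k = "\<lambda>x. \<theta> - C' * indicator B x"
  have kb: "\<bar>?k x\<bar> \<le> \<theta> + C'" for x using C' \<theta> by (auto simp: indicator_def)
  have le: "(\<integral>x. ?k x * (\<eta> n x * u x)\<^sup>2 \<partial>pmeas p) \<le> (\<integral>x. (norm (\<eta> n x *\<^sub>R g x + u x *\<^sub>R grad (\<eta> n) x))\<^sup>2 \<partial>pmeas p)" for n
  proof -
    have "L2 (\<lambda>x. \<eta> n x *\<^sub>R u x)" by (rule L2_scale_bounded[OF u _ \<eta>(3)]) simp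
    then have i: "integrable (pmeas p) (\<lambda>x. (\<theta> + C') * (\<eta> n x * u x)\<^sup>2)" by (simp add: L2_real)
    have "integrable (pmeas p) (\<lambda>x. ?k x * (\<eta> n x * u x)\<^sup>2)"
      by (rule Bochner_Integration.integrable_bound[OF i])
         (use kb C' \<theta> in \<open>auto simp: abs_mult intro!: AE_I2 mult_right_mono\<close>)
    then have i2: "integrable lborel (\<lambda>x. p x * (?k x * (\<eta> n x * u x)\<^sup>2))"
      by (subst (asm) integrable_pmeas) auto
    have "(\<integral>x. ?k x * (\<eta> n x * u x)\<^sup>2 \<partial>pmeas p) = (LBINT x. p x * (?k x * (\<eta> n x * u x)\<^sup>2))"
      by (subst integral_pmeas) auto
    also have "\<dots> \<le> (LBINT x. \<beta> * (laplacian p x - \<beta> * (norm (grad p x))\<^sup>2 / p x) * (\<eta> n x * u x)\<^sup>2)"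
    proof (rule integral_mono[OF i2 Lyapunov_localized(1)[OF wg u g \<eta>(2)]])
      fix x
      have "(?k x * p x) * (\<eta> n x * u x)\<^sup>2 \<le> \<beta> * (laplacian p x - \<beta> * (norm (grad p x))\<^sup>2 / p x) * (\<eta> n x * u x)\<^sup>2"
        by (rule mult_right_mono[OF q]) simp
      then show "p x * (?k x * (\<eta> n x * u x)\<^sup>2) \<le> \<beta> * (laplacian p x - \<beta> * (norm (grad p x))\<^sup>2 / p x) * (\<eta> n x * u x)\<^sup>2"
        by (simp only: mult.assoc mult.left_commute mult.commute)
    qed
    also have "\<dots> \<le> (\<integral>x. (norm (\<eta> n x *\<^sub>R g x + u x *\<^sub>R grad (\<eta> n) x))\<^sup>2 \<partial>pmeas p)"
      by (rule Lyapunov_localized(2)[OF wg u g \<eta>(2)])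
    finally show ?thesis .
  qed
  have lim1: "(\<lambda>n. \<integral>x. ?k x * (\<eta> n x * u x)\<^sup>2 \<partial>pmeas p) \<longlonglongrightarrow> (\<integral>x. ?k x * (u x)\<^sup>2 \<partial>pmeas p)"
  proof (rule integral_dominated_convergence[where w="\<lambda>x. (\<theta> + C') * (C\<^sup>2 * (u x)\<^sup>2)"])
    show "AE x in pmeas p. (\<lambda>n. ?k x * (\<eta> n x * u x)\<^sup>2) \<longlonglongrightarrow> ?k x * (u x)\<^sup>2"
    proof (rule AE_I2)
      fix x
      have "(\<lambda>n. ?k x * (\<eta> n x * u x)\<^sup>2) \<longlonglongrightarrow> ?k x * (1 * u x)\<^sup>2"
        by (intro tendsto_intros \<eta>)
      then show "(\<lambda>n. ?k x * (\<eta> n x * u x)\<^sup>2) \<longlonglongrightarrow> ?k x * (u x)\<^sup>2" by simp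
    qed
    show "AE x in pmeas p. norm (?k x * (\<eta> n x * u x)\<^sup>2) \<le> (\<theta> + C') * (C\<^sup>2 * (u x)\<^sup>2)" for n
    proof (rule AE_I2)
      fix x
      have "(\<eta> n x)\<^sup>2 \<le> C\<^sup>2" using \<eta>(3)[of n x] by (rule power2_le_iff_abs_le[THEN iffD2, OF \<eta>(1)])
      then have "(\<eta> n x * u x)\<^sup>2 \<le> C\<^sup>2 * (u x)\<^sup>2" by (simp add: power_mult_distrib mult_right_mono)
      with kb[of x] show "norm (?k x * (\<eta> n x * u x)\<^sup>2) \<le> (\<theta> + C') * (C\<^sup>2 * (u x)\<^sup>2)"
        unfolding real_norm_def abs_mult by (intro mult_mono) (use \<theta> C' in auto)
    qed
  qed (use iu in auto)
  have lim2: "(\<lambda>n. \<integral>x. (norm (\<eta> n x *\<^sub>R g x + u x *\<^sub>R grad (\<eta> n) x))\<^sup>2 \<partial>pmeas p) \<longlonglongrightarrow> (\<integral>x. (norm (g x))\<^sup>2 \<partial>pmeas p)"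
  proof (rule integral_dominated_convergence[where w="\<lambda>x. 2 * C\<^sup>2 * ((norm (g x))\<^sup>2 + (u x)\<^sup>2)"])
    show "AE x in pmeas p. (\<lambda>n. (norm (\<eta> n x *\<^sub>R g x + u x *\<^sub>R grad (\<eta> n) x))\<^sup>2) \<longlonglongrightarrow> (norm (g x))\<^sup>2"
    proof (rule AE_I2)
      fix x
      have "(\<lambda>n. (norm (\<eta> n x *\<^sub>R g x + u x *\<^sub>R grad (\<eta> n) x))\<^sup>2) \<longlonglongrightarrow> (norm (1 *\<^sub>R g x + u x *\<^sub>R 0))\<^sup>2"
        by (intro tendsto_intros \<eta>)
      then show "(\<lambda>n. (norm (\<eta> n x *\<^sub>R g x + u x *\<^sub>R grad (\<eta> n) x))\<^sup>2) \<longlonglongrightarrow> (norm (g x))\<^sup>2" by simp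
    qed
    show "AE x in pmeas p. norm ((norm (\<eta> n x *\<^sub>R g x + u x *\<^sub>R grad (\<eta> n) x))\<^sup>2) \<le> 2 * C\<^sup>2 * ((norm (g x))\<^sup>2 + (u x)\<^sup>2)" for n
    proof (rule AE_I2)
      fix x
      have 1: "norm (\<eta> n x *\<^sub>R g x) \<le> C * norm (g x)" using \<eta>(3) by (simp add: mult_right_mono)
      have 2: "norm (u x *\<^sub>R grad (\<eta> n) x) \<le> C * \<bar>u x\<bar>"
        using \<eta>(5)[of n x] by (simp add: mult.commute[of C] mult_left_mono)
      have "norm (\<eta> n x *\<^sub>R g x + u x *\<^sub>R grad (\<eta> n) x) \<le> C * norm (g x) + C * \<bar>u x\<bar>"
        using norm_triangle_ineq 1 2 by (meson add_mono order_trans)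
      then have "(norm (\<eta> n x *\<^sub>R g x + u x *\<^sub>R grad (\<eta> n) x))\<^sup>2 \<le> (C * norm (g x) + C * \<bar>u x\<bar>)\<^sup>2"
        by (rule power_mono) simp
      also have "\<dots> \<le> 2 * C\<^sup>2 * ((norm (g x))\<^sup>2 + (u x)\<^sup>2)"
        using zero_le_power2[of "C * norm (g x) - C * \<bar>u x\<bar>"]
        by (simp add: power2_diff power2_sum algebra_simps power_mult_distrib)
      finally show "norm ((norm (\<eta> n x *\<^sub>R g x + u x *\<^sub>R grad (\<eta> n) x))\<^sup>2) \<le> 2 * C\<^sup>2 * ((norm (g x))\<^sup>2 + (u x)\<^sup>2)"
        by simp
    qed
  qed (use iu ig in auto)
  have "(\<integral>x. ?k x * (u x)\<^sup>2 \<partial>pmeas p) \<le> (\<integral>x. (norm (g x))\<^sup>2 \<partial>pmeas p)"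
    using LIMSEQ_le[OF lim1 lim2] le by auto
  moreover have "(\<integral>x. ?k x * (u x)\<^sup>2 \<partial>pmeas p) = (\<integral>x. \<theta> * (u x)\<^sup>2 - C' * (indicator B x * (u x)\<^sup>2) \<partial>pmeas p)"
    by (simp add: algebra_simps)
  moreover have "\<dots> = \<theta> * (\<integral>x. (u x)\<^sup>2 \<partial>pmeas p) - C' * (\<integral>x. indicator B x * (u x)\<^sup>2 \<partial>pmeas p)"
    using iu iBu by simp
  ultimately show ?thesis by simp
qed

text \<open>On the ball p lies between its minimum p y > 0 and the upper bound P, so changing the
  measure on both sides costs the factor P / p y.\<close>

lemma local_Poincare_pmeas:
  assumes R: "0 < R"
  obtains K where "0 \<le> K"
    "\<And>u g. weak_gradient u g \<Longrightarrow> L2 u \<Longrightarrow> L2 g \<Longrightarrow>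
      (\<exists>c. (\<integral>x. indicator (cball 0 R) x * (u x - c)\<^sup>2 \<partial>pmeas p) \<le> K * (\<integral>x. (norm (g x))\<^sup>2 \<partial>pmeas p))"
proof -
  let ?B = "cball (0::'a) R"
  obtain K where K: "0 \<le> K" "\<And>(u :: 'a \<Rightarrow> real) g. weak_gradient u g \<Longrightarrow>
      (\<exists>c. (\<integral>\<^sup>+x. indicator ?B x * ennreal ((u x - c)\<^sup>2) \<partial>lborel)
        \<le> ennreal K * (\<integral>\<^sup>+x. indicator ?B x * ennreal ((norm (g x))\<^sup>2) \<partial>lborel))"
  proof (rule local_Poincare[OF R])
    fix K assume "0 \<le> K" "\<And>(u :: 'a \<Rightarrow> real) g. weak_gradient u g \<Longrightarrow>
      (\<exists>c. (\<integral>\<^sup>+x. indicator ?B x * ennreal ((u x - c)\<^sup>2) \<partial>lborel)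
        \<le> ennreal K * (\<integral>\<^sup>+x. indicator ?B x * ennreal ((norm (g x))\<^sup>2) \<partial>lborel))"
    then show thesis by (rule that)
  qed
  obtain y where y: "y \<in> ?B" "\<And>x. x \<in> ?B \<Longrightarrow> p y \<le> p x"
    using continuous_attains_inf[of ?B p] smooth_continuous_on[OF smooth_p] R by auto
  obtain P where P: "\<And>x. \<bar>p x\<bar> \<le> P" using bounded_p by (auto simp: bounded_iff)
  have P0: "0 \<le> P" using P[of 0] by linarith
  have [measurable]: "?B \<in> sets borel" by simp
  show ?thesis
  proof (rule that[of "P * (K * inverse (p y))"])
    show "0 \<le> P * (K * inverse (p y))" using K P0 p_pos[of y] by simp
    fix u g assume wg: "weak_gradient u g" and u: "L2 u" and g: "L2 g"
    note [measurable] = weak_gradientD(3,4)[OF wg]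
    obtain c where c: "(\<integral>\<^sup>+x. indicator ?B x * ennreal ((u x - c)\<^sup>2) \<partial>lborel)
        \<le> ennreal K * (\<integral>\<^sup>+x. indicator ?B x * ennreal ((norm (g x))\<^sup>2) \<partial>lborel)"
      using K(2)[OF wg] by blast
    let ?I = "\<integral>x. (norm (g x))\<^sup>2 \<partial>pmeas p"
    have I0: "0 \<le> ?I" by simp
    have "(\<integral>\<^sup>+x. indicator ?B x * ennreal ((norm (g x))\<^sup>2) \<partial>lborel)
       \<le> (\<integral>\<^sup>+x. ennreal (inverse (p y)) * (ennreal (p x) * ennreal ((norm (g x))\<^sup>2)) \<partial>lborel)"
    proof (rule nn_integral_mono)
      fix x
      show "indicator ?B x * ennreal ((norm (g x))\<^sup>2) \<le> ennreal (inverse (p y)) * (ennreal (p x) * ennreal ((norm (g x))\<^sup>2))"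
      proof (cases "x \<in> ?B")
        case True
        have "1 \<le> inverse (p y) * p x" using y(2)[OF True] p_pos[of y] by (simp add: field_simps)
        then have "1 * (norm (g x))\<^sup>2 \<le> inverse (p y) * p x * (norm (g x))\<^sup>2" by (rule mult_right_mono) simp
        then have "ennreal ((norm (g x))\<^sup>2) \<le> ennreal (inverse (p y) * (p x * (norm (g x))\<^sup>2))"
          by (intro ennreal_leI) (simp add: mult.assoc)
        then show ?thesis using True p_pos[of x] p_pos[of y] by (simp add: ennreal_mult less_imp_le)
      qed simp
    qed
    also have "\<dots> = ennreal (inverse (p y)) * (\<integral>\<^sup>+x. ennreal ((norm (g x))\<^sup>2) \<partial>pmeas p)"
      unfolding pmeas_def by (simp add: nn_integral_cmult nn_integral_density)
    also have "\<dots> = ennreal (inverse (p y) * ?I)"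
      using g p_pos[of y] by (simp add: L2_def nn_integral_eq_integral ennreal_mult less_imp_le)
    finally have 1: "(\<integral>\<^sup>+x. indicator ?B x * ennreal ((norm (g x))\<^sup>2) \<partial>lborel) \<le> ennreal (inverse (p y) * ?I)" .
    have "(\<integral>\<^sup>+x. ennreal (indicator ?B x * (u x - c)\<^sup>2) \<partial>pmeas p) = (\<integral>\<^sup>+x. ennreal (p x) * ennreal (indicator ?B x * (u x - c)\<^sup>2) \<partial>lborel)"
      unfolding pmeas_def by (rule nn_integral_density) auto
    also have "\<dots> \<le> (\<integral>\<^sup>+x. ennreal P * (indicator ?B x * ennreal ((u x - c)\<^sup>2)) \<partial>lborel)"
    proof (rule nn_integral_mono)
      fix x
      have "ennreal (p x) \<le> ennreal P" using P[of x] by (intro ennreal_leI) simp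
      then show "ennreal (p x) * ennreal (indicator ?B x * (u x - c)\<^sup>2) \<le> ennreal P * (indicator ?B x * ennreal ((u x - c)\<^sup>2))"
        by (auto simp: indicator_def intro!: mult_right_mono)
    qed
    also have "\<dots> = ennreal P * (\<integral>\<^sup>+x. indicator ?B x * ennreal ((u x - c)\<^sup>2) \<partial>lborel)"
      by (rule nn_integral_cmult) measurable
    also have "\<dots> \<le> ennreal P * (ennreal K * ennreal (inverse (p y) * ?I))"
      by (intro mult_left_mono order_trans[OF c] 1) auto
    also have "\<dots> = ennreal (P * (K * (inverse (p y) * ?I)))"
      using P0 K p_pos[of y] I0 by (simp add: ennreal_mult less_imp_le)
    finally have le: "(\<integral>\<^sup>+x. ennreal (indicator ?B x * (u x - c)\<^sup>2) \<partial>pmeas p) \<le> ennreal (P * (K * (inverse (p y) * ?I)))" .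
    have "(\<integral>x. indicator ?B x * (u x - c)\<^sup>2 \<partial>pmeas p) \<le> P * (K * (inverse (p y) * ?I))"
      by (rule nn_integral_le_imp_integrable(2)[OF _ _ le]) (use P0 K p_pos[of y] I0 in \<open>auto simp: less_imp_le\<close>)
    then show "\<exists>c. (\<integral>x. indicator ?B x * (u x - c)\<^sup>2 \<partial>pmeas p) \<le> P * (K * inverse (p y)) * ?I"
      by (auto simp: mult.assoc)
  qed
qed

text \<open>The Lyapunov estimate is applied to u - c, where c is the constant from the ball: the
  only term it leaves, the integral over the ball, is exactly what the local inequality bounds. As u
  has mean 0, subtracting c adds c^2 to the integral of the square, so the bound for u - c passes to
  u.\<close>

lemma Poincare:
  assumes R: "0 < R" and C': "0 \<le> C'" and \<theta>: "0 < \<theta>"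
    and q: "\<And>x. (\<theta> - C' * indicator (cball 0 R) x) * p x \<le> \<beta> * (laplacian p x - \<beta> * (norm (grad p x))\<^sup>2 / p x)"
  obtains C where "0 \<le> C"
    "\<And>u g. weak_gradient u g \<Longrightarrow> L2 u \<Longrightarrow> L2 g \<Longrightarrow> (\<integral>x. u x \<partial>pmeas p) = 0 \<Longrightarrow>
      (\<integral>x. (u x)\<^sup>2 \<partial>pmeas p) \<le> C * (\<integral>x. (norm (g x))\<^sup>2 \<partial>pmeas p)"
proof -
  obtain K where K: "0 \<le> K" "\<And>u g. weak_gradient u g \<Longrightarrow> L2 u \<Longrightarrow> L2 g \<Longrightarrow>
      (\<exists>c. (\<integral>x. indicator (cball 0 R) x * (u x - c)\<^sup>2 \<partial>pmeas p) \<le> K * (\<integral>x. (norm (g x))\<^sup>2 \<partial>pmeas p))"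
  proof (rule local_Poincare_pmeas[OF R])
    fix K assume "0 \<le> K" "\<And>u g. weak_gradient u g \<Longrightarrow> L2 u \<Longrightarrow> L2 g \<Longrightarrow>
      (\<exists>c. (\<integral>x. indicator (cball 0 R) x * (u x - c)\<^sup>2 \<partial>pmeas p) \<le> K * (\<integral>x. (norm (g x))\<^sup>2 \<partial>pmeas p))"
    then show thesis by (rule that)
  qed
  show ?thesis
  proof (rule that[of "(C' * K + 1) / \<theta>"])
    show "0 \<le> (C' * K + 1) / \<theta>" using C' K \<theta> by simp
    fix u g assume wg: "weak_gradient u g" and u: "L2 u" and g: "L2 g" and mean: "(\<integral>x. u x \<partial>pmeas p) = 0"
    let ?I = "\<integral>x. (norm (g x))\<^sup>2 \<partial>pmeas p"
    obtain c where c: "(\<integral>x. indicator (cball 0 R) x * (u x - c)\<^sup>2 \<partial>pmeas p) \<le> K * ?I"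
      using K(2)[OF wg u g] by blast
    have wgc: "weak_gradient (\<lambda>x. u x - c) g"
      using weak_gradient_lincomb[OF wg weak_gradient_const[of c], of 1 "-1"] by simp
    have uc: "L2 (\<lambda>x. u x - c)" using L2_add[OF u L2_const[of "-c"]] by simp
    have "\<theta> * (\<integral>x. (u x - c)\<^sup>2 \<partial>pmeas p) \<le> C' * (\<integral>x. indicator (cball 0 R) x * (u x - c)\<^sup>2 \<partial>pmeas p) + ?I"
      by (rule Lyapunov_global[OF wgc uc g _ C' _ q]) (use \<theta> in auto)
    also have "\<dots> \<le> C' * (K * ?I) + ?I" using c C' by (simp add: mult_left_mono)
    finally have "(\<integral>x. (u x - c)\<^sup>2 \<partial>pmeas p) \<le> (C' * K + 1) / \<theta> * ?I"
      using \<theta> by (simp add: field_simps)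
    moreover have "(\<integral>x. (u x - c)\<^sup>2 \<partial>pmeas p) = (\<integral>x. (u x)\<^sup>2 - 2 * c * u x + c\<^sup>2 \<partial>pmeas p)"
      by (simp add: power2_diff algebra_simps)
    moreover have "\<dots> = (\<integral>x. (u x)\<^sup>2 \<partial>pmeas p) + c\<^sup>2"
      using u L2_integrable[OF u] mean P.prob_space by (simp add: L2_real)
    ultimately show "(\<integral>x. (u x)\<^sup>2 \<partial>pmeas p) \<le> (C' * K + 1) / \<theta> * ?I"
      using zero_le_power2[of c] by linarith
  qed
qed

text \<open>Since \<Delta> log p = \<Delta>p/p - |\<nabla>p|^2/p^2, the coefficient
  \<open>?q\<close> is \<beta> p times the function in the liminf. Outside a ball that function
  exceeds some c > 0, and \<theta> = \<beta> c.\<close>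

lemma Lyapunov_condition:
  assumes \<beta>: "0 < \<beta>"
    and liminf: "0 < Liminf at_infinity (\<lambda>x. ereal
           ((1 - \<beta>) * (norm (grad (\<lambda>y. ln (p y)) x))\<^sup>2 + laplacian (\<lambda>y. ln (p y)) x))"
  obtains R C' \<theta> where "0 < R" "0 \<le> C'" "0 < \<theta>"
    "\<And>x. (\<theta> - C' * indicator (cball 0 R) x) * p x \<le> \<beta> * (laplacian p x - \<beta> * (norm (grad p x))\<^sup>2 / p x)"
proof -
  let ?F = "\<lambda>x. (1 - \<beta>) * (norm (grad (\<lambda>y. ln (p y)) x))\<^sup>2 + laplacian (\<lambda>y. ln (p y)) x"
  let ?q = "\<lambda>x. \<beta> * (laplacian p x - \<beta> * (norm (grad p x))\<^sup>2 / p x)"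
  have qF: "?q x = \<beta> * ?F x * p x" for x
  proof -
    have "?F x * p x = laplacian p x - \<beta> * (norm (grad p x))\<^sup>2 / p x"
      using p_pos[of x] unfolding grad_ln[OF smooth_p p_pos] laplacian_ln[OF smooth_p p_pos]
      by (simp add: power_mult_distrib field_simps power2_eq_square)
    then show ?thesis by (simp add: mult.assoc)
  qed
  obtain c where c: "0 < ereal c" "ereal c < Liminf at_infinity (\<lambda>x. ereal (?F x))"
    using ereal_dense2[OF liminf] by auto
  have "\<forall>\<^sub>F x in at_infinity. ereal c < ereal (?F x)" by (rule less_LiminfD[OF c(2)])
  then obtain R0 where R0: "\<And>x. R0 \<le> norm x \<Longrightarrow> c < ?F x" by (auto simp: eventually_at_infinity)
  define R where "R = max 1 R0"
  define \<theta> where "\<theta> = \<beta> * c"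
  have \<theta>: "0 < \<theta>" using \<beta> c by (simp add: \<theta>_def)
  have clap: "continuous_on S (laplacian p)" for S
    unfolding laplacian_def divergence_eq_sum_grad[OF smooth_grad[OF smooth_p], abs_def]
    by (intro continuous_on_sum continuous_on_inner smooth_continuous_on smooth_grad continuous_on_const
       smooth_linear_comp[OF bounded_linear_inner_left] smooth_p)
  have "continuous_on (cball 0 R) (\<lambda>x. ?q x / p x)"
    using p_pos by (intro continuous_intros clap smooth_continuous_on smooth_grad smooth_p) (metis less_irrefl)+
  then have "bounded ((\<lambda>x. ?q x / p x) ` cball 0 R)"
    by (intro compact_imp_bounded compact_continuous_image) auto
  then obtain M where M: "\<And>x. x \<in> cball 0 R \<Longrightarrow> \<bar>?q x / p x\<bar> \<le> M"
    unfolding bounded_iff ball_simps real_norm_def by blast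
  have "(0::'a) \<in> cball 0 R" by (simp add: R_def le_max_iff_disj)
  from M[OF this] have M0: "0 \<le> M" using abs_ge_zero order_trans by blast
  show ?thesis
  \<comment> \<open>With this constant the left factor equals -M on the ball, where -M bounds the
    continuous \<open>?q\<close> / p from below, and \<theta> outside.\<close>
  proof (rule that[of R "\<theta> + M" \<theta>])
    show "0 < R" "0 \<le> \<theta> + M" "0 < \<theta>" using \<theta> M0 by (auto simp: R_def)
    fix x
    show "(\<theta> - (\<theta> + M) * indicator (cball 0 R) x) * p x \<le> ?q x"
    proof (cases "x \<in> cball 0 R")
      case True
      have "- M \<le> ?q x / p x" using M[OF True] by linarith
      then have "- M * p x \<le> ?q x" using p_pos[of x] by (simp only: pos_le_divide_eq)
      then show ?thesis using True by simp
    next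
      case False
      then have "c < ?F x" by (intro R0) (auto simp: R_def)
      then have "\<theta> * p x \<le> ?q x"
        unfolding qF \<theta>_def using \<beta> p_pos[of x] by (intro mult_right_mono mult_left_mono) auto
      then show ?thesis using False by simp
    qed
  qed
qed

subsection \<open>Antisymmetry of the drift perturbation\<close>

text \<open>The weak gradient of u^2 is tested with the components of \<eta>_n p \<gamma>. As p
  \<gamma> has divergence 0, only the term with \<gamma> \<bullet> \<nabla>\<eta>_n survives, and it
  tends to 0 because \<gamma> is bounded, the gradients of the cutoffs are uniformly bounded and
  they vanish in the limit.\<close>

lemma drift_antisymmetric_diag:
  assumes wg: "weak_gradient u g" and u: "L2 u" and g: "L2 g"
    and s\<gamma>: "smooth \<gamma>" and b\<gamma>: "\<And>x. norm (\<gamma> x) \<le> D" and div: "\<And>x. divergence (\<lambda>y. p y *\<^sub>R \<gamma> y) x = 0"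
  shows "(\<integral>x. u x * (\<gamma> x \<bullet> g x) \<partial>pmeas p) = 0"
proof -
  note [measurable] = weak_gradientD(3,4)[OF wg]
  have [measurable]: "\<gamma> \<in> borel_measurable borel" by (rule smooth_measurable[OF s\<gamma>])
  have lu: "locally_integrable (\<lambda>x. (u x)\<^sup>2)" using L2_locally[OF u] by simp
  have lg: "locally_integrable (\<lambda>x. (norm (g x))\<^sup>2)" by (rule L2_locally[OF g])
  note sq = weak_gradient_square[OF wg lu lg]
  obtain \<eta> :: "nat \<Rightarrow> 'a \<Rightarrow> real" and C where \<eta>: "0 \<le> C" "\<And>n. test_function (\<eta> n)" "\<And>n x. \<bar>\<eta> n x\<bar> \<le> C"
    "\<And>x. (\<lambda>n. \<eta> n x) \<longlonglongrightarrow> 1" "\<And>n x. norm (grad (\<eta> n) x) \<le> C" "\<And>x. (\<lambda>n. grad (\<eta> n) x) \<longlonglongrightarrow> 0"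
    using cutoff_sequence by metis
  have s\<eta>: "smooth (\<eta> n)" for n using \<eta>(2) test_functionD by blast
  have [measurable]: "\<eta> n \<in> borel_measurable borel" "grad (\<eta> n) \<in> borel_measurable borel" for n
    using s\<eta> by (auto intro: smooth_measurable smooth_grad)
  have s\<gamma>b: "smooth (\<lambda>x. p x * (\<gamma> x \<bullet> b))" for b
    by (intro smooth_mult smooth_p smooth_linear_comp[OF bounded_linear_inner_left] s\<gamma>)
  have sp\<gamma>: "smooth (\<lambda>y. p y *\<^sub>R \<gamma> y)"
  proof -
    have "smooth (\<lambda>x. \<Sum>b\<in>Basis. (p x * (\<gamma> x \<bullet> b)) *\<^sub>R b)"
      by (intro smooth_sum smooth_linear_comp[OF bounded_linear_scaleR_left] s\<gamma>b)
    moreover have "(\<Sum>b\<in>Basis. (p x * (\<gamma> x \<bullet> b)) *\<^sub>R b) = p x *\<^sub>R \<gamma> x" for x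
      using euclidean_representation[of "p x *\<^sub>R \<gamma> x"] by simp
    ultimately show ?thesis by simp
  qed
  have div0: "(\<Sum>b\<in>Basis. grad (\<lambda>y. p y * (\<gamma> y \<bullet> b)) x \<bullet> b) = 0" for x
    using div[of x] unfolding divergence_eq_sum_grad[OF sp\<gamma>] by simp
  define \<psi> where "\<psi> = (\<lambda>n b x. (p x * (\<gamma> x \<bullet> b)) * \<eta> n x)"
  have t\<psi>: "test_function (\<psi> n b)" for n b
    unfolding \<psi>_def by (intro test_function_mult \<eta> s\<gamma>b)
  have Meq: "(\<Sum>b\<in>Basis. (u x)\<^sup>2 * (grad (\<psi> n b) x \<bullet> b)) = p x * ((u x)\<^sup>2 * (\<gamma> x \<bullet> grad (\<eta> n) x))" for n x
  proof -
    have "grad (\<psi> n b) x \<bullet> b = p x * ((\<gamma> x \<bullet> b) * (grad (\<eta> n) x \<bullet> b)) + \<eta> n x * (grad (\<lambda>y. p y * (\<gamma> y \<bullet> b)) x \<bullet> b)" for b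
      unfolding \<psi>_def grad_mult[OF s\<gamma>b s\<eta>] by (simp add: inner_simps algebra_simps)
    then have "(\<Sum>b\<in>Basis. grad (\<psi> n b) x \<bullet> b) = p x * (\<gamma> x \<bullet> grad (\<eta> n) x) + \<eta> n x * (\<Sum>b\<in>Basis. grad (\<lambda>y. p y * (\<gamma> y \<bullet> b)) x \<bullet> b)"
      unfolding euclidean_inner[of "\<gamma> x" "grad (\<eta> n) x"] by (simp add: sum.distrib sum_distrib_left)
    then show ?thesis unfolding sum_distrib_left[symmetric] by (simp add: div0)
  qed
  have Neq: "(\<Sum>b\<in>Basis. \<psi> n b x * (((2 * u x) *\<^sub>R g x) \<bullet> b)) = p x * (2 * \<eta> n x * (u x * (\<gamma> x \<bullet> g x)))" for n x
    unfolding \<psi>_def euclidean_inner[of "\<gamma> x" "g x"]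
    by (simp add: sum_distrib_left mult_ac)
  have MN: "(\<integral>x. (u x)\<^sup>2 * (\<gamma> x \<bullet> grad (\<eta> n) x) \<partial>pmeas p) = - (\<integral>x. 2 * \<eta> n x * (u x * (\<gamma> x \<bullet> g x)) \<partial>pmeas p)" for n
  proof -
    have "(\<integral>x. (u x)\<^sup>2 * (\<gamma> x \<bullet> grad (\<eta> n) x) \<partial>pmeas p) = (LBINT x. (\<Sum>b\<in>Basis. (u x)\<^sup>2 * (grad (\<psi> n b) x \<bullet> b)))"
      unfolding Meq by (subst integral_pmeas) auto
    also have "\<dots> = (\<Sum>b\<in>Basis. \<integral>x. (u x)\<^sup>2 * (grad (\<psi> n b) x \<bullet> b) \<partial>lborel)"
      by (rule Bochner_Integration.integral_sum) (rule integrable_test_grad[OF weak_gradientD(1)[OF sq] t\<psi>])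
    also have "\<dots> = - (\<Sum>b\<in>Basis. \<integral>x. \<psi> n b x * (((2 * u x) *\<^sub>R g x) \<bullet> b) \<partial>lborel)"
      unfolding weak_gradient_test[OF sq t\<psi>] by (rule sum_negf)
    also have "(\<Sum>b\<in>Basis. \<integral>x. \<psi> n b x * (((2 * u x) *\<^sub>R g x) \<bullet> b) \<partial>lborel) = (LBINT x. (\<Sum>b\<in>Basis. \<psi> n b x * (((2 * u x) *\<^sub>R g x) \<bullet> b)))"
      by (rule Bochner_Integration.integral_sum[symmetric]) (intro integrable_test_real(1) t\<psi> locally_integrable_inner[OF weak_gradientD(2)[OF sq]])
    also have "\<dots> = (\<integral>x. 2 * \<eta> n x * (u x * (\<gamma> x \<bullet> g x)) \<partial>pmeas p)"
      unfolding Neq by (subst integral_pmeas) auto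
    finally show ?thesis .
  qed
  have D0: "0 \<le> D" using b\<gamma>[of 0] norm_ge_zero[of "\<gamma> 0"] by linarith
  have "L2 (\<lambda>x. u x *\<^sub>R \<gamma> x)" by (rule L2_mult_bounded[OF u _ b\<gamma>]) simp
  from L2_integrable_inner[OF this g] have i1: "integrable (pmeas p) (\<lambda>x. u x * (\<gamma> x \<bullet> g x))" by simp
  have iu: "integrable (pmeas p) (\<lambda>x. (u x)\<^sup>2)" using u by (simp add: L2_real)
  have lim1: "(\<lambda>n. \<integral>x. (u x)\<^sup>2 * (\<gamma> x \<bullet> grad (\<eta> n) x) \<partial>pmeas p) \<longlonglongrightarrow> (\<integral>x. 0 \<partial>pmeas p)"
  proof (rule integral_dominated_convergence[where w="\<lambda>x. (u x)\<^sup>2 * (D * C)"])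
    show "AE x in pmeas p. (\<lambda>n. (u x)\<^sup>2 * (\<gamma> x \<bullet> grad (\<eta> n) x)) \<longlonglongrightarrow> 0"
    proof (rule AE_I2)
      fix x
      have "(\<lambda>n. (u x)\<^sup>2 * (\<gamma> x \<bullet> grad (\<eta> n) x)) \<longlonglongrightarrow> (u x)\<^sup>2 * (\<gamma> x \<bullet> 0)"
        by (intro tendsto_intros \<eta>)
      then show "(\<lambda>n. (u x)\<^sup>2 * (\<gamma> x \<bullet> grad (\<eta> n) x)) \<longlonglongrightarrow> 0" by simp
    qed
    show "AE x in pmeas p. norm ((u x)\<^sup>2 * (\<gamma> x \<bullet> grad (\<eta> n) x)) \<le> (u x)\<^sup>2 * (D * C)" for n
    proof (rule AE_I2)
      fix x
      have "\<bar>\<gamma> x \<bullet> grad (\<eta> n) x\<bar> \<le> norm (\<gamma> x) * norm (grad (\<eta> n) x)" by (rule Cauchy_Schwarz_ineq2)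
      also have "\<dots> \<le> D * C" using b\<gamma>[of x] \<eta>(5)[of n x] D0 by (intro mult_mono) auto
      finally show "norm ((u x)\<^sup>2 * (\<gamma> x \<bullet> grad (\<eta> n) x)) \<le> (u x)\<^sup>2 * (D * C)"
        by (simp add: abs_mult mult_left_mono)
    qed
  qed (use iu in auto)
  have lim2: "(\<lambda>n. \<integral>x. 2 * \<eta> n x * (u x * (\<gamma> x \<bullet> g x)) \<partial>pmeas p) \<longlonglongrightarrow> (\<integral>x. 2 * (u x * (\<gamma> x \<bullet> g x)) \<partial>pmeas p)"
  proof (rule integral_dominated_convergence[where w="\<lambda>x. 2 * C * \<bar>u x * (\<gamma> x \<bullet> g x)\<bar>"])
    show "AE x in pmeas p. (\<lambda>n. 2 * \<eta> n x * (u x * (\<gamma> x \<bullet> g x))) \<longlonglongrightarrow> 2 * (u x * (\<gamma> x \<bullet> g x))"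
    proof (rule AE_I2)
      fix x
      have "(\<lambda>n. 2 * \<eta> n x * (u x * (\<gamma> x \<bullet> g x))) \<longlonglongrightarrow> 2 * 1 * (u x * (\<gamma> x \<bullet> g x))"
        by (intro tendsto_intros \<eta>)
      then show "(\<lambda>n. 2 * \<eta> n x * (u x * (\<gamma> x \<bullet> g x))) \<longlonglongrightarrow> 2 * (u x * (\<gamma> x \<bullet> g x))" by simp
    qed
    show "AE x in pmeas p. norm (2 * \<eta> n x * (u x * (\<gamma> x \<bullet> g x))) \<le> 2 * C * \<bar>u x * (\<gamma> x \<bullet> g x)\<bar>" for n
      using \<eta>(3)[of n] by (intro AE_I2) (simp add: abs_mult mult_right_mono)
  qed (use i1 in auto)
  have "(\<lambda>n. - (\<integral>x. 2 * \<eta> n x * (u x * (\<gamma> x \<bullet> g x)) \<partial>pmeas p)) \<longlonglongrightarrow> 0"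
    using lim1 by (simp add: MN)
  from tendsto_add[OF this lim2] have "(\<lambda>n. 0) \<longlonglongrightarrow> (\<integral>x. 2 * (u x * (\<gamma> x \<bullet> g x)) \<partial>pmeas p)" by simp
  then have "(\<integral>x. 2 * (u x * (\<gamma> x \<bullet> g x)) \<partial>pmeas p) = 0" using LIMSEQ_unique tendsto_const by blast
  then show ?thesis by simp
qed

end

subsection \<open>Completeness and density\<close>

context weight
begin

lemma L2_diff: "L2 f \<Longrightarrow> L2 g \<Longrightarrow> L2 (\<lambda>x. f x - g x)"
  using L2_add[of f "\<lambda>x. (-1) *\<^sub>R g x"] L2_scaleR[of g "-1"] by simp

text \<open>The Riesz-Fischer argument: along a subsequence with geometrically small increments the
  increments are summable almost everywhere, because the L2 norm dominates the L1 norm on a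
  probability space. Fatou's lemma then bounds the distance of the full sequence to the pointwise
  limit.\<close>

lemma L2_complete:
  fixes s :: "nat \<Rightarrow> 'a \<Rightarrow> 'b::euclidean_space"
  assumes s: "\<And>n. L2 (s n)"
    and Cauchy: "\<And>\<epsilon>. 0 < \<epsilon> \<Longrightarrow> \<exists>N. \<forall>m\<ge>N. \<forall>n\<ge>N. (\<integral>x. (norm (s m x - s n x))\<^sup>2 \<partial>pmeas p) < \<epsilon>"
  shows "\<exists>l. L2 l \<and> (\<lambda>n. \<integral>x. (norm (s n x - l x))\<^sup>2 \<partial>pmeas p) \<longlonglongrightarrow> 0"
proof -
  have [measurable]: "s n \<in> borel_measurable borel" for n using s by (rule L2_measurable)
  have int: "integrable (pmeas p) (\<lambda>x. (norm (s m x - s n x))\<^sup>2)" for m n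
    using L2_diff[OF s s, of m n] by (simp add: L2_def)
  have "\<forall>k. \<exists>N. \<forall>m\<ge>N. \<forall>n\<ge>N. (\<integral>x. (norm (s m x - s n x))\<^sup>2 \<partial>pmeas p) < ((1/2)^k)\<^sup>2"
    by (intro allI Cauchy) simp
  then obtain N where N: "\<And>k m n. N k \<le> m \<Longrightarrow> N k \<le> n \<Longrightarrow> (\<integral>x. (norm (s m x - s n x))\<^sup>2 \<partial>pmeas p) < ((1/2)^k)\<^sup>2"
    by metis
  \<comment> \<open>Summing the thresholds makes the indices monotone and at least
    \<open>N k\<close>; the added ones ensure r k \<ge> k, so the subsequence goes to
    infinity.\<close>
  define r where "r = (\<lambda>k. \<Sum>j\<le>k. N j + 1)"
  have rN: "N k \<le> r k" for k
    unfolding r_def by (rule order_trans[OF _ member_le_sum[of k "{..k}" "\<lambda>j. N j + 1"]]) auto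
  have r_Suc: "r k \<le> r (Suc k)" for k by (simp add: r_def)
  have rk: "k \<le> r k" for k
  proof -
    have "(\<Sum>j\<le>k. 1) \<le> r k" unfolding r_def by (intro sum_mono) simp
    then show ?thesis by simp
  qed
  define d where "d = (\<lambda>k x. norm (s (r (Suc k)) x - s (r k) x))"
  have [measurable]: "d k \<in> borel_measurable borel" for k unfolding d_def by measurable
  have dL: "L2 (d k)" for k unfolding d_def by (intro L2_norm L2_diff s)
  have d1: "(\<integral>\<^sup>+x. ennreal (d k x) \<partial>pmeas p) \<le> ennreal ((1/2)^k)" for k
  proof -
    have "\<bar>\<integral>x. d k x * 1 \<partial>pmeas p\<bar> \<le> sqrt (\<integral>x. (d k x)\<^sup>2 \<partial>pmeas p) * sqrt (\<integral>x. 1\<^sup>2 \<partial>pmeas p)"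
      using dL[of k] by (intro Cauchy_Schwarz_integral) (auto simp: L2_real)
    also have "\<dots> \<le> sqrt (((1/2)^k)\<^sup>2)"
      using N[of k "r (Suc k)" "r k"] rN[of k] r_Suc[of k] P.prob_space
      by (simp add: d_def less_imp_le del: real_sqrt_abs)
    finally have "(\<integral>x. d k x \<partial>pmeas p) \<le> (1/2)^k" by simp
    moreover have "(\<integral>\<^sup>+x. ennreal (d k x) \<partial>pmeas p) = ennreal (\<integral>x. d k x \<partial>pmeas p)"
      by (rule nn_integral_eq_integral[OF L2_integrable[OF dL]]) (simp add: d_def)
    ultimately show ?thesis by (simp add: ennreal_leI)
  qed
  have "(\<integral>\<^sup>+x. (\<Sum>k. ennreal (d k x)) \<partial>pmeas p) = (\<Sum>k. \<integral>\<^sup>+x. ennreal (d k x) \<partial>pmeas p)"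
    by (rule nn_integral_suminf) measurable
  also have "\<dots> \<le> (\<Sum>k. ennreal ((1/2)^k))"
    by (intro suminf_le d1) auto
  also have "\<dots> = ennreal (\<Sum>k. (1/2)^k)"
    by (intro suminf_ennreal2) (auto intro: summable_geometric)
  finally have "(\<integral>\<^sup>+x. (\<Sum>k. ennreal (d k x)) \<partial>pmeas p) \<noteq> \<infinity>" using le_ennreal_iff by (auto simp: top_unique)
  then have "AE x in pmeas p. (\<Sum>k. ennreal (d k x)) \<noteq> \<infinity>"
    by (intro nn_integral_PInf_AE) measurable
  then have conv: "AE x in pmeas p. convergent (\<lambda>k. s (r k) x)"
  proof eventually_elim
    case (elim x)
    then have "summable (\<lambda>k. d k x)"
      by (intro summable_suminf_not_top) (auto simp: d_def)
    then have "summable (\<lambda>k. s (r (Suc k)) x - s (r k) x)"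
      unfolding d_def by (rule summable_norm_cancel)
    then have "convergent (\<lambda>n. \<Sum>k<n. s (r (Suc k)) x - s (r k) x)"
      by (simp add: summable_iff_convergent)
    then have "convergent (\<lambda>n. s (r n) x - s (r 0) x)" 
      using sum_lessThan_telescope[of "\<lambda>k. s (r k) x"] by simp
    then have "convergent (\<lambda>n. (s (r n) x - s (r 0) x) + s (r 0) x)"
      by (intro convergent_add convergent_const)
    then show ?case by simp
  qed
  define l where "l = (\<lambda>x. lim (\<lambda>k. s (r k) x))"
  have [measurable]: "l \<in> borel_measurable borel" unfolding l_def by measurable
  have lim: "AE x in pmeas p. (\<lambda>k. s (r k) x) \<longlonglongrightarrow> l x"
    using conv by eventually_elim (simp add: l_def convergent_LIMSEQ_iff)
  have key: "(\<integral>\<^sup>+x. ennreal ((norm (s n x - l x))\<^sup>2) \<partial>pmeas p) \<le> ennreal \<epsilon>"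
    if "\<forall>m\<ge>M. \<forall>n\<ge>M. (\<integral>x. (norm (s m x - s n x))\<^sup>2 \<partial>pmeas p) < \<epsilon>" "n \<ge> M" for n M \<epsilon>
  proof -
    have "(\<integral>\<^sup>+x. ennreal ((norm (s n x - l x))\<^sup>2) \<partial>pmeas p) = (\<integral>\<^sup>+x. liminf (\<lambda>k. ennreal ((norm (s n x - s (r k) x))\<^sup>2)) \<partial>pmeas p)"
    proof (rule nn_integral_cong_AE)
      show "AE x in pmeas p. ennreal ((norm (s n x - l x))\<^sup>2) = liminf (\<lambda>k. ennreal ((norm (s n x - s (r k) x))\<^sup>2))"
        using lim
      proof eventually_elim
        case (elim x)
        have "(\<lambda>k. ennreal ((norm (s n x - s (r k) x))\<^sup>2)) \<longlonglongrightarrow> ennreal ((norm (s n x - l x))\<^sup>2)"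
          by (intro tendsto_ennrealI tendsto_intros elim)
        then show ?case by (intro lim_imp_Liminf[symmetric]) auto
      qed
    qed
    also have "\<dots> \<le> liminf (\<lambda>k. \<integral>\<^sup>+x. ennreal ((norm (s n x - s (r k) x))\<^sup>2) \<partial>pmeas p)"
      by (rule nn_integral_liminf) measurable
    also have "\<dots> \<le> liminf (\<lambda>k. ennreal \<epsilon>)"
    proof (rule Liminf_mono)
      show "\<forall>\<^sub>F k in sequentially. (\<integral>\<^sup>+x. ennreal ((norm (s n x - s (r k) x))\<^sup>2) \<partial>pmeas p) \<le> ennreal \<epsilon>"
        using eventually_ge_at_top[of M]
      proof eventually_elim
        case (elim k)
        then have "M \<le> r k" using rk[of k] by simp
        then have "(\<integral>x. (norm (s n x - s (r k) x))\<^sup>2 \<partial>pmeas p) \<le> \<epsilon>" using that by (simp add: less_imp_le)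
        then show ?case using int by (simp add: nn_integral_eq_integral ennreal_leI)
      qed
    qed
    also have "\<dots> = ennreal \<epsilon>" by (simp add: Liminf_const)
    finally show ?thesis .
  qed
  have res: "integrable (pmeas p) (\<lambda>x. (norm (s n x - l x))\<^sup>2) \<and> (\<integral>x. (norm (s n x - l x))\<^sup>2 \<partial>pmeas p) \<le> \<epsilon>"
    if "\<forall>m\<ge>M. \<forall>n\<ge>M. (\<integral>x. (norm (s m x - s n x))\<^sup>2 \<partial>pmeas p) < \<epsilon>" "n \<ge> M" "0 < \<epsilon>" for n M \<epsilon>
    using nn_integral_le_imp_integrable[OF _ _ key[OF that(1,2)]] that(3) by (simp add: less_imp_le)
  show ?thesis
  proof (intro exI conjI)
    obtain M where M: "\<forall>m\<ge>M. \<forall>n\<ge>M. (\<integral>x. (norm (s m x - s n x))\<^sup>2 \<partial>pmeas p) < 1"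
      using Cauchy[of 1] by auto
    have "L2 (\<lambda>x. s M x - l x)" unfolding L2_def using res[OF M order_refl] by simp
    from L2_diff[OF s[of M] this] show "L2 l" by simp
    show "(\<lambda>n. \<integral>x. (norm (s n x - l x))\<^sup>2 \<partial>pmeas p) \<longlonglongrightarrow> 0"
    proof (rule LIMSEQ_I)
      fix \<epsilon> :: real assume \<epsilon>: "0 < \<epsilon>"
      obtain M where M: "\<forall>m\<ge>M. \<forall>n\<ge>M. (\<integral>x. (norm (s m x - s n x))\<^sup>2 \<partial>pmeas p) < \<epsilon> / 2"
        using Cauchy[of "\<epsilon> / 2"] \<epsilon> by auto
      have "norm ((\<integral>x. (norm (s n x - l x))\<^sup>2 \<partial>pmeas p) - 0) < \<epsilon>" if "n \<ge> M" for n
        using res[OF M that] \<epsilon> by simp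
      then show "\<exists>M. \<forall>n\<ge>M. norm ((\<integral>x. (norm (s n x - l x))\<^sup>2 \<partial>pmeas p) - 0) < \<epsilon>" by blast
    qed
  qed
qed

lemma L2_tendsto_mult:
  fixes s :: "nat \<Rightarrow> 'a \<Rightarrow> real"
  assumes s: "\<And>n. L2 (s n)" and l: "L2 l" and h: "L2 h"
    and lim: "(\<lambda>n. \<integral>x. (s n x - l x)\<^sup>2 \<partial>pmeas p) \<longlonglongrightarrow> 0"
  shows "(\<lambda>n. \<integral>x. s n x * h x \<partial>pmeas p) \<longlonglongrightarrow> (\<integral>x. l x * h x \<partial>pmeas p)"
proof -
  have "(\<lambda>n. (\<integral>x. s n x * h x \<partial>pmeas p) - (\<integral>x. l x * h x \<partial>pmeas p)) \<longlonglongrightarrow> 0"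
  proof (rule Lim_null_comparison)
    have "(\<lambda>n. sqrt (\<integral>x. (s n x - l x)\<^sup>2 \<partial>pmeas p) * sqrt (\<integral>x. (h x)\<^sup>2 \<partial>pmeas p)) \<longlonglongrightarrow> sqrt 0 * sqrt (\<integral>x. (h x)\<^sup>2 \<partial>pmeas p)"
      by (intro tendsto_intros lim)
    then show "(\<lambda>n. sqrt (\<integral>x. (s n x - l x)\<^sup>2 \<partial>pmeas p) * sqrt (\<integral>x. (h x)\<^sup>2 \<partial>pmeas p)) \<longlonglongrightarrow> 0" by simp
    show "\<forall>\<^sub>F n in sequentially. norm ((\<integral>x. s n x * h x \<partial>pmeas p) - (\<integral>x. l x * h x \<partial>pmeas p))
       \<le> sqrt (\<integral>x. (s n x - l x)\<^sup>2 \<partial>pmeas p) * sqrt (\<integral>x. (h x)\<^sup>2 \<partial>pmeas p)"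
    proof (rule always_eventually, rule allI)
      fix n
      have "(\<integral>x. s n x * h x \<partial>pmeas p) - (\<integral>x. l x * h x \<partial>pmeas p) = (\<integral>x. (s n x - l x) * h x \<partial>pmeas p)"
        using L2_integrable_mult[OF s h] L2_integrable_mult[OF l h] by (simp add: left_diff_distrib)
      then show "norm ((\<integral>x. s n x * h x \<partial>pmeas p) - (\<integral>x. l x * h x \<partial>pmeas p))
       \<le> sqrt (\<integral>x. (s n x - l x)\<^sup>2 \<partial>pmeas p) * sqrt (\<integral>x. (h x)\<^sup>2 \<partial>pmeas p)"
        using Cauchy_Schwarz_integral[of "\<lambda>x. s n x - l x" "pmeas p" h] L2_diff[OF s l, of n] h
        by (simp add: L2_real measurable_pmeas)
    qed
  qed
  then show ?thesis by (simp add: LIM_zero_iff)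
qed

text \<open>Pairing with h over Lebesgue measure is pairing with h / p over the weighted measure.
  This quotient is bounded, so such pairings are continuous in the weighted L2 norm.\<close>

lemma L2_test_over_p:
  assumes h: "test_function h"
  shows "L2 (\<lambda>x. h x / p x)"
proof -
  obtain K where K: "compact K" "\<And>x. x \<notin> K \<Longrightarrow> h x = 0" using h by (auto simp: test_function_def)
  have s: "smooth h" using h test_functionD by blast
  have c: "continuous_on UNIV (\<lambda>x. h x / p x)"
    using p_pos by (intro continuous_intros smooth_continuous_on s smooth_p) (metis less_irrefl)
  have [measurable]: "(\<lambda>x. h x / p x) \<in> borel_measurable borel" by (rule borel_measurable_continuous_onI[OF c])
  have "bounded ((\<lambda>x. h x / p x) ` K)"
    by (intro compact_imp_bounded compact_continuous_image K(1) continuous_on_subset[OF c]) simp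
  then obtain B where B: "\<And>x. x \<in> K \<Longrightarrow> \<bar>h x / p x\<bar> \<le> B" unfolding bounded_iff ball_simps real_norm_def by blast
  have "\<bar>h x / p x\<bar> \<le> \<bar>B\<bar>" for x
    using B[of x] K(2)[of x] by (cases "x \<in> K") auto
  then show ?thesis
    by (intro L2_bound[OF L2_const[of "1::real"], where C="\<bar>B\<bar>"]) (auto simp del: abs_divide)
qed

lemma integral_test_pmeas:
  fixes u h :: "'a \<Rightarrow> real"
  assumes h: "test_function h" and u[measurable]: "u \<in> borel_measurable borel"
  shows "(LBINT x. h x * u x) = (\<integral>x. u x * (h x / p x) \<partial>pmeas p)"
proof -
  have [measurable]: "h \<in> borel_measurable borel" using h test_functionD smooth_measurable by blast
  have pp: "p x * (u x * (h x / p x)) = h x * u x" for x using p_pos[of x] by simp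
  have "(\<integral>x. u x * (h x / p x) \<partial>pmeas p) = (LBINT x. p x * (u x * (h x / p x)))"
    by (subst integral_pmeas) auto
  then show ?thesis unfolding pp by simp
qed

text \<open>For a fixed test function both sides of the defining identity are continuous in the
  weighted L2 norm, after rewriting them by \<open>integral_test_pmeas\<close>; the identity passes
  to the limit.\<close>

lemma weak_gradient_closed:
  assumes wg: "\<And>n. weak_gradient (s n) (g n)" and s: "\<And>n. L2 (s n)" and g: "\<And>n. L2 (g n)"
    and l: "L2 l" and k: "L2 k"
    and lim: "(\<lambda>n. \<integral>x. (s n x - l x)\<^sup>2 \<partial>pmeas p) \<longlonglongrightarrow> 0"
    and glim: "(\<lambda>n. \<integral>x. (norm (g n x - k x))\<^sup>2 \<partial>pmeas p) \<longlonglongrightarrow> 0"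
  shows "weak_gradient l k"
  unfolding weak_gradient_iff
proof (intro conjI allI impI)
  note [measurable] = L2_measurable[OF l] L2_measurable[OF k] weak_gradientD(3,4)[OF wg]
  show "locally_integrable l"
    by (rule integrable_pmeas_locally[OF L2_measurable[OF l] L2_integrable[OF l]])
  have "locally_integrable (\<lambda>x. norm (k x))"
    by (rule integrable_pmeas_locally) (use L2_integrable[OF L2_norm[OF k]] in auto)
  then show "locally_integrable k" by (rule locally_integrable_bound) auto
  fix \<phi> :: "'a \<Rightarrow> real" and v :: 'a assume \<phi>: "test_function \<phi>"
  have t: "test_function (\<lambda>x. grad \<phi> x \<bullet> v)" by (rule test_function_derivative[OF \<phi>])
  have inner: "L2 (\<lambda>x. f x \<bullet> v)" if "L2 f" for f
    by (rule L2_bound[OF that, where C="norm v"])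
       (use L2_measurable[OF that] in \<open>auto intro!: AE_I2 simp: order_trans[OF Cauchy_Schwarz_ineq2] mult.commute\<close>)
  have "(\<lambda>n. \<integral>x. (grad \<phi> x \<bullet> v) * s n x \<partial>lborel) \<longlonglongrightarrow> (LBINT x. (grad \<phi> x \<bullet> v) * l x)"
    using L2_tendsto_mult[OF s l L2_test_over_p[OF t] lim] by (simp add: integral_test_pmeas[OF t])
  moreover have "(\<lambda>n. \<integral>x. \<phi> x * (g n x \<bullet> v) \<partial>lborel) \<longlonglongrightarrow> (LBINT x. \<phi> x * (k x \<bullet> v))"
  proof -
    have "(\<lambda>n. \<integral>x. (g n x \<bullet> v - k x \<bullet> v)\<^sup>2 \<partial>pmeas p) \<longlonglongrightarrow> 0"
    proof (rule tendsto_sandwich)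
      show "(\<lambda>n. 0::real) \<longlonglongrightarrow> 0" by simp
      show "(\<lambda>n. (norm v)\<^sup>2 * (\<integral>x. (norm (g n x - k x))\<^sup>2 \<partial>pmeas p)) \<longlonglongrightarrow> 0"
        using tendsto_mult_left[OF glim, of "(norm v)\<^sup>2"] by simp
      show "\<forall>\<^sub>F n in sequentially. (\<integral>x. (g n x \<bullet> v - k x \<bullet> v)\<^sup>2 \<partial>pmeas p) \<le> (norm v)\<^sup>2 * (\<integral>x. (norm (g n x - k x))\<^sup>2 \<partial>pmeas p)"
      proof (rule always_eventually, rule allI)
        fix n
        show "(\<integral>x. (g n x \<bullet> v - k x \<bullet> v)\<^sup>2 \<partial>pmeas p) \<le> (norm v)\<^sup>2 * (\<integral>x. (norm (g n x - k x))\<^sup>2 \<partial>pmeas p)"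
          using L2_inner(2)[of "\<lambda>x. g n x - k x" "pmeas p" v] L2_diff[OF g k, of n]
          by (simp add: L2_def measurable_pmeas inner_diff_left)
      qed
    qed simp
    from L2_tendsto_mult[OF inner[OF g] inner[OF k] L2_test_over_p[OF \<phi>] this]
    show ?thesis by (simp add: integral_test_pmeas[OF \<phi>])
  qed
  ultimately have "(\<lambda>n. - (LBINT x. \<phi> x * (g n x \<bullet> v))) \<longlonglongrightarrow> (LBINT x. (grad \<phi> x \<bullet> v) * l x)"
    "(\<lambda>n. - (LBINT x. \<phi> x * (g n x \<bullet> v))) \<longlonglongrightarrow> - (LBINT x. \<phi> x * (k x \<bullet> v))"
    using weak_gradient_test[OF wg \<phi>, of _ v] by (auto simp: mult.commute intro: tendsto_minus)
  from LIMSEQ_unique[OF this]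
  show "(LBINT x. l x * (grad \<phi> x \<bullet> v)) = - (LBINT x. \<phi> x * (k x \<bullet> v))"
    by (simp add: mult.commute)
qed

subsection \<open>The space \<open>H1\<close>\<close>

lemma L20_iff: "f \<in> L20 p \<longleftrightarrow> L2 f \<and> (\<integral>x. f x \<partial>pmeas p) = 0"
  by (auto simp: L20_def L2_real)

lemma L20_lincomb:
  assumes "f \<in> L20 p" "g \<in> L20 p"
  shows "(\<lambda>x. a * f x + b * g x) \<in> L20 p"
proof -
  have f: "L2 f" "(\<integral>x. f x \<partial>pmeas p) = 0" and g: "L2 g" "(\<integral>x. g x \<partial>pmeas p) = 0"
    using assms by (auto simp: L20_iff)
  have "L2 (\<lambda>x. a * f x + b * g x)"
    using L2_add[OF L2_scaleR[OF f(1), of a] L2_scaleR[OF g(1), of b]] by simp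
  moreover have "(\<integral>x. a * f x + b * g x \<partial>pmeas p) = 0"
    using f g L2_integrable by simp
  ultimately show ?thesis by (simp add: L20_iff)
qed

text \<open>The choice in \<open>wgrad\<close> knows nothing of square integrability. It agrees
  almost everywhere with the square-integrable weak gradient that membership in \<open>H1\<close>
  provides, and inherits the property.\<close>

lemma H1_wgrad:
  assumes "f \<in> H1 p"
  shows "weak_gradient f (wgrad f)" "L2 (wgrad f)" "L2 f" "f \<in> L20 p"
proof -
  obtain g where g: "weak_gradient f g" "integrable (pmeas p) (\<lambda>x. (norm (g x))\<^sup>2)"
    using assms by (auto simp: H1_def)
  show w: "weak_gradient f (wgrad f)" unfolding wgrad_def using g(1) by (rule someI[where P="weak_gradient f"])
  have "L2 g" using g weak_gradientD(4)[OF g(1)] by (simp add: L2_def)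
  moreover have "AE x in lborel. norm (wgrad f x) \<le> 1 * norm (g x)"
    using weak_gradient_unique[OF w g(1)] by eventually_elim simp
  ultimately show "L2 (wgrad f)" by (rule L2_bound[OF _ weak_gradientD(4)[OF w]])
  show "f \<in> L20 p" "L2 f" using assms by (auto simp: H1_def L20_iff)
qed

lemma H1_I: "f \<in> L20 p \<Longrightarrow> weak_gradient f g \<Longrightarrow> L2 g \<Longrightarrow> f \<in> H1 p"
  by (auto simp: H1_def L2_def)

lemma wgrad_AE:
  assumes "weak_gradient f g" "f \<in> H1 p"
  shows "AE x in pmeas p. wgrad f x = g x"
  unfolding AE_pmeas by (rule weak_gradient_unique[OF H1_wgrad(1)[OF assms(2)] assms(1)])

lemma H1_lincomb:
  assumes f: "f \<in> H1 p" and g: "g \<in> H1 p"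
  shows "(\<lambda>x. a * f x + b * g x) \<in> H1 p"
    "AE x in pmeas p. wgrad (\<lambda>x. a * f x + b * g x) x = a *\<^sub>R wgrad f x + b *\<^sub>R wgrad g x"
proof -
  note w = weak_gradient_lincomb[OF H1_wgrad(1)[OF f] H1_wgrad(1)[OF g], of a b]
  show H: "(\<lambda>x. a * f x + b * g x) \<in> H1 p"
    using L20_lincomb[OF H1_wgrad(4)[OF f] H1_wgrad(4)[OF g]] w
      L2_add[OF L2_scaleR[OF H1_wgrad(2)[OF f]] L2_scaleR[OF H1_wgrad(2)[OF g]]]
    by (rule H1_I)
  show "AE x in pmeas p. wgrad (\<lambda>x. a * f x + b * g x) x = a *\<^sub>R wgrad f x + b *\<^sub>R wgrad g x"
    by (rule wgrad_AE[OF w H])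
qed

lemma H1_cong_AE:
  assumes f: "f \<in> H1 p" and g: "g \<in> borel_measurable borel" "AE x in pmeas p. f x = g x"
  shows "g \<in> H1 p" "AE x in pmeas p. wgrad g x = wgrad f x"
proof -
  have ae: "AE x in lborel. f x = g x" using g(2) by (simp add: AE_pmeas)
  have w: "weak_gradient g (wgrad f)"
    by (rule weak_gradient_cong_AE[OF H1_wgrad(1)[OF f] g(1) ae weak_gradientD(4)[OF H1_wgrad(1)[OF f]]]) simp
  have "L2 g" by (rule L2_bound[OF H1_wgrad(3)[OF f] g(1), where C=1]) (use ae in auto)
  moreover have "(\<integral>x. g x \<partial>pmeas p) = (\<integral>x. f x \<partial>pmeas p)"
    by (rule integral_cong_AE) (use g L2_measurable[OF H1_wgrad(3)[OF f]] in \<open>auto simp: measurable_pmeas\<close>)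
  ultimately have "g \<in> L20 p" using H1_wgrad(4)[OF f] by (simp add: L20_iff)
  then show H: "g \<in> H1 p" using w H1_wgrad(2)[OF f] by (rule H1_I)
  show "AE x in pmeas p. wgrad g x = wgrad f x" by (rule wgrad_AE[OF w H])
qed

lemma H1_zero: "(\<lambda>x. 0) \<in> H1 p"
  by (rule H1_I[OF _ weak_gradient_const]) (auto simp: L20_iff L2_const)

lemma inner_1_integrable: "f \<in> H1 p \<Longrightarrow> g \<in> H1 p \<Longrightarrow> integrable (pmeas p) (\<lambda>x. wgrad f x \<bullet> wgrad g x)"
  by (intro L2_integrable_inner H1_wgrad)

lemma wgrad_measurable: "f \<in> H1 p \<Longrightarrow> wgrad f \<in> borel_measurable borel"
  using H1_wgrad(2) L2_measurable by blast

lemma inner_1_cong_AE: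
  assumes "f \<in> H1 p" "f' \<in> H1 p" "g \<in> H1 p" "AE x in pmeas p. wgrad f x = wgrad f' x"
  shows "inner_1 p f g = inner_1 p f' g"
  unfolding inner_1_def
  by (rule integral_cong_AE) (use assms wgrad_measurable[of f] wgrad_measurable[of f'] wgrad_measurable[of g] in \<open>auto simp: measurable_pmeas\<close>)

lemma inner_1_lincomb:
  assumes f: "f \<in> H1 p" and g: "g \<in> H1 p" and h: "h \<in> H1 p"
  shows "inner_1 p (\<lambda>x. a * f x + b * g x) h = a * inner_1 p f h + b * inner_1 p g h"
proof -
  note [measurable] = wgrad_measurable[OF f] wgrad_measurable[OF g] wgrad_measurable[OF h] wgrad_measurable[OF H1_lincomb(1)[OF f g]]
  have "inner_1 p (\<lambda>x. a * f x + b * g x) h = (\<integral>x. a * (wgrad f x \<bullet> wgrad h x) + b * (wgrad g x \<bullet> wgrad h x) \<partial>pmeas p)"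
    unfolding inner_1_def
    by (rule integral_cong_AE) (use H1_lincomb(2)[OF f g, of a b] in \<open>auto simp: inner_simps\<close>)
  then show ?thesis using inner_1_integrable[OF f h] inner_1_integrable[OF g h] by (simp add: inner_1_def)
qed

lemma inner_1_commute: "inner_1 p f g = inner_1 p g f"
  by (simp add: inner_1_def inner_commute)

lemma inner_1_self: "inner_1 p f f = (\<integral>x. (norm (wgrad f x))\<^sup>2 \<partial>pmeas p)"
  by (simp add: inner_1_def power2_norm_eq_inner)

text \<open>A test function minus its mean belongs to \<open>H1\<close>, and the subtracted constant
  does not matter against an \<open>h\<close> of mean 0. So p h is orthogonal to every test
  function.\<close>

lemma H1_dense:
  assumes h: "h \<in> L20 p" and 0: "\<And>v. v \<in> H1 p \<Longrightarrow> inner_p p h v = 0"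
  shows "AE x in pmeas p. h x = 0"
proof -
  have hL: "L2 h" "(\<integral>x. h x \<partial>pmeas p) = 0" using h by (auto simp: L20_iff)
  note [measurable] = L2_measurable[OF hL(1)]
  have "locally_integrable (\<lambda>x. p x *\<^sub>R h x)"
    by (intro locally_integrable_scaleR integrable_pmeas_locally L2_integrable hL smooth_continuous_on smooth_p L2_measurable)
  then have "locally_integrable (\<lambda>x. p x * h x)" by simp
  then have "AE x in lborel. p x * h x = 0"
  proof (rule fundamental_lemma)
    fix \<phi> :: "'a \<Rightarrow> real" assume \<phi>: "test_function \<phi>"
    have s: "smooth \<phi>" using \<phi> test_functionD by blast
    have [measurable]: "\<phi> \<in> borel_measurable borel" "grad \<phi> \<in> borel_measurable borel"
      using s by (auto intro: smooth_measurable smooth_grad)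
    obtain C where C: "0 \<le> C" "\<And>x. \<bar>\<phi> x\<bar> \<le> C" "\<And>x. norm (grad \<phi> x) \<le> C"
      using test_function_bounded[OF \<phi>] by metis
    have \<phi>L: "L2 \<phi>" by (rule L2_bound[OF L2_const[of "1::real"], where C=C]) (use C in auto)
    have gL: "L2 (grad \<phi>)" by (rule L2_bound[OF L2_const[of "1::real"], where C=C]) (use C in auto)
    define c where "c = (\<integral>x. \<phi> x \<partial>pmeas p)"
    have wg: "weak_gradient (\<lambda>x. \<phi> x - c) (grad \<phi>)"
      using weak_gradient_lincomb[OF weak_gradient_smooth[OF s] weak_gradient_const[of c], of 1 "-1"] by simp
    have "(\<lambda>x. \<phi> x - c) \<in> L20 p"
      using L2_diff[OF \<phi>L L2_const[of c]] L2_integrable[OF \<phi>L] P.prob_space by (simp add: L20_iff c_def)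
    then have "(\<lambda>x. \<phi> x - c) \<in> H1 p" using wg gL by (rule H1_I)
    then have "(\<integral>x. h x * (\<phi> x - c) \<partial>pmeas p) = 0" using 0 by (simp add: inner_p_def)
    then have "(\<integral>x. h x * \<phi> x \<partial>pmeas p) = 0"
      using L2_integrable_mult[OF hL(1) \<phi>L] L2_integrable[OF hL(1)] hL(2) by (simp add: right_diff_distrib)
    then show "(LBINT x. \<phi> x * (p x * h x)) = 0"
      by (subst (asm) integral_pmeas) (auto simp: mult_ac)
  qed
  then show ?thesis unfolding AE_pmeas by eventually_elim (use p_pos in \<open>auto simp: less_imp_neq[symmetric]\<close>)
qed

end

subsection \<open>Semi-inner product spaces of functions\<close>

text \<open>Vectors are functions rather than classes modulo null sets, so a vector of norm 0 need
  not be the zero function. Arguments below compare norms instead of vectors.\<close>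

locale semi_inner =
  fixes V :: "('x \<Rightarrow> real) set" and ip :: "('x \<Rightarrow> real) \<Rightarrow> ('x \<Rightarrow> real) \<Rightarrow> real"
  assumes zero_mem: "(\<lambda>x. 0) \<in> V"
    and lincomb_mem: "u \<in> V \<Longrightarrow> v \<in> V \<Longrightarrow> (\<lambda>x. a * u x + b * v x) \<in> V"
    and ip_lincomb: "u \<in> V \<Longrightarrow> v \<in> V \<Longrightarrow> w \<in> V \<Longrightarrow> ip (\<lambda>x. a * u x + b * v x) w = a * ip u w + b * ip v w"
    and ip_commute: "ip u v = ip v u"
    and ip_nonneg: "0 \<le> ip u u"
begin

lemma ip_lincomb_right: "u \<in> V \<Longrightarrow> v \<in> V \<Longrightarrow> w \<in> V \<Longrightarrow> ip w (\<lambda>x. a * u x + b * v x) = a * ip w u + b * ip w v"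
  using ip_lincomb[of u v w a b] by (simp add: ip_commute[of w])

lemma add_mem: "u \<in> V \<Longrightarrow> v \<in> V \<Longrightarrow> (\<lambda>x. u x + v x) \<in> V"
  and diff_mem: "u \<in> V \<Longrightarrow> v \<in> V \<Longrightarrow> (\<lambda>x. u x - v x) \<in> V"
  and scale_mem: "u \<in> V \<Longrightarrow> (\<lambda>x. a * u x) \<in> V"
  using lincomb_mem[of u v 1 1] lincomb_mem[of u v 1 "-1"] lincomb_mem[of u u a 0] by simp_all

lemma ip_add: "u \<in> V \<Longrightarrow> v \<in> V \<Longrightarrow> w \<in> V \<Longrightarrow> ip (\<lambda>x. u x + v x) w = ip u w + ip v w"
  and ip_diff: "u \<in> V \<Longrightarrow> v \<in> V \<Longrightarrow> w \<in> V \<Longrightarrow> ip (\<lambda>x. u x - v x) w = ip u w - ip v w"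
  and ip_scale: "u \<in> V \<Longrightarrow> w \<in> V \<Longrightarrow> ip (\<lambda>x. a * u x) w = a * ip u w"
  using ip_lincomb[of u v w 1 1] ip_lincomb[of u v w 1 "-1"] ip_lincomb[of u u w a 0] by simp_all

lemma ip_add_right: "u \<in> V \<Longrightarrow> v \<in> V \<Longrightarrow> w \<in> V \<Longrightarrow> ip w (\<lambda>x. u x + v x) = ip w u + ip w v"
  and ip_diff_right: "u \<in> V \<Longrightarrow> v \<in> V \<Longrightarrow> w \<in> V \<Longrightarrow> ip w (\<lambda>x. u x - v x) = ip w u - ip w v"
  and ip_scale_right: "u \<in> V \<Longrightarrow> w \<in> V \<Longrightarrow> ip w (\<lambda>x. a * u x) = a * ip w u"
  using ip_add[of u v w] ip_diff[of u v w] ip_scale[of u w a] by (simp_all add: ip_commute[of w])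

lemma ip_zero: "w \<in> V \<Longrightarrow> ip (\<lambda>x. 0) w = 0" "w \<in> V \<Longrightarrow> ip w (\<lambda>x. 0) = 0"
  using ip_scale[of "\<lambda>x. 0" w 0] zero_mem by (simp_all add: ip_commute[of w])

lemmas mem = zero_mem add_mem diff_mem scale_mem

lemmas ip_simps = ip_add ip_diff ip_scale ip_add_right ip_diff_right ip_scale_right ip_zero

lemma Cauchy_Schwarz_sq:
  assumes "u \<in> V" "v \<in> V"
  shows "(ip u v)\<^sup>2 \<le> ip u u * ip v v"
proof -
  have *: "0 \<le> ip u u - 2 * t * ip u v + t\<^sup>2 * ip v v" for t
    using ip_nonneg[of "\<lambda>x. u x - t * v x"] assms
    by (simp add: ip_simps mem ip_commute[of v u] power2_eq_square algebra_simps)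
  show ?thesis
  proof (cases "ip v v = 0")
    case True
    have "ip u v = 0"
    proof (rule ccontr)
      assume n: "ip u v \<noteq> 0"
      \<comment> \<open>The parameter is chosen so that the right side is -1. This degenerate case
        must be treated because the form may vanish on nonzero vectors.\<close>
      have "0 \<le> ip u u - 2 * ((ip u u + 1) / (2 * ip u v)) * ip u v"
        using *[of "(ip u u + 1) / (2 * ip u v)"] True by simp
      then show False using n by simp
    qed
    then show ?thesis using True by simp
  next
    case False
    then have pos: "0 < ip v v" using ip_nonneg[of v] by simp
    from *[of "ip u v / ip v v"] have "0 \<le> ip u u - (ip u v)\<^sup>2 / ip v v"
      using pos by (simp add: power2_eq_square field_simps)
    then show ?thesis using pos by (simp add: field_simps)
  qed
qed

definition nrm :: "('x \<Rightarrow> real) \<Rightarrow> real" where "nrm u = sqrt (ip u u)"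

lemma nrm_nonneg: "0 \<le> nrm u" by (simp add: nrm_def ip_nonneg)

lemma nrm_sq: "(nrm u)\<^sup>2 = ip u u" by (simp add: nrm_def ip_nonneg)

lemma Cauchy_Schwarz: "u \<in> V \<Longrightarrow> v \<in> V \<Longrightarrow> \<bar>ip u v\<bar> \<le> nrm u * nrm v"
  using real_sqrt_le_mono[OF Cauchy_Schwarz_sq[of u v]] by (simp add: nrm_def real_sqrt_mult)

lemma nrm_triangle:
  assumes "u \<in> V" "v \<in> V" shows "nrm (\<lambda>x. u x + v x) \<le> nrm u + nrm v"
proof (rule power2_le_imp_le)
  have "ip u v \<le> nrm u * nrm v" using Cauchy_Schwarz[OF assms] by linarith
  then show "(nrm (\<lambda>x. u x + v x))\<^sup>2 \<le> (nrm u + nrm v)\<^sup>2"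
    using assms by (simp add: nrm_sq power2_sum ip_simps mem ip_commute[of v u])
qed (simp add: nrm_nonneg)

lemma nrm_scale: "u \<in> V \<Longrightarrow> nrm (\<lambda>x. a * u x) = \<bar>a\<bar> * nrm u"
  by (simp add: nrm_def ip_simps mem real_sqrt_mult mult.assoc[symmetric])

lemma nrm_diff_triangle:
  assumes "u \<in> V" "v \<in> V" shows "\<bar>nrm u - nrm v\<bar> \<le> nrm (\<lambda>x. u x - v x)"
proof -
  have 1: "nrm (\<lambda>x. v x - u x) = nrm (\<lambda>x. u x - v x)"
    using nrm_scale[of "\<lambda>x. u x - v x" "-1"] assms by (simp add: mem)
  have "nrm u \<le> nrm (\<lambda>x. u x - v x) + nrm v"
    using nrm_triangle[of "\<lambda>x. u x - v x" v] assms by (simp add: mem)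
  moreover have "nrm v \<le> nrm (\<lambda>x. v x - u x) + nrm u"
    using nrm_triangle[of "\<lambda>x. v x - u x" u] assms by (simp add: mem)
  ultimately show ?thesis using 1 by simp
qed

end

locale hilbert = semi_inner V ip
  for V :: "('x \<Rightarrow> real) set" and ip +
  assumes complete: "(\<And>n::nat. s n \<in> V) \<Longrightarrow>
      (\<And>\<epsilon>. 0 < \<epsilon> \<Longrightarrow> \<exists>N. \<forall>m\<ge>N. \<forall>n\<ge>N. ip (\<lambda>x. s m x - s n x) (\<lambda>x. s m x - s n x) < \<epsilon>) \<Longrightarrow>
      \<exists>l\<in>V. (\<lambda>n. ip (\<lambda>x. s n x - l x) (\<lambda>x. s n x - l x)) \<longlonglongrightarrow> 0"
begin

text \<open>The representing element minimizes \<open>v \<mapsto> ip v v - 2 F v\<close>.\<close>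

lemma Riesz:
  assumes lin: "\<And>u v a b. u \<in> V \<Longrightarrow> v \<in> V \<Longrightarrow> F (\<lambda>x. a * u x + b * v x) = a * F u + b * F v"
    and bound: "\<And>u. u \<in> V \<Longrightarrow> \<bar>F u\<bar> \<le> C * nrm u"
  shows "\<exists>u\<in>V. \<forall>v\<in>V. ip u v = F v"
proof -
  define J where "J = (\<lambda>v. ip v v - 2 * F v)"
  have Flin: "F (\<lambda>x. u x + t * v x) = F u + t * F v" "F (\<lambda>x. u x - v x) = F u - F v" "F (\<lambda>x. t * v x) = t * F v"
    if "u \<in> V" "v \<in> V" for u v t
    using lin[OF that, of 1 t] lin[OF that, of 1 "-1"] lin[of v v t 0] that by simp_all
  \<comment> \<open>Completing the square in the norm of \<open>v\<close>; the infimum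
    \<open>d\<close> is therefore finite.\<close>
  have Jb: "- C\<^sup>2 \<le> J v" if "v \<in> V" for v
  proof -
    have "0 \<le> (nrm v - C)\<^sup>2" by simp
    moreover have "F v \<le> C * nrm v" using bound[OF that] by linarith
    ultimately show ?thesis unfolding J_def power2_diff nrm_sq by (simp add: mult_ac)
  qed
  define d where "d = (INF v\<in>V. J v)"
  have bdd: "bdd_below (J ` V)" using Jb by (intro bdd_belowI2[where m="- C\<^sup>2"])
  have dJ: "d \<le> J v" if "v \<in> V" for v unfolding d_def using bdd that by (rule cINF_lower)
  define i where "i = (\<lambda>n. inverse (real (Suc n)))"
  have i_pos: "0 < i n" for n by (simp add: i_def)
  have "\<forall>n::nat. \<exists>v\<in>V. J v < d + i n"
  proof
    fix n
    have "(INF v\<in>V. J v) < d + i n" unfolding d_def using i_pos by simp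
    then show "\<exists>v\<in>V. J v < d + i n"
      using cINF_less_iff[OF _ bdd] zero_mem by blast
  qed
  then obtain s where s: "\<And>n. s n \<in> V" "\<And>n. J (s n) < d + i n" by metis
  \<comment> \<open>The parallelogram law at the midpoint \<open>?h\<close>, where the linear part
    of J cancels; it makes every minimizing sequence Cauchy.\<close>
  have par: "ip (\<lambda>x. s m x - s n x) (\<lambda>x. s m x - s n x) \<le> 2 * (J (s m) - d) + 2 * (J (s n) - d)" for m n
  proof -
    let ?h = "\<lambda>x. (1/2) * s m x + (1/2) * s n x"
    have "ip (\<lambda>x. s m x - s n x) (\<lambda>x. s m x - s n x) = 2 * J (s m) + 2 * J (s n) - 4 * J ?h"
      unfolding J_def using s(1)[of m] s(1)[of n]
      by (simp add: ip_simps ip_lincomb ip_lincomb_right lincomb_mem mem lin ip_commute[of "s n" "s m"] del: times_divide_eq_left)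
         (simp add: field_simps)
    moreover have "d \<le> J ?h" by (intro dJ lincomb_mem s)
    ultimately show ?thesis by simp
  qed
  have "\<exists>l\<in>V. (\<lambda>n. ip (\<lambda>x. s n x - l x) (\<lambda>x. s n x - l x)) \<longlonglongrightarrow> 0"
  proof (rule complete[OF s(1)])
    fix \<epsilon> :: real assume "0 < \<epsilon>"
    then obtain N where N: "i N < \<epsilon> / 4" using reals_Archimedean[of "\<epsilon> / 4"] by (auto simp: i_def)
    have "ip (\<lambda>x. s m x - s n x) (\<lambda>x. s m x - s n x) < \<epsilon>" if "N \<le> m" "N \<le> n" for m n
    proof -
      have "i m \<le> i N" "i n \<le> i N"
        using that by (auto simp: i_def intro!: le_imp_inverse_le)
      have "2 * (J (s m) - d) + 2 * (J (s n) - d) < \<epsilon>" proof -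
        have "J (s m) - d < i m" "J (s n) - d < i n" using s(2)[of m] s(2)[of n] by simp_all
        then have "J (s m) - d < \<epsilon> / 4" "J (s n) - d < \<epsilon> / 4"
          using N \<open>i m \<le> i N\<close> \<open>i n \<le> i N\<close> by simp_all
        then show ?thesis by simp
      qed
      then show ?thesis by (rule le_less_trans[OF par])
    qed
    then show "\<exists>N. \<forall>m\<ge>N. \<forall>n\<ge>N. ip (\<lambda>x. s m x - s n x) (\<lambda>x. s m x - s n x) < \<epsilon>" by blast
  qed
  then obtain l where l: "l \<in> V" "(\<lambda>n. ip (\<lambda>x. s n x - l x) (\<lambda>x. s n x - l x)) \<longlonglongrightarrow> 0" by blast
  define \<delta> where "\<delta> = (\<lambda>n. nrm (\<lambda>x. s n x - l x))"
  have \<delta>: "\<delta> \<longlonglongrightarrow> 0" unfolding \<delta>_def nrm_def using tendsto_real_sqrt[OF l(2)] by simp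
  \<comment> \<open>J is compared at \<open>s n\<close> and \<open>l\<close> by expanding around
    \<open>l\<close>; the error is linear in the distance \<open>\<delta> n\<close>.\<close>
  have Jl: "J l \<le> d"
  proof (rule LIMSEQ_le_const)
    have "(\<lambda>n. d + i n + 2 * (C + nrm l) * \<delta> n) \<longlonglongrightarrow> d + 0 + 2 * (C + nrm l) * 0"
      unfolding i_def by (intro tendsto_intros LIMSEQ_inverse_real_of_nat \<delta>)
    then show "(\<lambda>n. d + i n + 2 * (C + nrm l) * \<delta> n) \<longlonglongrightarrow> d" by simp
    have "J l \<le> d + i n + 2 * (C + nrm l) * \<delta> n" for n
    proof -
      let ?e = "\<lambda>x. s n x - l x"
      have e: "?e \<in> V" using s l by (simp add: mem)
      have "J (s n) = J l + ip ?e ?e + 2 * ip l ?e - 2 * F ?e"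
        unfolding J_def using s(1)[of n] l(1) by (simp add: ip_simps mem Flin ip_commute[of "s n" l])
      moreover have "F ?e \<le> C * \<delta> n" using bound[OF e] unfolding \<delta>_def by linarith
      moreover have "- (nrm l * \<delta> n) \<le> ip l ?e" using Cauchy_Schwarz[OF l(1) e] unfolding \<delta>_def by linarith
      moreover have "0 \<le> ip ?e ?e" by (rule ip_nonneg)
      ultimately have "J l \<le> J (s n) + 2 * (nrm l * \<delta> n) + 2 * (C * \<delta> n)" by linarith
      then show ?thesis using s(2)[of n] by (simp add: algebra_simps)
    qed
    then show "\<exists>N. \<forall>n\<ge>N. J l \<le> d + i n + 2 * (C + nrm l) * \<delta> n" by blast
  qed
  have "ip l v = F v" if v: "v \<in> V" for v
  proof (rule ccontr)
    assume ne: "ip l v \<noteq> F v"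
    define D where "D = ip l v - F v"
    have D: "D \<noteq> 0" using ne by (simp add: D_def)
    have "0 \<le> t\<^sup>2 * ip v v + 2 * t * D" for t
    proof -
      have m: "(\<lambda>x. l x + t * v x) \<in> V" using l v by (simp add: mem)
      have "J (\<lambda>x. l x + t * v x) = J l + t\<^sup>2 * ip v v + 2 * t * D"
        unfolding J_def D_def using l(1) v
        by (simp add: ip_simps mem Flin ip_commute[of v l] power2_eq_square algebra_simps)
      then show ?thesis using Jl dJ[OF m] by linarith
    qed
    \<comment> \<open>The quadratic in t has slope 2D at 0, so it is negative for suitable small t.
      The added 1 keeps the denominator positive when \<open>v\<close> is a null vector.\<close>
    from this[of "- D / (ip v v + 1)"] have "0 \<le> (D / (ip v v + 1))\<^sup>2 * ip v v - 2 * (D\<^sup>2 / (ip v v + 1))"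
      by (simp add: power2_eq_square field_simps)
    also have "\<dots> = D\<^sup>2 * (ip v v - 2 * (ip v v + 1)) / (ip v v + 1)\<^sup>2"
      using ip_nonneg[of v] by (simp add: power_divide power2_eq_square divide_simps) (simp add: algebra_simps)
    also have "\<dots> < 0"
      using D ip_nonneg[of v] by (intro divide_neg_pos mult_pos_neg) auto
    finally show False by simp
  qed
  with l(1) show ?thesis by blast
qed

lemma closed_subspace:
  assumes "N \<subseteq> V" "(\<lambda>x. 0) \<in> N" "\<And>u v a b. u \<in> N \<Longrightarrow> v \<in> N \<Longrightarrow> (\<lambda>x. a * u x + b * v x) \<in> N"
    and closed: "\<And>s l. (\<And>n::nat. s n \<in> N) \<Longrightarrow> l \<in> V \<Longrightarrow> (\<lambda>n. ip (\<lambda>x. s n x - l x) (\<lambda>x. s n x - l x)) \<longlonglongrightarrow> 0 \<Longrightarrow> l \<in> N"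
  shows "hilbert N ip"
proof
  fix s assume s: "\<And>n::nat. s n \<in> N"
    and C: "\<And>\<epsilon>. 0 < \<epsilon> \<Longrightarrow> \<exists>N. \<forall>m\<ge>N. \<forall>n\<ge>N. ip (\<lambda>x. s m x - s n x) (\<lambda>x. s m x - s n x) < \<epsilon>"
  have "s n \<in> V" for n using s assms(1) by blast
  from complete[OF this C] obtain l where "l \<in> V" "(\<lambda>n. ip (\<lambda>x. s n x - l x) (\<lambda>x. s n x - l x)) \<longlonglongrightarrow> 0" by blast
  then have "l \<in> N" using closed[of s l] s by blast
  with \<open>(\<lambda>n. ip (\<lambda>x. s n x - l x) (\<lambda>x. s n x - l x)) \<longlonglongrightarrow> 0\<close> show "\<exists>l\<in>N. (\<lambda>n. ip (\<lambda>x. s n x - l x) (\<lambda>x. s n x - l x)) \<longlonglongrightarrow> 0" by blast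
next
  show "(\<lambda>x. 0) \<in> N" by (rule assms(2))
  show "(\<lambda>x. a * u x + b * v x) \<in> N" if "u \<in> N" "v \<in> N" for u v a b using that by (rule assms(3))
  show "ip (\<lambda>x. a * u x + b * v x) w = a * ip u w + b * ip v w" if "u \<in> N" "v \<in> N" "w \<in> N" for u v w a b
    using that assms(1) by (intro ip_lincomb) auto
  show "ip u v = ip v u" "0 \<le> ip u u" for u v by (rule ip_commute ip_nonneg)+
qed

text \<open>The projection is the Riesz representative, inside \<open>N\<close>, of the functional
  \<open>ip u\<close> restricted to \<open>N\<close>.\<close>

lemma projection:
  assumes N: "N \<subseteq> V" "hilbert N ip" and u: "u \<in> V"
  shows "\<exists>w\<in>N. \<forall>g\<in>N. ip (\<lambda>x. u x - w x) g = 0"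
proof -
  interpret N: hilbert N ip by (rule N)
  have "\<exists>w\<in>N. \<forall>g\<in>N. ip w g = ip u g"
  proof (rule N.Riesz)
    show "\<bar>ip u v\<bar> \<le> nrm u * N.nrm v" if "v \<in> N" for v
      using Cauchy_Schwarz[OF u, of v] that N by (auto simp: nrm_def N.nrm_def)
  qed (use u N ip_lincomb_right in \<open>auto simp: subset_iff\<close>)
  then obtain w where w: "w \<in> N" "\<And>g. g \<in> N \<Longrightarrow> ip w g = ip u g" by blast
  have "ip (\<lambda>x. u x - w x) g = 0" if "g \<in> N" for g
    using w that N(1) u by (simp add: ip_diff subset_iff)
  with w(1) show ?thesis by blast
qed

end

section \<open>Bounded skew forms on a Hilbert space and the resolvents of their operators\<close>

locale hilbert_skew = hilbert V ip
  for V :: "('x \<Rightarrow> real) set" and ip +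
  fixes A :: "('x \<Rightarrow> real) \<Rightarrow> ('x \<Rightarrow> real) \<Rightarrow> real" and K :: real
  assumes A_lincomb: "u \<in> V \<Longrightarrow> v \<in> V \<Longrightarrow> w \<in> V \<Longrightarrow> A (\<lambda>x. a * u x + b * v x) w = a * A u w + b * A v w"
    and A_skew: "u \<in> V \<Longrightarrow> v \<in> V \<Longrightarrow> A u v = - A v u"
    and A_bound: "u \<in> V \<Longrightarrow> v \<in> V \<Longrightarrow> \<bar>A u v\<bar> \<le> K * nrm u * nrm v"
    and K_nonneg: "0 \<le> K"
begin

lemma A_lincomb_right:
  assumes "u \<in> V" "v \<in> V" "w \<in> V"
  shows "A w (\<lambda>x. a * u x + b * v x) = a * A w u + b * A w v"
  using A_lincomb[OF assms, of a b] A_skew[OF assms(3) lincomb_mem[OF assms(1,2)], of a b]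
    A_skew[OF assms(3,1)] A_skew[OF assms(3,2)] by (simp add: algebra_simps)

lemma A_add: "u \<in> V \<Longrightarrow> v \<in> V \<Longrightarrow> w \<in> V \<Longrightarrow> A (\<lambda>x. u x + v x) w = A u w + A v w"
  and A_diff: "u \<in> V \<Longrightarrow> v \<in> V \<Longrightarrow> w \<in> V \<Longrightarrow> A (\<lambda>x. u x - v x) w = A u w - A v w"
  and A_scale: "u \<in> V \<Longrightarrow> w \<in> V \<Longrightarrow> A (\<lambda>x. a * u x) w = a * A u w"
  using A_lincomb[of u v w 1 1] A_lincomb[of u v w 1 "-1"] A_lincomb[of u u w a 0] by simp_all

lemma A_self: "u \<in> V \<Longrightarrow> A u u = 0"
  using A_skew[of u u] by simp

text \<open>The bounded operator that represents the form \<open>A\<close>. The representative is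
  unique only up to null vectors, so this choice is linear only in that sense.\<close>

definition G :: "('x \<Rightarrow> real) \<Rightarrow> 'x \<Rightarrow> real" where
  "G u = (SOME g. g \<in> V \<and> (\<forall>v\<in>V. ip g v = A u v))"

lemma G: "u \<in> V \<Longrightarrow> G u \<in> V" "u \<in> V \<Longrightarrow> v \<in> V \<Longrightarrow> ip (G u) v = A u v"
proof -
  have ex: "\<exists>g. g \<in> V \<and> (\<forall>v\<in>V. ip g v = A u v)" if "u \<in> V" for u
    using Riesz[of "A u" "K * nrm u"] A_lincomb_right A_bound that by blast
  show "u \<in> V \<Longrightarrow> G u \<in> V" "u \<in> V \<Longrightarrow> v \<in> V \<Longrightarrow> ip (G u) v = A u v"
    using someI_ex[OF ex] unfolding G_def by blast+
qed

lemma nrm_G: "u \<in> V \<Longrightarrow> nrm (G u) \<le> K * nrm u"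
proof -
  assume u: "u \<in> V"
  have "nrm (G u) * nrm (G u) = A u (G u)" using G[OF u] by (simp add: nrm_sq[unfolded power2_eq_square])
  also have "\<dots> \<le> K * nrm u * nrm (G u)" using A_bound[OF u G(1)[OF u]] by linarith
  finally show ?thesis
    using nrm_nonneg[of "G u"] mult_nonneg_nonneg[OF K_nonneg nrm_nonneg[of u]]
    by (cases "nrm (G u) = 0") (simp_all add: mult_le_cancel_right)
qed

text \<open>The equation (1 - \<alpha> G) \<phi> = h in weak form. Stating it with \<open>A\<close>
  avoids the choice in \<open>G\<close>, and solutions combine linearly without exceptional null
  vectors.\<close>

definition solves :: "real \<Rightarrow> ('x \<Rightarrow> real) \<Rightarrow> ('x \<Rightarrow> real) \<Rightarrow> bool" where
  "solves \<alpha> h \<phi> \<longleftrightarrow> h \<in> V \<and> \<phi> \<in> V \<and> (\<forall>v\<in>V. ip \<phi> v - \<alpha> * A \<phi> v = ip h v)"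

text \<open>Testing with \<phi> itself removes the skew term. The bound does not depend on
  \<alpha>.\<close>

lemma solves_norm:
  assumes "solves \<alpha> h \<phi>" shows "nrm \<phi> \<le> nrm h"
proof -
  have m: "h \<in> V" "\<phi> \<in> V" and e: "ip \<phi> \<phi> - \<alpha> * A \<phi> \<phi> = ip h \<phi>" using assms by (auto simp: solves_def)
  have "nrm \<phi> * nrm \<phi> = ip h \<phi>" using e A_self[OF m(2)] by (simp add: nrm_sq[unfolded power2_eq_square])
  also have "\<dots> \<le> nrm h * nrm \<phi>" using Cauchy_Schwarz[OF m] by linarith
  finally show ?thesis using nrm_nonneg[of \<phi>] nrm_nonneg[of h]
    by (cases "nrm \<phi> = 0") (simp_all add: mult_le_cancel_right)
qed

lemma solves_lincomb:
  assumes "solves \<alpha> h \<phi>" "solves \<alpha> h' \<phi>'"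
  shows "solves \<alpha> (\<lambda>x. a * h x + b * h' x) (\<lambda>x. a * \<phi> x + b * \<phi>' x)"
  unfolding solves_def
proof (intro conjI ballI)
  have m: "h \<in> V" "\<phi> \<in> V" "h' \<in> V" "\<phi>' \<in> V" using assms by (auto simp: solves_def)
  show "(\<lambda>x. a * h x + b * h' x) \<in> V" "(\<lambda>x. a * \<phi> x + b * \<phi>' x) \<in> V"
    using m by (auto intro: lincomb_mem)
  fix v assume v: "v \<in> V"
  have e: "ip \<phi> v = ip h v + \<alpha> * A \<phi> v" "ip \<phi>' v = ip h' v + \<alpha> * A \<phi>' v"
    using assms v by (auto simp: solves_def dest!: bspec[of _ _ v])
  show "ip (\<lambda>x. a * \<phi> x + b * \<phi>' x) v - \<alpha> * A (\<lambda>x. a * \<phi> x + b * \<phi>' x) v = ip (\<lambda>x. a * h x + b * h' x) v"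
    using m v by (simp add: ip_lincomb A_lincomb e algebra_simps)
qed

text \<open>The difference of two solutions solves the equation with zero data, so it is a null
  vector. Equality of the squared norms is what makes the asymptotic variance well defined.\<close>

lemma solves_unique:
  assumes "solves \<alpha> h \<phi>" "solves \<alpha> h \<phi>'"
  shows "ip \<phi> \<phi> = ip \<phi>' \<phi>'"
proof -
  have m: "\<phi> \<in> V" "\<phi>' \<in> V" "h \<in> V" using assms by (auto simp: solves_def)
  have "nrm (\<lambda>x. 1 * \<phi> x + (-1) * \<phi>' x) \<le> nrm (\<lambda>x. 1 * h x + (-1) * h x)"
    by (rule solves_norm[OF solves_lincomb[OF assms]])
  then have "nrm (\<lambda>x. \<phi> x - \<phi>' x) \<le> nrm (\<lambda>x. 0)" by simp
  also have "nrm (\<lambda>x. 0) = 0" using ip_zero[OF zero_mem] by (simp add: nrm_def)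
  finally have "nrm \<phi> = nrm \<phi>'" using nrm_diff_triangle[OF m(1,2)] by simp
  then show ?thesis using nrm_sq by metis
qed

text \<open>With the inner product \<open>ip u v + \<alpha>\<^sup>2 ip (G u) (G v)\<close> the Riesz theorem yields \<open>\<psi>\<close> with
  \<open>(1 - \<alpha>\<^sup>2 G\<^sup>2) \<psi> = h\<close>, and \<open>(1 + \<alpha> G) \<psi>\<close> is the solution.\<close>

lemma solves_exists:
  assumes h: "h \<in> V"
  shows "\<exists>\<phi>. solves \<alpha> h \<phi>"
proof -
  define q where "q = (\<lambda>u v. ip u v + \<alpha>\<^sup>2 * ip (G u) (G v))"
  have GG: "ip (G u) (G v) = - A (G u) v" if "u \<in> V" "v \<in> V" for u v
    using G(2)[OF that(2) G(1)[OF that(1)]] A_skew[OF that(2) G(1)[OF that(1)]] by (simp add: ip_commute[of "G u"])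
  have Glin: "ip (G (\<lambda>x. a * u x + b * v x)) (G w) = a * ip (G u) (G w) + b * ip (G v) (G w)"
    if "u \<in> V" "v \<in> V" "w \<in> V" for u v w a b
    using that by (simp add: G lincomb_mem A_lincomb)
  have le: "ip u u \<le> q u u" for u by (simp add: q_def ip_nonneg)
  have ge: "q u u \<le> (1 + \<alpha>\<^sup>2 * K\<^sup>2) * ip u u" if "u \<in> V" for u
  proof -
    have "(nrm (G u))\<^sup>2 \<le> (K * nrm u)\<^sup>2" by (rule power_mono[OF nrm_G[OF that] nrm_nonneg])
    then have "ip (G u) (G u) \<le> K\<^sup>2 * ip u u" by (simp add: power_mult_distrib nrm_sq)
    then have "\<alpha>\<^sup>2 * ip (G u) (G u) \<le> \<alpha>\<^sup>2 * (K\<^sup>2 * ip u u)" by (rule mult_left_mono) simp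
    then show ?thesis by (simp add: q_def algebra_simps)
  qed
  \<comment> \<open>By \<open>le\<close> and \<open>ge\<close> the two forms are equivalent, so
    Cauchy sequences and limits are the same and completeness carries over.\<close>
  interpret Q: hilbert V q
  proof
    show "q (\<lambda>x. a * u x + b * v x) w = a * q u w + b * q v w" if "u \<in> V" "v \<in> V" "w \<in> V" for u v w a b
      using that by (simp add: q_def ip_lincomb Glin algebra_simps)
    show "q u v = q v u" for u v by (simp add: q_def ip_commute[of u] ip_commute[of "G u"])
    show "0 \<le> q u u" for u by (simp add: q_def ip_nonneg)
    fix s assume s: "\<And>n::nat. s n \<in> V"
      and C: "\<And>\<epsilon>. 0 < \<epsilon> \<Longrightarrow> \<exists>N. \<forall>m\<ge>N. \<forall>n\<ge>N. q (\<lambda>x. s m x - s n x) (\<lambda>x. s m x - s n x) < \<epsilon>"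
    have "\<exists>N. \<forall>m\<ge>N. \<forall>n\<ge>N. ip (\<lambda>x. s m x - s n x) (\<lambda>x. s m x - s n x) < \<epsilon>" if "0 < \<epsilon>" for \<epsilon>
      using C[OF that] le order_le_less_trans by meson
    from complete[OF s this] obtain l where l: "l \<in> V" "(\<lambda>n. ip (\<lambda>x. s n x - l x) (\<lambda>x. s n x - l x)) \<longlonglongrightarrow> 0" by blast
    have "(\<lambda>n. q (\<lambda>x. s n x - l x) (\<lambda>x. s n x - l x)) \<longlonglongrightarrow> 0"
    proof (rule tendsto_sandwich[where f="\<lambda>n. 0"])
      show "(\<lambda>n. (1 + \<alpha>\<^sup>2 * K\<^sup>2) * ip (\<lambda>x. s n x - l x) (\<lambda>x. s n x - l x)) \<longlonglongrightarrow> 0"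
        using tendsto_mult_left[OF l(2), of "1 + \<alpha>\<^sup>2 * K\<^sup>2"] by simp
      show "\<forall>\<^sub>F n in sequentially. q (\<lambda>x. s n x - l x) (\<lambda>x. s n x - l x) \<le> (1 + \<alpha>\<^sup>2 * K\<^sup>2) * ip (\<lambda>x. s n x - l x) (\<lambda>x. s n x - l x)"
        using ge s l by (simp add: mem)
      show "\<forall>\<^sub>F n in sequentially. 0 \<le> q (\<lambda>x. s n x - l x) (\<lambda>x. s n x - l x)"
        by (simp add: q_def ip_nonneg)
    qed simp
    with l(1) show "\<exists>l\<in>V. (\<lambda>n. q (\<lambda>x. s n x - l x) (\<lambda>x. s n x - l x)) \<longlonglongrightarrow> 0" by blast
  qed (use zero_mem lincomb_mem in auto)
  have "\<exists>\<psi>\<in>V. \<forall>v\<in>V. q \<psi> v = ip h v"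
  proof (rule Q.Riesz)
    show "\<bar>ip h v\<bar> \<le> nrm h * Q.nrm v" if "v \<in> V" for v
    proof -
      have "\<bar>ip h v\<bar> \<le> nrm h * nrm v" by (rule Cauchy_Schwarz[OF h that])
      also have "\<dots> \<le> nrm h * Q.nrm v"
        using le[of v] by (intro mult_left_mono nrm_nonneg) (simp add: nrm_def Q.nrm_def)
      finally show ?thesis .
    qed
  qed (use h ip_lincomb_right in auto)
  then obtain \<psi> where \<psi>: "\<psi> \<in> V" "\<And>v. v \<in> V \<Longrightarrow> q \<psi> v = ip h v" by blast
  have "solves \<alpha> h (\<lambda>x. 1 * \<psi> x + \<alpha> * G \<psi> x)"
    unfolding solves_def
  proof (intro conjI ballI h lincomb_mem \<psi>(1) G(1))
    fix v assume v: "v \<in> V"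
    have "ip h v = ip \<psi> v - \<alpha>\<^sup>2 * A (G \<psi>) v" using \<psi>(2)[OF v] GG[OF \<psi>(1) v] by (simp add: q_def)
    moreover have "ip (\<lambda>x. 1 * \<psi> x + \<alpha> * G \<psi> x) v = ip \<psi> v + \<alpha> * A \<psi> v"
      using ip_lincomb[OF \<psi>(1) G(1)[OF \<psi>(1)] v, of 1 \<alpha>] G(2)[OF \<psi>(1) v] by simp
    moreover have "A (\<lambda>x. 1 * \<psi> x + \<alpha> * G \<psi> x) v = A \<psi> v + \<alpha> * A (G \<psi>) v"
      using A_lincomb[OF \<psi>(1) G(1)[OF \<psi>(1)] v, of 1 \<alpha>] by simp
    ultimately show "ip (\<lambda>x. 1 * \<psi> x + \<alpha> * G \<psi> x) v - \<alpha> * A (\<lambda>x. 1 * \<psi> x + \<alpha> * G \<psi> x) v = ip h v"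
      by (simp add: power2_eq_square algebra_simps)
  qed
  then show ?thesis by blast
qed

definition ker :: "('x \<Rightarrow> real) set" where
  "ker = {u \<in> V. \<forall>v\<in>V. A u v = 0}"

text \<open>For fixed \<open>v\<close>, the map u to A u v is continuous by \<open>A_bound\<close>,
  so the kernel is closed and the projection onto it exists.\<close>

lemma hilbert_ker: "hilbert ker ip"
proof (rule closed_subspace)
  show "ker \<subseteq> V" by (auto simp: ker_def)
  show "(\<lambda>x. 0) \<in> ker" using A_scale[OF zero_mem, of _ 0] by (auto simp: ker_def zero_mem)
  show "(\<lambda>x. a * u x + b * v x) \<in> ker" if "u \<in> ker" "v \<in> ker" for u v a b
    using that by (auto simp: ker_def lincomb_mem A_lincomb)
  fix s l assume s: "\<And>n::nat. s n \<in> ker" and l: "l \<in> V"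
    and lim: "(\<lambda>n. ip (\<lambda>x. s n x - l x) (\<lambda>x. s n x - l x)) \<longlonglongrightarrow> 0"
  have sV: "s n \<in> V" for n using s[of n] by (simp add: ker_def)
  have "A l v = 0" if v: "v \<in> V" for v
  proof -
    have "(\<lambda>n. K * nrm (\<lambda>x. s n x - l x) * nrm v) \<longlonglongrightarrow> K * sqrt 0 * nrm v"
      unfolding nrm_def by (intro tendsto_intros lim)
    moreover have "\<bar>A l v\<bar> \<le> K * nrm (\<lambda>x. s n x - l x) * nrm v" for n
    proof -
      have "A (\<lambda>x. s n x - l x) v = - A l v" using A_diff[OF sV l v] s[of n] v by (simp add: ker_def)
      then show ?thesis using A_bound[of "\<lambda>x. s n x - l x" v] sV[of n] l v by (simp add: mem)
    qed
    ultimately have "\<bar>A l v\<bar> \<le> K * sqrt 0 * nrm v"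
      by (intro LIMSEQ_le_const) auto
    then show ?thesis by simp
  qed
  then show "l \<in> ker" using l by (simp add: ker_def)
qed

text \<open>Testing with the difference of \<phi> and h leaves \<alpha> A on the right, so that
  difference has norm at most |\<alpha>| K times the norm of h, by
  \<open>solves_norm\<close>.\<close>

lemma solves_tendsto_zero:
  assumes "\<And>\<alpha>. solves \<alpha> h (\<phi> \<alpha>)"
  shows "((\<lambda>\<alpha>. ip (\<phi> \<alpha>) (\<phi> \<alpha>)) \<longlongrightarrow> ip h h) (at 0)"
proof -
  have m: "h \<in> V" "\<phi> \<alpha> \<in> V" for \<alpha> using assms by (auto simp: solves_def)
  have le: "\<bar>nrm (\<phi> \<alpha>) - nrm h\<bar> \<le> \<bar>\<alpha>\<bar> * (K * nrm h)" for \<alpha>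
  proof -
    let ?d = "\<lambda>x. \<phi> \<alpha> x - h x"
    have d: "?d \<in> V" using m by (simp add: mem)
    have "nrm ?d * nrm ?d = ip (\<phi> \<alpha>) ?d - ip h ?d"
      using m d by (simp add: nrm_sq[unfolded power2_eq_square] ip_diff)
    also have "\<dots> = \<alpha> * A (\<phi> \<alpha>) ?d" using assms[of \<alpha>] d by (auto simp: solves_def dest: bspec[of _ _ ?d])
    also have "\<dots> \<le> \<bar>\<alpha>\<bar> * \<bar>A (\<phi> \<alpha>) ?d\<bar>" by (metis abs_ge_self abs_mult)
    also have "\<dots> \<le> \<bar>\<alpha>\<bar> * (K * nrm (\<phi> \<alpha>) * nrm ?d)" by (intro mult_left_mono A_bound m d) simp
    also have "\<dots> \<le> \<bar>\<alpha>\<bar> * (K * nrm h * nrm ?d)"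
      by (intro mult_left_mono mult_right_mono solves_norm[OF assms] K_nonneg nrm_nonneg) simp
    finally have "nrm ?d * nrm ?d \<le> \<bar>\<alpha>\<bar> * (K * nrm h) * nrm ?d" by (simp add: mult_ac)
    then have "nrm ?d \<le> \<bar>\<alpha>\<bar> * (K * nrm h)"
      using nrm_nonneg[of ?d] mult_nonneg_nonneg[OF abs_ge_zero[of \<alpha>] mult_nonneg_nonneg[OF K_nonneg nrm_nonneg[of h]]]
      by (cases "nrm ?d = 0") (simp_all add: mult_le_cancel_right)
    then show ?thesis using nrm_diff_triangle[OF m(2,1), of \<alpha>] by linarith
  qed
  have "((\<lambda>\<alpha>. nrm (\<phi> \<alpha>) - nrm h) \<longlongrightarrow> 0) (at 0)"
  proof (rule Lim_null_comparison)
    have "((\<lambda>\<alpha>. \<bar>\<alpha>\<bar> * (K * nrm h)) \<longlongrightarrow> \<bar>0\<bar> * (K * nrm h)) (at 0)"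
      by (intro tendsto_intros)
    then show "((\<lambda>\<alpha>. \<bar>\<alpha>\<bar> * (K * nrm h)) \<longlongrightarrow> 0) (at 0)" by simp
  qed (use le in auto)
  then have "((\<lambda>\<alpha>. nrm (\<phi> \<alpha>)) \<longlongrightarrow> nrm h) (at 0)" by (simp add: LIM_zero_iff)
  from tendsto_power[OF this, of 2] show ?thesis by (simp add: nrm_sq)
qed

text \<open>The closure \<open>M\<close> of the range is a closed subspace. The residual of
  projecting r onto it is orthogonal to the range, hence in the kernel by skewness; since r is
  orthogonal to the kernel, the residual has norm 0.\<close>

lemma range_G_dense:
  assumes r: "r \<in> V" and orth: "\<And>k. k \<in> ker \<Longrightarrow> ip r k = 0" and \<epsilon>: "0 < \<epsilon>"
  shows "\<exists>g\<in>V. nrm (\<lambda>x. r x - G g x) < \<epsilon>"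
proof -
  define M where "M = {m \<in> V. \<forall>\<epsilon>>0. \<exists>g\<in>V. nrm (\<lambda>x. m x - G g x) < \<epsilon>}"
  \<comment> \<open>Substitute for linearity of the chosen \<open>G\<close>; without it
    \<open>M\<close> could not be shown to be a subspace.\<close>
  have null: "nrm (\<lambda>x. (a * G g x + b * G g' x) - G (\<lambda>x. a * g x + b * g' x) x) = 0" if "g \<in> V" "g' \<in> V" for g g' a b
  proof -
    let ?n = "\<lambda>x. (a * G g x + b * G g' x) - G (\<lambda>x. a * g x + b * g' x) x"
    have n: "?n \<in> V" using that by (intro diff_mem lincomb_mem G)
    have "ip ?n ?n = 0"
      using that n by (subst ip_diff) (auto simp: lincomb_mem G ip_lincomb A_lincomb)
    then show ?thesis by (simp add: nrm_def)
  qed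
  have MV: "M \<subseteq> V" by (auto simp: M_def)
  have HM: "hilbert M ip"
  proof (rule closed_subspace[OF MV])
    have ip0: "nrm (G (\<lambda>x. 0)) = 0"
      using nrm_G[OF zero_mem] nrm_nonneg[of "G (\<lambda>x. 0)"] ip_zero[OF zero_mem] by (simp add: nrm_def)
    have "nrm (\<lambda>x. (0::real) - G (\<lambda>x. 0) x) = 0"
      using nrm_scale[OF G(1)[OF zero_mem], of "-1"] ip0 by simp
    then show "(\<lambda>x. 0) \<in> M" using zero_mem by (auto simp: M_def intro!: bexI[of _ "\<lambda>x. 0"])
    show "(\<lambda>x. a * u x + b * v x) \<in> M" if u: "u \<in> M" and v: "v \<in> M" for u v a b
    proof -
      have uV: "u \<in> V" and vV: "v \<in> V" using u v MV by auto
      have "\<exists>g\<in>V. nrm (\<lambda>x. (a * u x + b * v x) - G g x) < \<epsilon>" if e: "0 < \<epsilon>" for \<epsilon>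
      proof -
        \<comment> \<open>The added 1 covers a = b = 0, and the factor 2 makes the final inequality
          strict.\<close>
        define \<delta> where "\<delta> = \<epsilon> / (2 * (\<bar>a\<bar> + \<bar>b\<bar> + 1))"
        have \<delta>: "0 < \<delta>" using e by (simp add: \<delta>_def add_nonneg_pos)
        obtain g g' where g: "g \<in> V" "nrm (\<lambda>x. u x - G g x) < \<delta>" and g': "g' \<in> V" "nrm (\<lambda>x. v x - G g' x) < \<delta>"
          using u v \<delta> unfolding M_def by blast
        let ?c = "\<lambda>x. a * g x + b * g' x"
        let ?n = "\<lambda>x. (a * G g x + b * G g' x) - G ?c x"
        let ?p = "\<lambda>x. a * (u x - G g x)" and ?q = "\<lambda>x. b * (v x - G g' x)"
        have mems: "?p \<in> V" "?q \<in> V" "?n \<in> V" "(\<lambda>x. u x - G g x) \<in> V" "(\<lambda>x. v x - G g' x) \<in> V"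
          by (rule scale_mem[OF diff_mem[OF uV G(1)[OF g(1)]]] scale_mem[OF diff_mem[OF vV G(1)[OF g'(1)]]]
                diff_mem[OF lincomb_mem[OF G(1)[OF g(1)] G(1)[OF g'(1)]] G(1)[OF lincomb_mem[OF g(1) g'(1)]]]
                diff_mem[OF uV G(1)[OF g(1)]] diff_mem[OF vV G(1)[OF g'(1)]])+
        have "nrm (\<lambda>x. (a * u x + b * v x) - G ?c x) = nrm (\<lambda>x. (?p x + ?q x) + ?n x)"
          by (simp add: algebra_simps)
        also have "\<dots> \<le> nrm (\<lambda>x. ?p x + ?q x) + nrm ?n" by (rule nrm_triangle) (use mems add_mem in auto)
        also have "nrm (\<lambda>x. ?p x + ?q x) \<le> nrm ?p + nrm ?q" by (rule nrm_triangle) (use mems in auto)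
        also have "nrm ?n = 0" by (rule null[OF g(1) g'(1)])
        also have "nrm ?p = \<bar>a\<bar> * nrm (\<lambda>x. u x - G g x)" by (rule nrm_scale[OF mems(4)])
        also have "nrm ?q = \<bar>b\<bar> * nrm (\<lambda>x. v x - G g' x)" by (rule nrm_scale[OF mems(5)])
        also have "\<bar>a\<bar> * nrm (\<lambda>x. u x - G g x) + \<bar>b\<bar> * nrm (\<lambda>x. v x - G g' x) + 0 \<le> \<bar>a\<bar> * \<delta> + \<bar>b\<bar> * \<delta> + 0"
          using g(2) g'(2) by (intro add_mono mult_left_mono) auto
        also have "\<dots> \<le> (\<bar>a\<bar> + \<bar>b\<bar> + 1) * \<delta>" using \<delta> by (simp add: algebra_simps)
        also have "\<dots> = \<epsilon> / 2" unfolding \<delta>_def by (simp add: field_simps)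
        also have "\<dots> < \<epsilon>" using e by simp
        finally have "nrm (\<lambda>x. (a * u x + b * v x) - G ?c x) < \<epsilon>" by simp
        moreover have "?c \<in> V" using g g' by (simp add: lincomb_mem)
        ultimately show ?thesis by blast
      qed
      then show ?thesis using uV vV by (simp add: M_def lincomb_mem)
    qed
    fix s l assume s: "\<And>n::nat. s n \<in> M" and l: "l \<in> V"
      and lim: "(\<lambda>n. ip (\<lambda>x. s n x - l x) (\<lambda>x. s n x - l x)) \<longlonglongrightarrow> 0"
    have sV: "s n \<in> V" for n using s MV by blast
    have lim': "(\<lambda>n. nrm (\<lambda>x. s n x - l x)) \<longlonglongrightarrow> 0" unfolding nrm_def using tendsto_real_sqrt[OF lim] by simp
    have "\<exists>g\<in>V. nrm (\<lambda>x. l x - G g x) < \<epsilon>" if e: "0 < \<epsilon>" for \<epsilon>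
    proof -
      obtain n where "\<forall>m\<ge>n. norm (nrm (\<lambda>x. s m x - l x) - 0) < \<epsilon> / 2"
        using LIMSEQ_D[OF lim', of "\<epsilon> / 2"] e by auto
      then have n: "nrm (\<lambda>x. s n x - l x) < \<epsilon> / 2" using nrm_nonneg by auto
      obtain g where g: "g \<in> V" "nrm (\<lambda>x. s n x - G g x) < \<epsilon> / 2"
        using s[of n] e unfolding M_def by (auto dest: spec[of _ "\<epsilon> / 2"])
      have mems: "(\<lambda>x. s n x - l x) \<in> V" "(\<lambda>x. s n x - G g x) \<in> V" using sV[of n] l g(1) by (auto intro: diff_mem G)
      have "nrm (\<lambda>x. l x - G g x) = nrm (\<lambda>x. (-1) * (s n x - l x) + (s n x - G g x))" by simp
      also have "\<dots> \<le> nrm (\<lambda>x. (-1) * (s n x - l x)) + nrm (\<lambda>x. s n x - G g x)"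
        by (rule nrm_triangle[OF scale_mem[OF mems(1)] mems(2)])
      also have "nrm (\<lambda>x. (-1) * (s n x - l x)) = \<bar>-1\<bar> * nrm (\<lambda>x. s n x - l x)" by (rule nrm_scale[OF mems(1)])
      finally have "nrm (\<lambda>x. l x - G g x) < \<epsilon>" using n g(2) by simp
      with g(1) show ?thesis by blast
    qed
    then show "l \<in> M" using l by (simp add: M_def)
  qed
  obtain m where m: "m \<in> M" "\<And>g. g \<in> M \<Longrightarrow> ip (\<lambda>x. r x - m x) g = 0"
    using projection[OF MV HM r] by blast
  let ?d = "\<lambda>x. r x - m x"
  have mV: "m \<in> V" and d: "?d \<in> V" using m MV r by (auto intro: diff_mem)
  have GM: "G g \<in> M" if "g \<in> V" for g
  proof -
    have "nrm (\<lambda>x. G g x - G g x) = 0" using ip_zero[OF zero_mem] by (simp add: nrm_def)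
    then show ?thesis using that G(1)[OF that] unfolding M_def by (auto intro!: bexI[of _ g])
  qed
  have dker: "?d \<in> ker"
    unfolding ker_def
  proof (intro CollectI conjI ballI d)
    fix v assume v: "v \<in> V"
    have "A ?d v = - ip (G v) ?d" using A_skew[OF d v] G(2)[OF v d] by simp
    then show "A ?d v = 0" using m(2)[OF GM[OF v]] by (simp add: ip_commute[of "G v"])
  qed
  have "ip ?d ?d = ip r ?d - ip m ?d" using r mV d by (subst ip_diff) auto
  also have "ip r ?d = 0" by (rule orth[OF dker])
  also have "ip m ?d = 0" using m(2)[OF m(1)] by (simp add: ip_commute[of m])
  finally have nd: "nrm ?d = 0" by (simp add: nrm_def)
  obtain g where g: "g \<in> V" "nrm (\<lambda>x. m x - G g x) < \<epsilon>" using m(1) \<epsilon> unfolding M_def by blast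
  have "nrm (\<lambda>x. r x - G g x) = nrm (\<lambda>x. ?d x + (m x - G g x))" by simp
  also have "\<dots> \<le> nrm ?d + nrm (\<lambda>x. m x - G g x)"
    by (rule nrm_triangle[OF d]) (use mV g in \<open>auto intro: diff_mem G\<close>)
  finally have "nrm (\<lambda>x. r x - G g x) < \<epsilon>" using g nd by simp
  with g(1) show ?thesis by blast
qed

text \<open>A kernel vector w solves the equation with data w for every \<alpha>, so it can be split
  off from both sides.\<close>

lemma solves_minus_ker:
  assumes "solves \<alpha> h \<phi>" "w \<in> ker"
  shows "solves \<alpha> (\<lambda>x. h x - w x) (\<lambda>x. \<phi> x - w x)"
  using assms unfolding solves_def ker_def
  by (auto simp: mem ip_diff A_diff)

text \<open>Let y = \<phi> - w and let G g approximate r = h - w up to \<rho>. Since (1 - \<alpha>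
  G) (g/\<alpha>) = g/\<alpha> - G g, the vector y + g/\<alpha> solves the equation with data \<rho>
  + g/\<alpha>. The contraction bound then gives |y| \<le> |\<rho>| + 2 |g| / |\<alpha>|. A general
  filter covers both signs of infinity.\<close>

lemma solves_tendsto_inf:
  assumes sol: "\<And>\<alpha>. solves \<alpha> h (\<phi> \<alpha>)"
    and w: "w \<in> ker" "\<And>k. k \<in> ker \<Longrightarrow> ip (\<lambda>x. h x - w x) k = 0"
    and F: "filterlim (\<lambda>\<alpha>. \<bar>\<alpha>\<bar>) at_top F"
  shows "((\<lambda>\<alpha>. ip (\<phi> \<alpha>) (\<phi> \<alpha>)) \<longlongrightarrow> ip w w) F"
proof -
  have m: "h \<in> V" "\<phi> \<alpha> \<in> V" "w \<in> V" for \<alpha> using sol w(1) by (auto simp: solves_def ker_def)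
  let ?r = "\<lambda>x. h x - w x"
  have r: "?r \<in> V" using m by (simp add: mem)
  have "((\<lambda>\<alpha>. nrm (\<phi> \<alpha>) - nrm w) \<longlongrightarrow> 0) F"
  proof (rule tendstoI)
    fix \<epsilon> :: real assume \<epsilon>: "0 < \<epsilon>"
    obtain g where g: "g \<in> V" "nrm (\<lambda>x. ?r x - G g x) < \<epsilon> / 2"
      using range_G_dense[OF r w(2), of "\<epsilon> / 2"] \<epsilon> by auto
    \<comment> \<open>This threshold makes 2 |g| / |\<alpha>| less than \<epsilon>/2; the added 1
      keeps it positive, which excludes \<alpha> = 0.\<close>
    have "\<forall>\<^sub>F \<alpha> in F. 4 * (nrm g + 1) / \<epsilon> < \<bar>\<alpha>\<bar>"
      using F by (simp add: filterlim_at_top_dense)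
    then show "\<forall>\<^sub>F \<alpha> in F. dist (nrm (\<phi> \<alpha>) - nrm w) 0 < \<epsilon>"
    proof eventually_elim
      case (elim \<alpha>)
      have "0 < 4 * (nrm g + 1) / \<epsilon>" using \<epsilon> nrm_nonneg[of g] by (intro divide_pos_pos mult_pos_pos) auto
      then have \<alpha>: "0 < \<bar>\<alpha>\<bar>" using elim by linarith
      then have \<alpha>0: "\<alpha> \<noteq> 0" by simp
      have small: "2 * (\<bar>inverse \<alpha>\<bar> * nrm g) < \<epsilon> / 2"
      proof -
        have "4 * (nrm g + 1) < \<epsilon> * \<bar>\<alpha>\<bar>" using elim \<epsilon> by (simp add: field_simps)
        then have "4 * nrm g < \<epsilon> * \<bar>\<alpha>\<bar>" by simp
        then show ?thesis using \<alpha> by (simp add: field_simps)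
      qed
      let ?y = "\<lambda>x. \<phi> \<alpha> x - w x"
      let ?ag = "\<lambda>x. inverse \<alpha> * g x"
      let ?\<rho> = "\<lambda>x. ?r x - G g x"
      have mems: "?y \<in> V" "?ag \<in> V" "?\<rho> \<in> V" using m r g(1) by (auto intro: diff_mem scale_mem G)
      have "solves \<alpha> (\<lambda>x. ?\<rho> x + ?ag x) (\<lambda>x. ?y x + ?ag x)"
        unfolding solves_def
      proof (intro conjI ballI add_mem mems)
        fix v assume v: "v \<in> V"
        have "ip ?y v - \<alpha> * A ?y v = ip ?r v"
          using solves_minus_ker[OF sol w(1), of \<alpha>] v by (simp add: solves_def)
        moreover have "ip ?\<rho> v = ip ?r v - A g v" using r g(1) v by (simp add: ip_diff[OF r G(1)] G)
        moreover have "\<alpha> * A ?ag v = A g v" using \<alpha>0 g(1) v by (simp add: A_scale)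
        ultimately show "ip (\<lambda>x. ?y x + ?ag x) v - \<alpha> * A (\<lambda>x. ?y x + ?ag x) v = ip (\<lambda>x. ?\<rho> x + ?ag x) v"
          unfolding ip_add[OF mems(1,2) v] A_add[OF mems(1,2) v] ip_add[OF mems(3,2) v] by (simp add: algebra_simps)
      qed
      then have "nrm (\<lambda>x. ?y x + ?ag x) \<le> nrm (\<lambda>x. ?\<rho> x + ?ag x)" by (rule solves_norm)
      also have "\<dots> \<le> nrm ?\<rho> + nrm ?ag" by (rule nrm_triangle[OF mems(3,2)])
      finally have 1: "nrm (\<lambda>x. ?y x + ?ag x) \<le> nrm ?\<rho> + nrm ?ag" .
      have "nrm ?y = nrm (\<lambda>x. (?y x + ?ag x) + (-1) * ?ag x)" by simp
      also have "\<dots> \<le> nrm (\<lambda>x. ?y x + ?ag x) + nrm (\<lambda>x. (-1) * ?ag x)"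
        by (rule nrm_triangle[OF add_mem[OF mems(1,2)] scale_mem[OF mems(2)]])
      also have "nrm (\<lambda>x. (-1) * ?ag x) = \<bar>-1\<bar> * nrm ?ag" by (rule nrm_scale[OF mems(2)])
      finally have "nrm ?y \<le> nrm ?\<rho> + 2 * nrm ?ag" using 1 by simp
      also have "nrm ?ag = \<bar>inverse \<alpha>\<bar> * nrm g" by (rule nrm_scale[OF g(1)])
      finally have "nrm ?y < \<epsilon>" using g(2) small by simp
      then show ?case using nrm_diff_triangle[OF m(2,3), of \<alpha>] by simp
    qed
  qed
  then have "((\<lambda>\<alpha>. nrm (\<phi> \<alpha>)) \<longlongrightarrow> nrm w) F" by (simp add: LIM_zero_iff)
  from tendsto_power[OF this, of 2] show ?thesis by (simp add: nrm_sq)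
qed

end

subsection \<open>Complexification and Parseval's identity\<close>

context semi_inner
begin

text \<open>The abstract counterpart of \<open>cinner_1\<close>, with the same convention of
  linearity in the first argument.\<close>

definition cip :: "('x \<Rightarrow> complex) \<Rightarrow> ('x \<Rightarrow> complex) \<Rightarrow> complex" where
  "cip f g = Complex
     (ip (\<lambda>x. Re (f x)) (\<lambda>x. Re (g x)) + ip (\<lambda>x. Im (f x)) (\<lambda>x. Im (g x)))
     (ip (\<lambda>x. Im (f x)) (\<lambda>x. Re (g x)) - ip (\<lambda>x. Re (f x)) (\<lambda>x. Im (g x)))"

abbreviation "CV \<equiv> cplx_space V"

lemma CV_iff: "f \<in> CV \<longleftrightarrow> (\<lambda>x. Re (f x)) \<in> V \<and> (\<lambda>x. Im (f x)) \<in> V"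
  by (simp add: cplx_space_def)

lemma CV_add: "f \<in> CV \<Longrightarrow> g \<in> CV \<Longrightarrow> (\<lambda>x. f x + g x) \<in> CV"
  and CV_diff: "f \<in> CV \<Longrightarrow> g \<in> CV \<Longrightarrow> (\<lambda>x. f x - g x) \<in> CV"
  by (auto simp: CV_iff mem)

lemma CV_scale: "f \<in> CV \<Longrightarrow> (\<lambda>x. c * f x) \<in> CV"
  using lincomb_mem[of "\<lambda>x. Re (f x)" "\<lambda>x. Im (f x)" "Re c" "- Im c"]
    lincomb_mem[of "\<lambda>x. Im (f x)" "\<lambda>x. Re (f x)" "Re c" "Im c"]
  by (simp add: CV_iff)

lemma CV_sum: "(\<And>n. n \<in> J \<Longrightarrow> e n \<in> CV) \<Longrightarrow> (\<lambda>x. \<Sum>n\<in>J. c n * e n x) \<in> CV"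
proof (induction J rule: infinite_finite_induct)
  case (insert n J)
  have "(\<lambda>x. c n * e n x + (\<Sum>n\<in>J. c n * e n x)) \<in> CV"
    using insert by (intro CV_add CV_scale) auto
  then show ?case using insert by simp
qed (auto simp: CV_iff zero_mem)

lemma cip_add: "f \<in> CV \<Longrightarrow> g \<in> CV \<Longrightarrow> h \<in> CV \<Longrightarrow> cip (\<lambda>x. f x + g x) h = cip f h + cip g h"
  and cip_diff: "f \<in> CV \<Longrightarrow> g \<in> CV \<Longrightarrow> h \<in> CV \<Longrightarrow> cip (\<lambda>x. f x - g x) h = cip f h - cip g h"
  by (simp_all add: cip_def CV_iff ip_simps complex_eq_iff)

lemma cip_scale: "f \<in> CV \<Longrightarrow> h \<in> CV \<Longrightarrow> cip (\<lambda>x. c * f x) h = c * cip f h"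
  by (simp add: cip_def CV_iff ip_simps scale_mem complex_eq_iff algebra_simps)

lemma cip_cnj: "cip f g = cnj (cip g f)"
  by (simp add: cip_def complex_eq_iff ip_commute)

lemma cip_sum: "(\<And>n. n \<in> J \<Longrightarrow> e n \<in> CV) \<Longrightarrow> h \<in> CV \<Longrightarrow> cip (\<lambda>x. \<Sum>n\<in>J. c n * e n x) h = (\<Sum>n\<in>J. c n * cip (e n) h)"
proof (induction J rule: infinite_finite_induct)
  case (insert n J)
  have "cip (\<lambda>x. c n * e n x + (\<Sum>n\<in>J. c n * e n x)) h = cip (\<lambda>x. c n * e n x) h + cip (\<lambda>x. \<Sum>n\<in>J. c n * e n x) h"
    using insert by (intro cip_add CV_scale CV_sum) auto
  also have "\<dots> = c n * cip (e n) h + (\<Sum>n\<in>J. c n * cip (e n) h)"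
    using insert by (simp add: cip_scale)
  finally show ?case using insert by simp
qed (auto simp: cip_def CV_iff ip_zero complex_eq_iff)

lemma cip_nonneg: "0 \<le> Re (cip f f)"
  by (simp add: cip_def ip_nonneg)

text \<open>Completing the square in each coefficient. The choice of the Fourier coefficients for c
  gives Bessel's inequality; arbitrary c shows that Fourier coefficients approximate best.\<close>

lemma Bessel_identity:
  assumes J: "finite J" and e: "\<And>n. n \<in> J \<Longrightarrow> e n \<in> CV" and f: "f \<in> CV"
    and on: "\<And>m n. m \<in> J \<Longrightarrow> n \<in> J \<Longrightarrow> cip (e m) (e n) = (if m = n then 1 else 0)"
  shows "Re (cip (\<lambda>x. f x - (\<Sum>n\<in>J. c n * e n x)) (\<lambda>x. f x - (\<Sum>n\<in>J. c n * e n x)))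
    = Re (cip f f) - (\<Sum>n\<in>J. (cmod (cip f (e n)))\<^sup>2) + (\<Sum>n\<in>J. (cmod (cip f (e n) - c n))\<^sup>2)"
proof -
  let ?S = "\<lambda>x. \<Sum>n\<in>J. c n * e n x"
  have S: "?S \<in> CV" using e by (rule CV_sum)
  have d: "(\<lambda>x. f x - ?S x) \<in> CV" using f S by (rule CV_diff)
  have Sf: "cip ?S f = (\<Sum>n\<in>J. c n * cip (e n) f)" by (rule cip_sum[OF e f])
  have Se: "cip ?S (e m) = c m" if m: "m \<in> J" for m
  proof -
    have "cip ?S (e m) = (\<Sum>n\<in>J. c n * cip (e n) (e m))" by (rule cip_sum[OF e e[OF m]])
    also have "\<dots> = (\<Sum>n\<in>J. if n = m then c n else 0)" by (intro sum.cong) (auto simp: on m)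
    finally show ?thesis using J m by simp
  qed
  have SS: "cip ?S ?S = (\<Sum>n\<in>J. c n * cnj (c n))"
  proof -
    have "cip ?S ?S = (\<Sum>n\<in>J. c n * cip (e n) ?S)" by (rule cip_sum[OF e S])
    also have "\<dots> = (\<Sum>n\<in>J. c n * cnj (c n))"
    proof (rule sum.cong[OF refl])
      fix n assume n: "n \<in> J"
      show "c n * cip (e n) ?S = c n * cnj (c n)" unfolding cip_cnj[of "e n" ?S] Se[OF n] ..
    qed
    finally show ?thesis .
  qed
  have "cip (\<lambda>x. f x - ?S x) (\<lambda>x. f x - ?S x) = cip f (\<lambda>x. f x - ?S x) - cip ?S (\<lambda>x. f x - ?S x)"
    by (rule cip_diff[OF f S d])
  also have "cip f (\<lambda>x. f x - ?S x) = cnj (cip f f) - cnj (cip ?S f)"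
    unfolding cip_cnj[of f "\<lambda>x. f x - ?S x"] cip_diff[OF f S f] by simp
  also have "cip ?S (\<lambda>x. f x - ?S x) = cip ?S f - cnj (cip ?S ?S)"
    unfolding cip_cnj[of ?S "\<lambda>x. f x - ?S x"] cip_diff[OF f S S] by (simp add: cip_cnj[of f])
  finally have "Re (cip (\<lambda>x. f x - ?S x) (\<lambda>x. f x - ?S x)) = Re (cip f f) - 2 * Re (cip ?S f) + Re (cip ?S ?S)"
    by simp
  also have "\<dots> = Re (cip f f) - (\<Sum>n\<in>J. 2 * Re (c n * cip (e n) f)) + (\<Sum>n\<in>J. Re (c n * cnj (c n)))"
    unfolding Sf SS by (simp add: sum_distrib_left)
  also have "\<dots> = Re (cip f f) + (\<Sum>n\<in>J. Re (c n * cnj (c n)) - 2 * Re (c n * cip (e n) f))"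
    by (simp add: sum_subtractf)
  also have "(\<Sum>n\<in>J. Re (c n * cnj (c n)) - 2 * Re (c n * cip (e n) f)) = (\<Sum>n\<in>J. (cmod (cip f (e n) - c n))\<^sup>2 - (cmod (cip f (e n)))\<^sup>2)"
  proof (rule sum.cong[OF refl])
    fix n
    show "Re (c n * cnj (c n)) - 2 * Re (c n * cip (e n) f) = (cmod (cip f (e n) - c n))\<^sup>2 - (cmod (cip f (e n)))\<^sup>2"
      unfolding cip_cnj[of "e n" f] cmod_power2 by (simp add: power2_eq_square algebra_simps)
  qed
  finally show ?thesis by (simp add: sum_subtractf)
qed

text \<open>Finite partial sums never exceed the squared norm, by Bessel. Conversely any good
  approximation by a finite combination forces the partial sum over its index set, and over any
  larger one, to be close. The index set is arbitrary, so finite and infinite bases are treated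
  together.\<close>

lemma Parseval:
  assumes e: "\<And>n. n \<in> I \<Longrightarrow> e n \<in> CV" and f: "f \<in> CV"
    and on: "\<And>m n. m \<in> I \<Longrightarrow> n \<in> I \<Longrightarrow> cip (e m) (e n) = (if m = n then 1 else 0)"
    and dense: "\<And>\<epsilon>. 0 < \<epsilon> \<Longrightarrow> \<exists>J c. finite J \<and> J \<subseteq> I \<and>
        sqrt (Re (cip (\<lambda>x. f x - (\<Sum>n\<in>J. c n * e n x)) (\<lambda>x. f x - (\<Sum>n\<in>J. c n * e n x)))) < \<epsilon>"
  shows "((\<lambda>n. (cmod (cip f (e n)))\<^sup>2) has_sum Re (cip f f)) I"
  unfolding has_sum_def
proof (rule tendstoI)
  fix \<epsilon> :: real assume \<epsilon>: "0 < \<epsilon>"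
  have id: "Re (cip (\<lambda>x. f x - (\<Sum>n\<in>J. c n * e n x)) (\<lambda>x. f x - (\<Sum>n\<in>J. c n * e n x)))
    = Re (cip f f) - (\<Sum>n\<in>J. (cmod (cip f (e n)))\<^sup>2) + (\<Sum>n\<in>J. (cmod (cip f (e n) - c n))\<^sup>2)"
    if "finite J" "J \<subseteq> I" for J c
  proof (rule Bessel_identity[OF that(1) _ f])
    show "e n \<in> CV" if "n \<in> J" for n using e \<open>J \<subseteq> I\<close> that by blast
    show "cip (e m) (e n) = (if m = n then 1 else 0)" if "m \<in> J" "n \<in> J" for m n
      by (rule on) (use \<open>J \<subseteq> I\<close> that in blast)+
  qed
  have upper: "(\<Sum>n\<in>J. (cmod (cip f (e n)))\<^sup>2) \<le> Re (cip f f)" if "finite J" "J \<subseteq> I" for J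
    using id[OF that, of "\<lambda>n. cip f (e n)"] cip_nonneg[of "\<lambda>x. f x - (\<Sum>n\<in>J. cip f (e n) * e n x)"] by simp
  \<comment> \<open>The square root of \<epsilon> appears because the approximation is measured in
    the norm and the sum in its square.\<close>
  obtain J c where J: "finite J" "J \<subseteq> I" and lt: "sqrt (Re (cip (\<lambda>x. f x - (\<Sum>n\<in>J. c n * e n x)) (\<lambda>x. f x - (\<Sum>n\<in>J. c n * e n x)))) < sqrt \<epsilon>"
    using dense[of "sqrt \<epsilon>"] \<epsilon> by auto
  have "Re (cip f f) - (\<Sum>n\<in>J. (cmod (cip f (e n)))\<^sup>2) < \<epsilon>"
    using lt id[OF J, of c] sum_nonneg[of J "\<lambda>n. (cmod (cip f (e n) - c n))\<^sup>2"] by simp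
  then have close: "dist (\<Sum>n\<in>J'. (cmod (cip f (e n)))\<^sup>2) (Re (cip f f)) < \<epsilon>" if "finite J'" "J \<subseteq> J'" "J' \<subseteq> I" for J'
    using upper[OF that(1,3)] sum_mono2[OF that(1,2), of "\<lambda>n. (cmod (cip f (e n)))\<^sup>2"] by (simp add: dist_real_def)
  show "\<forall>\<^sub>F J in finite_subsets_at_top I. dist (\<Sum>n\<in>J. (cmod (cip f (e n)))\<^sup>2) (Re (cip f f)) < \<epsilon>"
    unfolding eventually_finite_subsets_at_top using J close by blast
qed

end

text \<open>Parseval is applied to y = \<phi> - w, the part of the solution orthogonal to the
  kernel; its squared norm is the difference on the right by Pythagoras. The hypotheses
  \<open>eigen\<close> are the real and imaginary parts of G e = \<i> l e, paired with
  \<open>v\<close>.\<close>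

lemma (in hilbert_skew) spectral_expansion:
  assumes sol: "solves \<alpha> h \<phi>"
    and w: "w \<in> ker" "\<And>k. k \<in> ker \<Longrightarrow> ip (\<lambda>x. h x - w x) k = 0"
    and e: "\<And>n. n \<in> I \<Longrightarrow> e n \<in> CV" "\<And>n k. n \<in> I \<Longrightarrow> k \<in> cplx_space ker \<Longrightarrow> cip (e n) k = 0"
    and on: "\<And>m n. m \<in> I \<Longrightarrow> n \<in> I \<Longrightarrow> cip (e m) (e n) = (if m = n then 1 else 0)"
    and dense: "\<And>g \<epsilon>. g \<in> CV \<Longrightarrow> (\<And>k. k \<in> cplx_space ker \<Longrightarrow> cip g k = 0) \<Longrightarrow> 0 < \<epsilon> \<Longrightarrow> \<exists>J c. finite J \<and> J \<subseteq> I \<and>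
        sqrt (Re (cip (\<lambda>x. g x - (\<Sum>n\<in>J. c n * e n x)) (\<lambda>x. g x - (\<Sum>n\<in>J. c n * e n x)))) < \<epsilon>"
    and eigen: "\<And>n v. n \<in> I \<Longrightarrow> v \<in> V \<Longrightarrow> A (\<lambda>x. Re (e n x)) v = - (l n * ip (\<lambda>x. Im (e n x)) v)"
      "\<And>n v. n \<in> I \<Longrightarrow> v \<in> V \<Longrightarrow> A (\<lambda>x. Im (e n x)) v = l n * ip (\<lambda>x. Re (e n x)) v"
  shows "((\<lambda>n. (cmod (cip (\<lambda>x. complex_of_real (h x)) (e n)))\<^sup>2 / (1 + \<alpha>\<^sup>2 * (l n)\<^sup>2)) has_sum (ip \<phi> \<phi> - ip w w)) I"
proof -
  have m: "h \<in> V" "\<phi> \<in> V" "w \<in> V" and eq: "\<And>v. v \<in> V \<Longrightarrow> ip \<phi> v - \<alpha> * A \<phi> v = ip h v"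
    using sol w(1) by (auto simp: solves_def ker_def)
  have Aw: "A w v = 0" if "v \<in> V" for v using w(1) that by (simp add: ker_def)
  let ?y = "\<lambda>x. \<phi> x - w x"
  let ?Y = "\<lambda>x. complex_of_real (?y x)"
  have y: "?y \<in> V" using m by (simp add: mem)
  have Y: "?Y \<in> CV" using y zero_mem by (simp add: CV_iff)
  have yk: "ip ?y k = 0" if k: "k \<in> ker" for k
  proof -
    have kV: "k \<in> V" using k by (simp add: ker_def)
    have "A \<phi> k = 0" using A_skew[OF m(2) kV] k m(2) by (simp add: ker_def)
    then have "ip \<phi> k = ip h k" using eq[OF kV] by simp
    then show ?thesis using w(2)[OF k] m kV by (simp add: ip_diff)
  qed
  have Yk: "cip ?Y k = 0" if "k \<in> cplx_space ker" for k
    using that yk by (auto simp: cplx_space_def cip_def complex_eq_iff ker_def ip_zero)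
  have ps: "((\<lambda>n. (cmod (cip ?Y (e n)))\<^sup>2) has_sum Re (cip ?Y ?Y)) I"
    by (rule Parseval[OF e(1) Y on dense[OF Y Yk]])
  have "Re (cip ?Y ?Y) = ip ?y ?y" by (simp add: cip_def ip_zero zero_mem)
  also have "\<dots> = ip \<phi> \<phi> - ip w w"
    using yk[OF w(1)] m by (simp add: ip_simps mem ip_commute[of w \<phi>])
  finally have norm: "Re (cip ?Y ?Y) = ip \<phi> \<phi> - ip w w" .
  have "(cmod (cip ?Y (e n)))\<^sup>2 = (cmod (cip (\<lambda>x. complex_of_real (h x)) (e n)))\<^sup>2 / (1 + \<alpha>\<^sup>2 * (l n)\<^sup>2)" if n: "n \<in> I" for n
  proof -
    let ?r = "\<lambda>x. Re (e n x)" and ?i = "\<lambda>x. Im (e n x)"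
    have ri: "?r \<in> V" "?i \<in> V" using e(1)[OF n] by (auto simp: CV_iff)
    have "(\<lambda>x. 0) \<in> ker" using w(1) A_scale[OF zero_mem, of _ 0] zero_mem by (auto simp: ker_def)
    then have "(\<lambda>x. complex_of_real (w x)) \<in> cplx_space ker" using w(1) by (simp add: cplx_space_def)
    from e(2)[OF n this] have rw: "ip w ?r = 0" "ip w ?i = 0"
      using ri by (auto simp: cip_def complex_eq_iff ip_zero ip_commute[of w])
    \<comment> \<open>Testing with the two parts of the eigenvector gives a real 2 by 2 system, a
      rotation composed with a dilation: it multiplies the sum of squares by 1 + \<alpha>^2 l^2.
      This is division by 1 - \<i> \<alpha> l in real form.\<close>
    have 1: "ip \<phi> ?r - \<alpha> * l n * ip \<phi> ?i = ip h ?r"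
      using eq[OF ri(1)] A_skew[OF m(2) ri(1)] eigen(1)[OF n m(2)] by (simp add: ip_commute[of ?i])
    have 2: "ip \<phi> ?i + \<alpha> * l n * ip \<phi> ?r = ip h ?i"
      using eq[OF ri(2)] A_skew[OF m(2) ri(2)] eigen(2)[OF n m(2)] by (simp add: ip_commute[of ?r])
    have Yr: "(cmod (cip ?Y (e n)))\<^sup>2 = (ip \<phi> ?r)\<^sup>2 + (ip \<phi> ?i)\<^sup>2"
      using ri m rw by (simp add: cmod_power2 cip_def ip_zero ip_diff)
    have "(cmod (cip (\<lambda>x. complex_of_real (h x)) (e n)))\<^sup>2 = (ip h ?r)\<^sup>2 + (ip h ?i)\<^sup>2"
      using ri m by (simp add: cmod_power2 cip_def ip_zero)
    also have "\<dots> = (1 + \<alpha>\<^sup>2 * (l n)\<^sup>2) * (cmod (cip ?Y (e n)))\<^sup>2"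
      unfolding Yr 1[symmetric] 2[symmetric] by (simp add: power2_eq_square algebra_simps)
    moreover have "1 + \<alpha>\<^sup>2 * (l n)\<^sup>2 > 0" by (intro add_pos_nonneg) auto
    ultimately show ?thesis by simp
  qed
  then show ?thesis using ps unfolding norm by (simp cong: has_sum_cong)
qed

subsection \<open>The perturbed diffusion\<close>

text \<open>The Lyapunov hypothesis enters from here on only through the Poincare constant
  \<open>C\<close>, and the boundedness of \<gamma> through \<open>D\<close>.\<close>

locale drift = weight p for p :: "'a::euclidean_space \<Rightarrow> real" +
  fixes \<gamma> :: "'a \<Rightarrow> 'a" and D C :: real
  assumes smooth_\<gamma>: "smooth \<gamma>" and bound_\<gamma>: "\<And>x. norm (\<gamma> x) \<le> D"
    and div_free: "\<And>x. divergence (\<lambda>y. p y *\<^sub>R \<gamma> y) x = 0"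
    and C_nonneg: "0 \<le> C"
    and Poincare_ineq: "\<And>u g. weak_gradient u g \<Longrightarrow> L2 u \<Longrightarrow> L2 g \<Longrightarrow> (\<integral>x. u x \<partial>pmeas p) = 0 \<Longrightarrow>
      (\<integral>x. (u x)\<^sup>2 \<partial>pmeas p) \<le> C * (\<integral>x. (norm (g x))\<^sup>2 \<partial>pmeas p)"
begin

lemma \<gamma>_measurable[measurable]: "\<gamma> \<in> borel_measurable borel"
  by (rule smooth_measurable[OF smooth_\<gamma>])

lemma Poincare_H1: "u \<in> H1 p \<Longrightarrow> (\<integral>x. (u x)\<^sup>2 \<partial>pmeas p) \<le> C * inner_1 p u u"
  unfolding inner_1_self using Poincare_ineq[OF H1_wgrad(1,3,2)] H1_wgrad(4) by (simp add: L20_iff)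

lemma H1_diff:
  assumes "f \<in> H1 p" "g \<in> H1 p"
  shows "(\<lambda>x. f x - g x) \<in> H1 p" "AE x in pmeas p. wgrad (\<lambda>x. f x - g x) x = wgrad f x - wgrad g x"
  using H1_lincomb[OF assms, of 1 "-1"] by simp_all

lemma inner_1_diff_self:
  assumes "f \<in> H1 p" "weak_gradient g k" "g \<in> H1 p"
  shows "inner_1 p (\<lambda>x. f x - g x) (\<lambda>x. f x - g x) = (\<integral>x. (norm (wgrad f x - k x))\<^sup>2 \<partial>pmeas p)"
proof -
  note [measurable] = wgrad_measurable[OF assms(1)] wgrad_measurable[OF H1_diff(1)[OF assms(1,3)]] weak_gradientD(4)[OF assms(2)]
  show ?thesis
    unfolding inner_1_self
  proof (rule integral_cong_AE)
    show "AE x in pmeas p. (norm (wgrad (\<lambda>x. f x - g x) x))\<^sup>2 = (norm (wgrad f x - k x))\<^sup>2"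
      using H1_diff(2)[OF assms(1,3)] wgrad_AE[OF assms(2,3)] by eventually_elim simp
  qed measurable
qed

text \<open>A Cauchy sequence has converging gradients by the very definition of the form, and
  converging functions by the Poincare inequality. Closedness of the weak gradient matches the two
  limits, and the mean 0 survives since constants are in L2.\<close>

lemma hilbert_H1: "hilbert (H1 p) (inner_1 p)"
proof
  show "(\<lambda>x. 0) \<in> H1 p" by (rule H1_zero)
  show "(\<lambda>x. a * u x + b * v x) \<in> H1 p" if "u \<in> H1 p" "v \<in> H1 p" for u v a b
    by (rule H1_lincomb(1)[OF that])
  show "inner_1 p (\<lambda>x. a * u x + b * v x) w = a * inner_1 p u w + b * inner_1 p v w"
    if "u \<in> H1 p" "v \<in> H1 p" "w \<in> H1 p" for u v w a b
    by (rule inner_1_lincomb[OF that])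
  show "inner_1 p u v = inner_1 p v u" for u v by (rule inner_1_commute)
  show "0 \<le> inner_1 p u u" for u by (simp add: inner_1_self)
  fix s assume s: "\<And>n::nat. s n \<in> H1 p"
    and Cauchy: "\<And>\<epsilon>. 0 < \<epsilon> \<Longrightarrow> \<exists>N. \<forall>m\<ge>N. \<forall>n\<ge>N. inner_1 p (\<lambda>x. s m x - s n x) (\<lambda>x. s m x - s n x) < \<epsilon>"
  have gd: "inner_1 p (\<lambda>x. s m x - s n x) (\<lambda>x. s m x - s n x) = (\<integral>x. (norm (wgrad (s m) x - wgrad (s n) x))\<^sup>2 \<partial>pmeas p)" for m n
    by (rule inner_1_diff_self[OF s H1_wgrad(1)[OF s] s])
  have "\<exists>k. L2 k \<and> (\<lambda>n. \<integral>x. (norm (wgrad (s n) x - k x))\<^sup>2 \<partial>pmeas p) \<longlonglongrightarrow> 0"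
    using Cauchy unfolding gd by (intro L2_complete H1_wgrad(2)[OF s])
  then obtain k where k: "L2 k" "(\<lambda>n. \<integral>x. (norm (wgrad (s n) x - k x))\<^sup>2 \<partial>pmeas p) \<longlonglongrightarrow> 0" by blast
  have "\<exists>l. L2 l \<and> (\<lambda>n. \<integral>x. (norm (s n x - l x))\<^sup>2 \<partial>pmeas p) \<longlonglongrightarrow> 0"
  proof (rule L2_complete[OF H1_wgrad(3)[OF s]])
    fix \<epsilon> :: real assume \<epsilon>: "0 < \<epsilon>"
    \<comment> \<open>The constant \<open>C\<close> may be 0, hence C + 1 in the
      denominator.\<close>
    have "0 < \<epsilon> / (C + 1)" using \<epsilon> C_nonneg by simp
    from Cauchy[OF this] obtain N where N: "\<And>m n. N \<le> m \<Longrightarrow> N \<le> n \<Longrightarrow> inner_1 p (\<lambda>x. s m x - s n x) (\<lambda>x. s m x - s n x) < \<epsilon> / (C + 1)"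
      by blast
    have "(\<integral>x. (norm (s m x - s n x))\<^sup>2 \<partial>pmeas p) < \<epsilon>" if mn: "N \<le> m" "N \<le> n" for m n
    proof -
      let ?q = "inner_1 p (\<lambda>x. s m x - s n x) (\<lambda>x. s m x - s n x)"
      have q0: "0 \<le> ?q" by (simp add: inner_1_self)
      have "(\<integral>x. (norm (s m x - s n x))\<^sup>2 \<partial>pmeas p) \<le> C * ?q"
        using Poincare_H1[OF H1_diff(1)[OF s s]] by simp
      also have "\<dots> \<le> (C + 1) * ?q" using q0 by (simp add: algebra_simps)
      also have "\<dots> < (C + 1) * (\<epsilon> / (C + 1))" using N[OF mn] C_nonneg by (intro mult_strict_left_mono) auto
      also have "\<dots> = \<epsilon>" using C_nonneg by simp
      finally show ?thesis .
    qed
    then show "\<exists>N. \<forall>m\<ge>N. \<forall>n\<ge>N. (\<integral>x. (norm (s m x - s n x))\<^sup>2 \<partial>pmeas p) < \<epsilon>" by blast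
  qed
  then obtain l where l: "L2 l" "(\<lambda>n. \<integral>x. (s n x - l x)\<^sup>2 \<partial>pmeas p) \<longlonglongrightarrow> 0" by auto
  have wg: "weak_gradient l k"
    by (rule weak_gradient_closed[OF H1_wgrad(1)[OF s] H1_wgrad(3)[OF s] H1_wgrad(2)[OF s] l(1) k(1) l(2) k(2)])
  have "(\<lambda>n. \<integral>x. s n x * 1 \<partial>pmeas p) \<longlonglongrightarrow> (\<integral>x. l x * 1 \<partial>pmeas p)"
    by (rule L2_tendsto_mult[OF H1_wgrad(3)[OF s] l(1) L2_const l(2)])
  moreover have "(\<integral>x. s n x * 1 \<partial>pmeas p) = 0" for n using H1_wgrad(4)[OF s, of n] by (simp add: L20_iff)
  ultimately have "(\<lambda>n::nat. 0) \<longlonglongrightarrow> (\<integral>x. l x * 1 \<partial>pmeas p)" by (simp only:)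
  then have "(\<integral>x. l x * 1 \<partial>pmeas p) = 0" using LIMSEQ_unique tendsto_const by blast
  then have "l \<in> L20 p" using l(1) by (simp add: L20_iff)
  then have lH: "l \<in> H1 p" using wg k(1) by (rule H1_I)
  have "(\<lambda>n. inner_1 p (\<lambda>x. s n x - l x) (\<lambda>x. s n x - l x)) \<longlonglongrightarrow> 0"
    using k(2) unfolding inner_1_diff_self[OF s wg lH] .
  with lH show "\<exists>l\<in>H1 p. (\<lambda>n. inner_1 p (\<lambda>x. s n x - l x) (\<lambda>x. s n x - l x)) \<longlonglongrightarrow> 0" by blast
qed

lemma inner_p_lincomb:
  assumes "L2 f" "L2 g" "L2 v"
  shows "inner_p p (\<lambda>x. a * f x + b * g x) v = a * inner_p p f v + b * inner_p p g v"
proof -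
  have "inner_p p (\<lambda>x. a * f x + b * g x) v = (\<integral>x. a * (f x * v x) + b * (g x * v x) \<partial>pmeas p)"
    by (simp add: inner_p_def algebra_simps)
  then show ?thesis using L2_integrable_mult[OF assms(1,3)] L2_integrable_mult[OF assms(2,3)] by (simp add: inner_p_def)
qed

lemma inner_p_commute: "inner_p p f g = inner_p p g f"
  by (simp add: inner_p_def mult.commute)

lemma inner_p_cong_AE:
  assumes "AE x in pmeas p. f x = f' x" "f \<in> borel_measurable borel" "f' \<in> borel_measurable borel" "L2 v"
  shows "inner_p p f v = inner_p p f' v"
  unfolding inner_p_def
  by (rule integral_cong_AE) (use assms L2_measurable[OF assms(4)] in \<open>auto simp: measurable_pmeas\<close>)

lemma inner_p_bound:
  assumes "L2 f" "v \<in> H1 p"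
  shows "\<bar>inner_p p f v\<bar> \<le> sqrt (\<integral>x. (f x)\<^sup>2 \<partial>pmeas p) * (sqrt C * sqrt (inner_1 p v v))"
proof -
  have "\<bar>inner_p p f v\<bar> \<le> sqrt (\<integral>x. (f x)\<^sup>2 \<partial>pmeas p) * sqrt (\<integral>x. (v x)\<^sup>2 \<partial>pmeas p)"
    unfolding inner_p_def using assms(1) H1_wgrad(3)[OF assms(2)]
    by (intro Cauchy_Schwarz_integral) (auto simp: L2_real measurable_pmeas)
  also have "\<dots> \<le> sqrt (\<integral>x. (f x)\<^sup>2 \<partial>pmeas p) * (sqrt C * sqrt (inner_1 p v v))"
    unfolding real_sqrt_mult[symmetric, of C] by (intro mult_left_mono real_sqrt_le_mono Poincare_H1 assms) simp
  finally show ?thesis .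
qed

lemma A_op_L2:
  assumes "u \<in> H1 p"
  shows "L2 (A_op \<gamma> u)" "(\<integral>x. (A_op \<gamma> u x)\<^sup>2 \<partial>pmeas p) \<le> D\<^sup>2 * inner_1 p u u"
proof -
  note [measurable] = wgrad_measurable[OF assms]
  have le: "\<bar>A_op \<gamma> u x\<bar> \<le> D * norm (wgrad u x)" for x
    unfolding A_op_def using Cauchy_Schwarz_ineq2[of "\<gamma> x" "wgrad u x"] mult_right_mono[OF bound_\<gamma>[of x] norm_ge_zero[of "wgrad u x"]]
    by linarith
  show L: "L2 (A_op \<gamma> u)"
  proof (rule L2_bound[OF H1_wgrad(2)[OF assms], where C=D])
    show "A_op \<gamma> u \<in> borel_measurable borel" unfolding A_op_def[abs_def] by measurable
  qed (use le in auto)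
  have "(\<integral>x. (A_op \<gamma> u x)\<^sup>2 \<partial>pmeas p) \<le> (\<integral>x. D\<^sup>2 * (norm (wgrad u x))\<^sup>2 \<partial>pmeas p)"
  proof (rule integral_mono)
    show "integrable (pmeas p) (\<lambda>x. (A_op \<gamma> u x)\<^sup>2)" using L by (simp add: L2_real)
    show "integrable (pmeas p) (\<lambda>x. D\<^sup>2 * (norm (wgrad u x))\<^sup>2)" using H1_wgrad(2)[OF assms] by (simp add: L2_def)
    fix x
    have "\<bar>A_op \<gamma> u x\<bar>\<^sup>2 \<le> (D * norm (wgrad u x))\<^sup>2" by (rule power_mono[OF le]) simp
    then show "(A_op \<gamma> u x)\<^sup>2 \<le> D\<^sup>2 * (norm (wgrad u x))\<^sup>2" by (simp add: power_mult_distrib)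
  qed
  then show "(\<integral>x. (A_op \<gamma> u x)\<^sup>2 \<partial>pmeas p) \<le> D\<^sup>2 * inner_1 p u u" by (simp add: inner_1_self)
qed

lemma A_op_diag:
  assumes "weak_gradient u g" "L2 u" "L2 g"
  shows "(\<integral>x. (\<gamma> x \<bullet> g x) * u x \<partial>pmeas p) = 0"
  using drift_antisymmetric_diag[OF assms smooth_\<gamma> bound_\<gamma> div_free] by (simp add: mult.commute)

text \<open>The functions u and u + 1 have the same gradient; subtracting the diagonal identities
  for both isolates the mean of \<gamma> \<bullet> \<nabla>u. For this reason
  \<open>A_op_diag\<close> does not require mean 0.\<close>

lemma A_op_L20:
  assumes u: "u \<in> H1 p"
  shows "A_op \<gamma> u \<in> L20 p"
proof -
  note w = H1_wgrad[OF u]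
  have "weak_gradient (\<lambda>x. u x + 1) (wgrad u)"
    using weak_gradient_lincomb[OF w(1) weak_gradient_const[of 1], of 1 1] by simp
  then have "(\<integral>x. (\<gamma> x \<bullet> wgrad u x) * (u x + 1) \<partial>pmeas p) = 0"
    by (rule A_op_diag[OF _ L2_add[OF w(3) L2_const] w(2)])
  moreover have "(\<integral>x. (\<gamma> x \<bullet> wgrad u x) * u x \<partial>pmeas p) = 0" by (rule A_op_diag[OF w(1,3,2)])
  moreover have "integrable (pmeas p) (\<lambda>x. (\<gamma> x \<bullet> wgrad u x) * u x)" "integrable (pmeas p) (\<lambda>x. \<gamma> x \<bullet> wgrad u x)"
    using L2_integrable_mult[OF A_op_L2(1)[OF u] w(3)] L2_integrable[OF A_op_L2(1)[OF u]] by (simp_all add: A_op_def[abs_def])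
  ultimately have "(\<integral>x. A_op \<gamma> u x \<partial>pmeas p) = 0" by (simp add: distrib_left A_op_def)
  then show ?thesis using A_op_L2(1)[OF u] by (simp add: L20_iff)
qed

lemma A_op_lincomb:
  assumes "u \<in> H1 p" "v \<in> H1 p"
  shows "AE x in pmeas p. A_op \<gamma> (\<lambda>x. a * u x + b * v x) x = a * A_op \<gamma> u x + b * A_op \<gamma> v x"
  using H1_lincomb(2)[OF assms, of a b] by eventually_elim (simp add: A_op_def inner_simps)

lemma inner_p_A_op_lincomb:
  assumes u: "u \<in> H1 p" and v: "v \<in> H1 p" and w: "w \<in> H1 p"
  shows "inner_p p (A_op \<gamma> (\<lambda>x. a * u x + b * v x)) w = a * inner_p p (A_op \<gamma> u) w + b * inner_p p (A_op \<gamma> v) w"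
proof -
  note [measurable] = A_op_L2(1)[THEN L2_measurable, OF u] A_op_L2(1)[THEN L2_measurable, OF v]
  have "inner_p p (A_op \<gamma> (\<lambda>x. a * u x + b * v x)) w = inner_p p (\<lambda>x. a * A_op \<gamma> u x + b * A_op \<gamma> v x) w"
    by (rule inner_p_cong_AE[OF A_op_lincomb[OF u v] L2_measurable[OF A_op_L2(1)[OF H1_lincomb(1)[OF u v]]] _ H1_wgrad(3)[OF w]]) measurable
  then show ?thesis using inner_p_lincomb[OF A_op_L2(1)[OF u] A_op_L2(1)[OF v] H1_wgrad(3)[OF w]] by simp
qed

text \<open>Polarization of the vanishing diagonal at u + v. The factors 1 in \<open>?s\<close>
  match the form of the linear combination lemmas.\<close>

lemma A_op_skew:
  assumes u: "u \<in> H1 p" and v: "v \<in> H1 p"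
  shows "inner_p p (A_op \<gamma> u) v = - inner_p p (A_op \<gamma> v) u"
proof -
  have diag: "inner_p p (A_op \<gamma> w) w = 0" if "w \<in> H1 p" for w
    using A_op_diag[OF H1_wgrad(1,3,2)[OF that]] by (simp add: inner_p_def A_op_def)
  let ?s = "\<lambda>x. 1 * u x + 1 * v x"
  have s: "?s \<in> H1 p" by (rule H1_lincomb(1)[OF u v])
  have "0 = inner_p p (A_op \<gamma> ?s) ?s" using diag[OF s] by simp
  also have "\<dots> = inner_p p (A_op \<gamma> u) ?s + inner_p p (A_op \<gamma> v) ?s"
    using inner_p_A_op_lincomb[OF u v s, of 1 1] by simp
  also have "inner_p p (A_op \<gamma> u) ?s = inner_p p (A_op \<gamma> u) u + inner_p p (A_op \<gamma> u) v"
    using inner_p_lincomb[OF H1_wgrad(3)[OF u] H1_wgrad(3)[OF v] A_op_L2(1)[OF u], of 1 1]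
    by (simp add: inner_p_commute[of "A_op \<gamma> u"])
  also have "inner_p p (A_op \<gamma> v) ?s = inner_p p (A_op \<gamma> v) u + inner_p p (A_op \<gamma> v) v"
    using inner_p_lincomb[OF H1_wgrad(3)[OF u] H1_wgrad(3)[OF v] A_op_L2(1)[OF v], of 1 1]
    by (simp add: inner_p_commute[of "A_op \<gamma> v"])
  finally show ?thesis using diag[OF u] diag[OF v] by simp
qed

lemma D_nonneg: "0 \<le> D"
  using bound_\<gamma>[of 0] norm_ge_zero[of "\<gamma> 0"] by linarith

text \<open>In the bound, D comes from |\<gamma> \<bullet> \<nabla>u| \<le> D |\<nabla>u|, and sqrt
  C from the Poincare inequality applied to \<open>v\<close>.\<close>

sublocale H: hilbert_skew "H1 p" "inner_1 p" "\<lambda>u v. inner_p p (A_op \<gamma> u) v" "D * sqrt C"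
proof -
  interpret H: hilbert "H1 p" "inner_1 p" by (rule hilbert_H1)
  show "hilbert_skew (H1 p) (inner_1 p) (\<lambda>u v. inner_p p (A_op \<gamma> u) v) (D * sqrt C)"
  proof
    show "0 \<le> D * sqrt C" using D_nonneg C_nonneg by simp
    show "\<bar>inner_p p (A_op \<gamma> u) v\<bar> \<le> D * sqrt C * H.nrm u * H.nrm v" if "u \<in> H1 p" "v \<in> H1 p" for u v
    proof -
      have "sqrt (\<integral>x. (A_op \<gamma> u x)\<^sup>2 \<partial>pmeas p) \<le> sqrt (D\<^sup>2 * inner_1 p u u)"
        by (rule real_sqrt_le_mono[OF A_op_L2(2)[OF that(1)]])
      then have 1: "sqrt (\<integral>x. (A_op \<gamma> u x)\<^sup>2 \<partial>pmeas p) \<le> D * H.nrm u"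
        using D_nonneg by (simp add: real_sqrt_mult H.nrm_def)
      have "\<bar>inner_p p (A_op \<gamma> u) v\<bar> \<le> sqrt (\<integral>x. (A_op \<gamma> u x)\<^sup>2 \<partial>pmeas p) * (sqrt C * H.nrm v)"
        unfolding H.nrm_def by (rule inner_p_bound[OF A_op_L2(1)[OF that(1)] that(2)])
      also have "\<dots> \<le> (D * H.nrm u) * (sqrt C * H.nrm v)"
        using C_nonneg H.nrm_nonneg by (intro mult_right_mono[OF 1]) auto
      finally show ?thesis by (simp add: mult_ac)
    qed
  qed (fact inner_p_A_op_lincomb A_op_skew)+
qed


text \<open>A function in \<open>L20\<close> that is orthogonal to all of \<open>H1\<close> vanishes
  almost everywhere, so the pointwise and the weak kernel agree.\<close>

lemma ker_A_eq: "ker_A p \<gamma> = H.ker"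
proof -
  have "(AE x in pmeas p. A_op \<gamma> u x = 0) \<longleftrightarrow> (\<forall>v\<in>H1 p. inner_p p (A_op \<gamma> u) v = 0)" if u: "u \<in> H1 p" for u
  proof
    assume ae: "AE x in pmeas p. A_op \<gamma> u x = 0"
    show "\<forall>v\<in>H1 p. inner_p p (A_op \<gamma> u) v = 0"
    proof
      fix v assume "v \<in> H1 p"
      then have "inner_p p (A_op \<gamma> u) v = inner_p p (\<lambda>x. 0) v"
        by (intro inner_p_cong_AE[OF ae L2_measurable[OF A_op_L2(1)[OF u]]] H1_wgrad(3)) auto
      then show "inner_p p (A_op \<gamma> u) v = 0" by (simp add: inner_p_def)
    qed
  qed (use H1_dense[OF A_op_L20[OF u]] in blast)
  then show ?thesis unfolding ker_A_def H.ker_def by blast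
qed

section \<open>The operator S, its inverse, the Poisson equation and the asymptotic variance\<close>

lemma L20_D: "f \<in> L20 p \<Longrightarrow> L2 f" "f \<in> L20 p \<Longrightarrow> f \<in> borel_measurable borel"
  by (auto simp: L20_iff L2_measurable)

lemma L20_minus: "f \<in> L20 p \<Longrightarrow> (\<lambda>x. - f x) \<in> L20 p"
  using L20_lincomb[of f f "-1" 0] by simp

lemma inner_p_minus: "inner_p p (\<lambda>x. - f x) v = - inner_p p f v"
  by (simp add: inner_p_def)

lemma S_rel_unique:
  assumes "S_rel p u h" "S_rel p u h'"
  shows "AE x in pmeas p. h x = h' x"
proof -
  have L: "h \<in> L20 p" "h' \<in> L20 p" using assms by (auto simp: S_rel_def)
  have "(\<lambda>x. 1 * h x + (-1) * h' x) \<in> L20 p" by (rule L20_lincomb[OF L])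
  moreover have "inner_p p (\<lambda>x. 1 * h x + (-1) * h' x) v = 0" if "v \<in> H1 p" for v
    unfolding inner_p_lincomb[OF L20_D(1)[OF L(1)] L20_D(1)[OF L(2)] H1_wgrad(3)[OF that]]
    using assms that by (simp add: S_rel_def)
  ultimately have "AE x in pmeas p. 1 * h x + (-1) * h' x = 0" by (rule H1_dense)
  then show ?thesis by simp
qed

lemma S_rel_S_op: "u \<in> H2 p \<Longrightarrow> S_rel p u (S_op p u)"
  unfolding H2_def S_op_def by (auto intro: someI[where P="S_rel p u"])

lemma S_rel_imp: "S_rel p u h \<Longrightarrow> u \<in> H2 p \<and> (AE x in pmeas p. S_op p u x = h x)"
  using S_rel_S_op[of u] S_rel_unique[of u "S_op p u" h] by (auto simp: H2_def)

text \<open>The Riesz representative u of the functional v to <f, v> satisfies S u = -f by the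
  definition of \<open>S_rel\<close>, so the choice in \<open>neg_S_inv\<close> has a witness. The
  chosen element then satisfies the same weak identity as u.\<close>

lemma neg_S_inv:
  assumes f: "f \<in> L20 p"
  shows "neg_S_inv p f \<in> H1 p" "v \<in> H1 p \<Longrightarrow> inner_1 p (neg_S_inv p f) v = inner_p p f v"
proof -
  note L = L20_D(1)[OF f]
  have "\<exists>u\<in>H1 p. \<forall>v\<in>H1 p. inner_1 p u v = inner_p p f v"
  proof (rule H.Riesz)
    show "inner_p p f (\<lambda>x. a * u x + b * v x) = a * inner_p p f u + b * inner_p p f v"
      if "u \<in> H1 p" "v \<in> H1 p" for u v a b
      using inner_p_lincomb[OF H1_wgrad(3)[OF that(1)] H1_wgrad(3)[OF that(2)] L] by (simp add: inner_p_commute[of f])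
    show "\<bar>inner_p p f u\<bar> \<le> (sqrt (\<integral>x. (f x)\<^sup>2 \<partial>pmeas p) * sqrt C) * H.nrm u" if "u \<in> H1 p" for u
      using inner_p_bound[OF L that] by (simp add: H.nrm_def mult.assoc)
  qed
  then obtain u where u: "u \<in> H1 p" "\<And>v. v \<in> H1 p \<Longrightarrow> inner_1 p u v = inner_p p f v" by blast
  have "S_rel p u (\<lambda>x. - f x)"
    using u L20_minus[OF f] by (simp add: S_rel_def inner_p_minus)
  from S_rel_imp[OF this] have "u \<in> H2 p \<and> (AE x in pmeas p. - S_op p u x = f x)" by auto
  then have n: "neg_S_inv p f \<in> H2 p \<and> (AE x in pmeas p. - S_op p (neg_S_inv p f) x = f x)"
    unfolding neg_S_inv_def by (rule someI[where P="\<lambda>u. u \<in> H2 p \<and> (AE x in pmeas p. - S_op p u x = f x)"])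
  then have S: "S_rel p (neg_S_inv p f) (S_op p (neg_S_inv p f))" using S_rel_S_op by blast
  then show "neg_S_inv p f \<in> H1 p" by (simp add: S_rel_def)
  assume v: "v \<in> H1 p"
  have Sm: "S_op p (neg_S_inv p f) \<in> borel_measurable borel" using S L20_D(2) by (auto simp: S_rel_def)
  have "inner_p p (S_op p (neg_S_inv p f)) v = inner_p p (\<lambda>x. - f x) v"
    by (rule inner_p_cong_AE[OF _ Sm _ H1_wgrad(3)[OF v]]) (use n L20_D(2)[OF L20_minus[OF f]] in auto)
  then show "inner_1 p (neg_S_inv p f) v = inner_p p f v"
    using S v by (simp add: S_rel_def inner_p_minus)
qed

text \<open>Links the operator equation on the domain of S to the abstract equation in H1. The
  nontrivial direction gains the domain: a weak solution \<phi> satisfies the form identity with S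
  \<phi> = -f - \<alpha> A \<phi>, which lies in \<open>L20\<close>, and this is what membership in
  \<open>H2\<close> means.\<close>

lemma poisson_solution_iff:
  assumes f: "f \<in> L20 p"
  shows "poisson_solution p \<gamma> \<alpha> f \<phi> \<longleftrightarrow> H.solves \<alpha> (neg_S_inv p f) \<phi>"
proof
  have combo: "(\<lambda>x. (-1) * f x + (-\<alpha>) * A_op \<gamma> \<phi> x) \<in> L20 p" if "\<phi> \<in> H1 p"
    by (rule L20_lincomb[OF f A_op_L20[OF that]])
  have inner: "inner_p p (\<lambda>x. (-1) * f x + (-\<alpha>) * A_op \<gamma> \<phi> x) v = - inner_p p f v - \<alpha> * inner_p p (A_op \<gamma> \<phi>) v"
    if "\<phi> \<in> H1 p" "v \<in> H1 p" for v
    using inner_p_lincomb[OF L20_D(1)[OF f] A_op_L2(1)[OF that(1)] H1_wgrad(3)[OF that(2)], of "-1" "-\<alpha>"] by simp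
  {
    assume "poisson_solution p \<gamma> \<alpha> f \<phi>"
    then have S: "S_rel p \<phi> (S_op p \<phi>)" and ae: "AE x in pmeas p. - L_op p \<gamma> \<alpha> \<phi> x = f x"
      using S_rel_S_op by (auto simp: poisson_solution_def)
    have \<phi>: "\<phi> \<in> H1 p" and Sm: "S_op p \<phi> \<in> borel_measurable borel" using S L20_D(2) by (auto simp: S_rel_def)
    have ae': "AE x in pmeas p. S_op p \<phi> x = (-1) * f x + (-\<alpha>) * A_op \<gamma> \<phi> x"
      using ae by eventually_elim (simp add: L_op_def)
    show "H.solves \<alpha> (neg_S_inv p f) \<phi>"
      unfolding H.solves_def
    proof (intro conjI ballI neg_S_inv(1)[OF f] \<phi>)
      fix v assume v: "v \<in> H1 p"
      have "inner_p p (S_op p \<phi>) v = - inner_p p f v - \<alpha> * inner_p p (A_op \<gamma> \<phi>) v"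
        using inner_p_cong_AE[OF ae' Sm L20_D(2)[OF combo[OF \<phi>]] H1_wgrad(3)[OF v]] inner[OF \<phi> v] by simp
      moreover have "inner_p p (S_op p \<phi>) v = - inner_1 p \<phi> v" using S v by (simp add: S_rel_def)
      ultimately show "inner_1 p \<phi> v - \<alpha> * inner_p p (A_op \<gamma> \<phi>) v = inner_1 p (neg_S_inv p f) v"
        using neg_S_inv(2)[OF f v] by simp
    qed
  }
  {
    assume "H.solves \<alpha> (neg_S_inv p f) \<phi>"
    then have \<phi>: "\<phi> \<in> H1 p" and eq: "\<And>v. v \<in> H1 p \<Longrightarrow> inner_1 p \<phi> v - \<alpha> * inner_p p (A_op \<gamma> \<phi>) v = inner_p p f v"
      using neg_S_inv(2)[OF f] by (auto simp: H.solves_def)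
    have "S_rel p \<phi> (\<lambda>x. (-1) * f x + (-\<alpha>) * A_op \<gamma> \<phi> x)"
      unfolding S_rel_def
    proof (intro conjI ballI \<phi> combo)
      fix v assume v: "v \<in> H1 p"
      show "inner_p p (\<lambda>x. (-1) * f x + (-\<alpha>) * A_op \<gamma> \<phi> x) v = - inner_1 p \<phi> v"
        unfolding inner[OF \<phi> v] using eq[OF v] by simp
    qed
    from S_rel_imp[OF this] show "poisson_solution p \<gamma> \<alpha> f \<phi>"
      by (auto simp: poisson_solution_def L_op_def)
  }
qed

text \<open>The \<open>THE\<close> is legitimate because all solutions have the same squared H1
  norm.\<close>

lemma asymptotic_variance_eq:
  assumes f: "f \<in> L20 p" and sol: "H.solves \<alpha> (neg_S_inv p f) \<phi>"
  shows "asymptotic_variance p \<gamma> f \<alpha> = 2 * inner_1 p \<phi> \<phi>"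
  unfolding asymptotic_variance_def inner_1_self[symmetric] poisson_solution_iff[OF f]
proof (rule the_equality)
  show "\<exists>\<phi>'. H.solves \<alpha> (neg_S_inv p f) \<phi>' \<and> 2 * inner_1 p \<phi> \<phi> = 2 * inner_1 p \<phi>' \<phi>'" using sol by blast
  fix s assume "\<exists>\<phi>'. H.solves \<alpha> (neg_S_inv p f) \<phi>' \<and> s = 2 * inner_1 p \<phi>' \<phi>'"
  then show "s = 2 * inner_1 p \<phi> \<phi>" using H.solves_unique[OF sol] by auto
qed

lemma proj_1_ker:
  assumes "u \<in> H1 p"
  shows "proj_1 p (ker_A p \<gamma>) u \<in> H.ker"
    "k \<in> H.ker \<Longrightarrow> inner_1 p (\<lambda>x. u x - proj_1 p (ker_A p \<gamma>) u x) k = 0"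
proof -
  have "\<exists>w. w \<in> H.ker \<and> (\<forall>g\<in>H.ker. inner_1 p (\<lambda>x. u x - w x) g = 0)"
    using H.projection[OF _ H.hilbert_ker assms] by (auto simp: H.ker_def)
  from someI_ex[OF this]
  show "proj_1 p (ker_A p \<gamma>) u \<in> H.ker" "k \<in> H.ker \<Longrightarrow> inner_1 p (\<lambda>x. u x - proj_1 p (ker_A p \<gamma>) u x) k = 0"
    unfolding proj_1_def ker_A_eq by blast+
qed

lemma norm_1_sq: "(norm_1 p u)\<^sup>2 = inner_1 p u u"
  by (simp add: norm_1_def inner_1_self)

lemma cinner_1_eq: "cinner_1 p = H.cip"
  by (intro ext) (simp add: cinner_1_def H.cip_def)

lemma G_op:
  assumes "u \<in> H1 p"
  shows "G_op p \<gamma> u \<in> H1 p" "v \<in> H1 p \<Longrightarrow> inner_1 p (G_op p \<gamma> u) v = inner_p p (A_op \<gamma> u) v"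
  unfolding G_op_def using neg_S_inv[OF A_op_L20[OF assms]] by auto

lemma inner_1_cong:
  assumes "f \<in> H1 p" "g \<in> H1 p" "AE x in pmeas p. f x = g x" "v \<in> H1 p"
  shows "inner_1 p f v = inner_1 p g v"
  using H1_cong_AE(2)[OF assms(1) L2_measurable[OF H1_wgrad(3)[OF assms(2)]] assms(3)]
  by (intro inner_1_cong_AE assms) auto

text \<open>From \<Gamma> = -\<i> G, the eigenvalue equation reads G e = \<i> l e. As the
  complexified G acts on real and imaginary parts separately, this splits into G (Re e) = -l Im e
  and G (Im e) = l Re e, which are then paired with \<open>v\<close>.\<close>

lemma Gamma_op_eigen:
  assumes e: "e \<in> cplx_space (H1 p)" and ae: "AE x in pmeas p. Gamma_op p \<gamma> e x = complex_of_real l * e x" and v: "v \<in> H1 p"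
  shows "inner_p p (A_op \<gamma> (\<lambda>x. Re (e x))) v = - (l * inner_1 p (\<lambda>x. Im (e x)) v)"
    "inner_p p (A_op \<gamma> (\<lambda>x. Im (e x))) v = l * inner_1 p (\<lambda>x. Re (e x)) v"
proof -
  have r: "(\<lambda>x. Re (e x)) \<in> H1 p" and i: "(\<lambda>x. Im (e x)) \<in> H1 p" using e by (auto simp: cplx_space_def)
  have ae1: "AE x in pmeas p. G_op p \<gamma> (\<lambda>x. Re (e x)) x = (-l) * Im (e x)"
    using ae by eventually_elim (simp add: Gamma_op_def cplx_op_def complex_eq_iff)
  have ae2: "AE x in pmeas p. G_op p \<gamma> (\<lambda>x. Im (e x)) x = l * Re (e x)"
    using ae by eventually_elim (simp add: Gamma_op_def cplx_op_def complex_eq_iff)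
  show "inner_p p (A_op \<gamma> (\<lambda>x. Re (e x))) v = - (l * inner_1 p (\<lambda>x. Im (e x)) v)"
    using inner_1_cong[OF G_op(1)[OF r] H.scale_mem[OF i] ae1 v] G_op(2)[OF r v] H.ip_scale[OF i v, of "-l"] by simp
  show "inner_p p (A_op \<gamma> (\<lambda>x. Im (e x))) v = l * inner_1 p (\<lambda>x. Re (e x)) v"
    using inner_1_cong[OF G_op(1)[OF i] H.scale_mem[OF r] ae2 v] G_op(2)[OF i v] H.ip_scale[OF r v, of l] by simp
qed

lemma variance_expansion:
  fixes f :: "'a \<Rightarrow> real"
  defines "h \<equiv> neg_S_inv p f"
  assumes f: "f \<in> L20 p"
    and basis: "orthonormal_basis_1 p (orth_1 p (cplx_space (ker_A p \<gamma>))) I e"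
    and eigen: "\<And>n. n \<in> I \<Longrightarrow> AE x in pmeas p. Gamma_op p \<gamma> (e n) x = complex_of_real (l n) * e n x"
  shows "((\<lambda>n. (cmod (cinner_1 p (\<lambda>x. complex_of_real (h x)) (e n)))\<^sup>2 / (1 + \<alpha>\<^sup>2 * (l n)\<^sup>2)) has_sum
     (asymptotic_variance p \<gamma> f \<alpha> / 2 - (norm_1 p (proj_1 p (ker_A p \<gamma>) h))\<^sup>2)) I"
proof -
  have h: "h \<in> H1 p" unfolding h_def by (rule neg_S_inv(1)[OF f])
  obtain \<phi> where \<phi>: "H.solves \<alpha> h \<phi>" using H.solves_exists[OF h] by blast
  have e: "e n \<in> orth_1 p (cplx_space (ker_A p \<gamma>))" if "n \<in> I" for n
    using basis that by (auto simp: orthonormal_basis_1_def)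
  have eC: "e n \<in> cplx_space (H1 p)" if "n \<in> I" for n using e[OF that] by (simp add: orth_1_def)
  have "((\<lambda>n. (cmod (H.cip (\<lambda>x. complex_of_real (h x)) (e n)))\<^sup>2 / (1 + \<alpha>\<^sup>2 * (l n)\<^sup>2)) has_sum
     (inner_1 p \<phi> \<phi> - inner_1 p (proj_1 p (ker_A p \<gamma>) h) (proj_1 p (ker_A p \<gamma>) h))) I"
  proof (rule H.spectral_expansion[OF \<phi> proj_1_ker(1)[OF h] proj_1_ker(2)[OF h]])
    show "e n \<in> cplx_space (H1 p)" if "n \<in> I" for n by (rule eC[OF that])
    show "H.cip (e n) k = 0" if "n \<in> I" "k \<in> cplx_space H.ker" for n k
      using e[OF that(1)] that(2) by (simp add: orth_1_def ker_A_eq cinner_1_eq)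
    show "H.cip (e m) (e n) = (if m = n then 1 else 0)" if "m \<in> I" "n \<in> I" for m n
      using basis that by (simp add: orthonormal_basis_1_def cinner_1_eq)
    show "\<exists>J c. finite J \<and> J \<subseteq> I \<and> sqrt (Re (H.cip (\<lambda>x. g x - (\<Sum>n\<in>J. c n * e n x)) (\<lambda>x. g x - (\<Sum>n\<in>J. c n * e n x)))) < \<epsilon>"
      if "g \<in> cplx_space (H1 p)" "\<And>k. k \<in> cplx_space H.ker \<Longrightarrow> H.cip g k = 0" "0 < \<epsilon>" for g \<epsilon>
    proof -
      have "g \<in> orth_1 p (cplx_space (ker_A p \<gamma>))" using that(1,2) by (simp add: orth_1_def ker_A_eq cinner_1_eq)
      then show ?thesis using basis that(3) unfolding orthonormal_basis_1_def cnorm_1_def cinner_1_eq by blast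
    qed
  qed (use Gamma_op_eigen[OF eC eigen] in auto)
  then show ?thesis
    using asymptotic_variance_eq[OF f \<phi>[unfolded h_def]] by (simp add: norm_1_sq cinner_1_eq)
qed

lemma variance_limits:
  fixes f :: "'a \<Rightarrow> real"
  defines "h \<equiv> neg_S_inv p f"
  assumes f: "f \<in> L20 p"
  shows "(asymptotic_variance p \<gamma> f \<longlongrightarrow> 2 * (norm_1 p h)\<^sup>2) (at 0)"
    "asymptotic_variance p \<gamma> f 0 = 2 * (norm_1 p h)\<^sup>2"
    "filterlim (\<lambda>\<alpha>. \<bar>\<alpha>\<bar>) at_top F \<Longrightarrow> (asymptotic_variance p \<gamma> f \<longlongrightarrow> 2 * (norm_1 p (proj_1 p (ker_A p \<gamma>) h))\<^sup>2) F"
proof -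
  have h: "h \<in> H1 p" unfolding h_def by (rule neg_S_inv(1)[OF f])
  define \<phi> where "\<phi> = (\<lambda>\<alpha>. SOME \<phi>. H.solves \<alpha> h \<phi>)"
  have \<phi>: "H.solves \<alpha> h (\<phi> \<alpha>)" for \<alpha>
    unfolding \<phi>_def using someI_ex[OF H.solves_exists[OF h]] .
  have av: "asymptotic_variance p \<gamma> f = (\<lambda>\<alpha>. 2 * inner_1 p (\<phi> \<alpha>) (\<phi> \<alpha>))"
    using asymptotic_variance_eq[OF f] \<phi> unfolding h_def by blast
  show "(asymptotic_variance p \<gamma> f \<longlongrightarrow> 2 * (norm_1 p h)\<^sup>2) (at 0)"
    unfolding av norm_1_sq by (intro tendsto_mult_left H.solves_tendsto_zero[OF \<phi>])
  \<comment> \<open>At \<alpha> = 0 the skew term disappears, so h solves its own equation.\<close>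
  have "H.solves 0 h h" using h by (simp add: H.solves_def)
  then show "asymptotic_variance p \<gamma> f 0 = 2 * (norm_1 p h)\<^sup>2"
    unfolding h_def norm_1_sq by (rule asymptotic_variance_eq[OF f])
  show "(asymptotic_variance p \<gamma> f \<longlongrightarrow> 2 * (norm_1 p (proj_1 p (ker_A p \<gamma>) h))\<^sup>2) F"
    if "filterlim (\<lambda>\<alpha>. \<bar>\<alpha>\<bar>) at_top F"
    unfolding av norm_1_sq
    by (intro tendsto_mult_left H.solves_tendsto_inf[OF \<phi> proj_1_ker(1)[OF h] proj_1_ker(2)[OF h] that])
qed

end

theorem theorem4:
  fixes p :: "'a::euclidean_space \<Rightarrow> real"
    and \<gamma> :: "'a \<Rightarrow> 'a"
    and f :: "'a \<Rightarrow> real"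
    and \<alpha> \<beta> :: real
  defines "fhat \<equiv> neg_S_inv p f"
  defines "fhatN \<equiv> proj_1 p (ker_A p \<gamma>) fhat"
  assumes "smooth p" and "\<And>x. 0 < p x" and "prob_space (pmeas p)"
    and "smooth \<gamma>" and "\<And>x. divergence (\<lambda>y. p y *\<^sub>R \<gamma> y) x = 0"
    and "bounded (range p)" and "0 < \<beta>" and "\<beta> < 1"
    and "0 < Liminf at_infinity (\<lambda>x. ereal
           ((1 - \<beta>) * (norm (grad (\<lambda>y. ln (p y)) x))\<^sup>2 + laplacian (\<lambda>y. ln (p y)) x))"
    and "filterlim (\<lambda>x. norm (grad (\<lambda>y. ln (p y)) x)) at_top at_infinity"
    and "bounded (range \<gamma>)"
    and "f \<in> L20 p"
  shows "(\<forall>(I :: nat set) (e :: nat \<Rightarrow> 'a \<Rightarrow> complex) (l :: nat \<Rightarrow> real).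
            (I = {1..} \<or> (\<exists>m. I = {1..m})) \<longrightarrow>
            orthonormal_basis_1 p (orth_1 p (cplx_space (ker_A p \<gamma>))) I e \<longrightarrow>
            (\<forall>n\<in>I. AE x in pmeas p. Gamma_op p \<gamma> (e n) x = complex_of_real (l n) * e n x) \<longrightarrow>
            (\<lambda>n. (cmod (cinner_1 p (\<lambda>x. complex_of_real (fhat x)) (e n)))\<^sup>2
                  / (1 + \<alpha>\<^sup>2 * (l n)\<^sup>2)) summable_on I \<and>
            asymptotic_variance p \<gamma> f \<alpha> =
              2 * (norm_1 p fhatN)\<^sup>2 +
              2 * (\<Sum>\<^sub>\<infinity>n\<in>I. (cmod (cinner_1 p (\<lambda>x. complex_of_real (fhat x)) (e n)))\<^sup>2
                           / (1 + \<alpha>\<^sup>2 * (l n)\<^sup>2))) \<and>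
         (asymptotic_variance p \<gamma> f \<longlongrightarrow> asymptotic_variance p \<gamma> f 0) (at 0) \<and>
         asymptotic_variance p \<gamma> f 0 = 2 * (norm_1 p fhat)\<^sup>2 \<and>
         (asymptotic_variance p \<gamma> f \<longlongrightarrow> 2 * (norm_1 p fhatN)\<^sup>2) at_top \<and>
         (asymptotic_variance p \<gamma> f \<longlongrightarrow> 2 * (norm_1 p fhatN)\<^sup>2) at_bot"
proof -
  have "weight p"
    unfolding weight_def using \<open>smooth p\<close> \<open>\<And>x. 0 < p x\<close> \<open>prob_space (pmeas p)\<close> \<open>bounded (range p)\<close> by blast
  then interpret weight p .
  obtain R C' \<theta> where lyap: "0 < R" "0 \<le> C'" "0 < \<theta>"
    "\<And>x. (\<theta> - C' * indicator (cball 0 R) x) * p x \<le> \<beta> * (laplacian p x - \<beta> * (norm (grad p x))\<^sup>2 / p x)"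
  proof (rule Lyapunov_condition[OF assms(9,11)])
    fix R C' \<theta> assume "0 < R" "0 \<le> C'" "0 < \<theta>"
      "\<And>x. (\<theta> - C' * indicator (cball 0 R) x) * p x \<le> \<beta> * (laplacian p x - \<beta> * (norm (grad p x))\<^sup>2 / p x)"
    then show thesis by (rule that)
  qed
  obtain C where C: "0 \<le> C" "\<And>u g. weak_gradient u g \<Longrightarrow> L2 u \<Longrightarrow> L2 g \<Longrightarrow> (\<integral>x. u x \<partial>pmeas p) = 0 \<Longrightarrow>
      (\<integral>x. (u x)\<^sup>2 \<partial>pmeas p) \<le> C * (\<integral>x. (norm (g x))\<^sup>2 \<partial>pmeas p)"
  proof (rule Poincare[OF lyap])
    fix C assume "0 \<le> C" "\<And>u g. weak_gradient u g \<Longrightarrow> L2 u \<Longrightarrow> L2 g \<Longrightarrow> (\<integral>x. u x \<partial>pmeas p) = 0 \<Longrightarrow>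
      (\<integral>x. (u x)\<^sup>2 \<partial>pmeas p) \<le> C * (\<integral>x. (norm (g x))\<^sup>2 \<partial>pmeas p)"
    then show thesis by (rule that)
  qed
  obtain D where D: "\<And>x. norm (\<gamma> x) \<le> D" using assms(13) by (auto simp: bounded_iff)
  have "drift p \<gamma> D C"
    unfolding drift_def drift_axioms_def
    using \<open>weight p\<close> \<open>smooth \<gamma>\<close> \<open>\<And>x. divergence (\<lambda>y. p y *\<^sub>R \<gamma> y) x = 0\<close> D C by blast
  then interpret drift p \<gamma> D C .
  note f = \<open>f \<in> L20 p\<close>
  note lim = variance_limits[OF f, folded fhat_def, folded fhatN_def]
  show ?thesis
  proof (intro conjI allI impI)
    fix I :: "nat set" and e :: "nat \<Rightarrow> 'a \<Rightarrow> complex" and l :: "nat \<Rightarrow> real"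
    assume basis: "orthonormal_basis_1 p (orth_1 p (cplx_space (ker_A p \<gamma>))) I e"
      and eigen: "\<forall>n\<in>I. AE x in pmeas p. Gamma_op p \<gamma> (e n) x = complex_of_real (l n) * e n x"
    have hs: "((\<lambda>n. (cmod (cinner_1 p (\<lambda>x. complex_of_real (fhat x)) (e n)))\<^sup>2 / (1 + \<alpha>\<^sup>2 * (l n)\<^sup>2)) has_sum
       (asymptotic_variance p \<gamma> f \<alpha> / 2 - (norm_1 p fhatN)\<^sup>2)) I"
      unfolding fhatN_def fhat_def using eigen by (intro variance_expansion[OF f basis]) auto
    then show "(\<lambda>n. (cmod (cinner_1 p (\<lambda>x. complex_of_real (fhat x)) (e n)))\<^sup>2 / (1 + \<alpha>\<^sup>2 * (l n)\<^sup>2)) summable_on I"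
      by (rule has_sum_imp_summable)
    show "asymptotic_variance p \<gamma> f \<alpha> = 2 * (norm_1 p fhatN)\<^sup>2 +
        2 * (\<Sum>\<^sub>\<infinity>n\<in>I. (cmod (cinner_1 p (\<lambda>x. complex_of_real (fhat x)) (e n)))\<^sup>2 / (1 + \<alpha>\<^sup>2 * (l n)\<^sup>2))"
      unfolding infsumI[OF hs] by simp
  next
    show "asymptotic_variance p \<gamma> f 0 = 2 * (norm_1 p fhat)\<^sup>2" by (rule lim(2))
    show "(asymptotic_variance p \<gamma> f \<longlongrightarrow> asymptotic_variance p \<gamma> f 0) (at 0)"
      unfolding lim(2) by (rule lim(1))
    show "(asymptotic_variance p \<gamma> f \<longlongrightarrow> 2 * (norm_1 p fhatN)\<^sup>2) at_top"
      by (rule lim(3)[OF filterlim_abs_real])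
    show "(asymptotic_variance p \<gamma> f \<longlongrightarrow> 2 * (norm_1 p fhatN)\<^sup>2) at_bot"
      \<comment> \<open>Reflection \<alpha> to -\<alpha> leaves |\<alpha>| unchanged, so the limit
        at minus infinity is an instance of the same filter statement.\<close>
      by (rule lim(3)) (auto simp: filterlim_at_bot_mirror filterlim_abs_real)
  qed
qed

end
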